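(* Let $k$ be a differential field of characteristic zero, let $E$ be a liouvillian extension of $k$, and let $K$ be a differential field with $k\subset K\subset E$. Then: I. $K=k\langle u_1,\dots,u_l\rangle$ for some finite list of elements $u_1,\dots,u_l\in K$ such that for each $i$, $u_i$ satisfies a linear homogeneous differential equation over $k\langle u_1,\dots,u_{i-1}\rangle$. II. If $E=k(t_1,\dots,t_n)$ is an iterated antiderivative extension of $k$ with $C_E=C_k$, then $K$ is an iterated antiderivative extension of $k$; that is, $K=k(v_1,\dots,v_m)$ where $v_i'\in k(v_1,\dots,v_{i-1})$ for each $i$. III. If $k$ is an algebraically closed field and $K\neq k$, then there is an element $u\in K-k$ such that $u'=au+b$ for some $a,b\in k$. IV. If $k$ is an algebraically closed field, $c'=0$ for all $c\in k$, and $K\neq k$, then there is an element $z\in K-k$ such that either $z'=1$ or $z'=az$ for some element $a\in k$.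
   Context: A differential field is a field with a derivation $'$; a differential field extension is a field extension to which the derivation extends; intermediate differential fields carry the restricted derivation. $C_F=\{x\in F: x'=0\}$ denotes the field of constants of a differential field $F$. $K-k$ denotes the set of elements of $K$ not in $k$. For a differential field extension $E$ of $k$ and $u_1,\dots,u_i\in E$, $k(u_1,\dots,u_i)$ is the subfield, and $k\langle u_1,\dots,u_i\rangle$ the differential subfield, of $E$ generated over $k$ by $u_1,\dots,u_i$ (for $i=0$ both are $k$). A differential field extension $E$ of $k$ is a liouvillian extension of $k$ if $E=k(t_1,\dots,t_n)$ and there is a tower of differential fields $k=k_0\subset k_1\subset\cdots\subset k_n=E$ such that for each $i$, $k_i=k_{i-1}(t_i)$ and either $t_i'\in k_{i-1}$, or $t_i'/t_i\in k_{i-1}$ (with $t_i\ne 0$), or $t_i$ is algebraic over $k_{i-1}$. If moreover $t_i'\in k_{i-1}$ for every $i$, then $E$ is called an iterated antiderivative extension of $k$. A linear homogeneous differential equation over a differential field $F$ is an equation $Y^{(m)}+a_{m-1}Y^{(m-1)}+\cdots+a_1Y'+a_0Y=0$ with $m\ge 1$ and $a_0,\dots,a_{m-1}\in F$. *)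

theory Defs
  imports "HOL.Hull" "HOL-Computational_Algebra.Computational_Algebra"
begin

text \<open>
  All fields live inside one ambient field given by a type \<open>'a\<close>, which carries a derivation \<open>D\<close>.
  Subfields are sets of elements of \<open>'a\<close>, and the derivation on each of them is the restriction
  of \<open>D\<close>. An extension \<open>E\<close> of \<open>k\<close> can always be taken as its own ambient field.
\<close>

definition derivation :: "('a::field \<Rightarrow> 'a) \<Rightarrow> bool" where
  "derivation D \<longleftrightarrow>
     (\<forall>x y. D (x + y) = D x + D y) \<and> (\<forall>x y. D (x * y) = D x * y + x * D y)"

definition subfield :: "'a::field set \<Rightarrow> bool" where
  "subfield F \<longleftrightarrow>
     0 \<in> F \<and> 1 \<in> F \<and> (\<forall>x\<in>F. \<forall>y\<in>F. x + y \<in> F \<and> x * y \<in> F) \<and>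
     (\<forall>x\<in>F. - x \<in> F \<and> inverse x \<in> F)"

definition diff_subfield :: "('a::field \<Rightarrow> 'a) \<Rightarrow> 'a set \<Rightarrow> bool" where
  "diff_subfield D F \<longleftrightarrow> subfield F \<and> (\<forall>x\<in>F. D x \<in> F)"

definition constants :: "('a::field \<Rightarrow> 'a) \<Rightarrow> 'a set \<Rightarrow> 'a set" where
  "constants D F = {x \<in> F. D x = 0}"

text \<open>\<open>adjoin k S\<close> is $k(S)$ and \<open>diff_adjoin D k S\<close> is $k\langle S\rangle$.\<close>

definition adjoin :: "'a::field set \<Rightarrow> 'a set \<Rightarrow> 'a set" where
  "adjoin k S = subfield hull (k \<union> S)"

definition diff_adjoin :: "('a::field \<Rightarrow> 'a) \<Rightarrow> 'a set \<Rightarrow> 'a set \<Rightarrow> 'a set" where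
  "diff_adjoin D k S = diff_subfield D hull (k \<union> S)"

definition algebraic_over :: "'a::field set \<Rightarrow> 'a \<Rightarrow> bool" where
  "algebraic_over F x \<longleftrightarrow> (\<exists>p. p \<noteq> 0 \<and> (\<forall>i. coeff p i \<in> F) \<and> poly p x = 0)"

definition alg_closed :: "'a::field set \<Rightarrow> bool" where
  "alg_closed F \<longleftrightarrow> (\<forall>p. (\<forall>i. coeff p i \<in> F) \<and> degree p > 0 \<longrightarrow> (\<exists>x\<in>F. poly p x = 0))"

text \<open>
  Finite lists of elements are functions on \<open>nat\<close> restricted to \<open>{..<n}\<close>, so the generators
  are numbered from 0: \<open>t i\<close> generates \<open>F (Suc i)\<close> over \<open>F i\<close>. The empty list is allowed,
  and inclusions in a tower need not be proper.
\<close>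

definition diff_tower ::
  "('a::field \<Rightarrow> 'a) \<Rightarrow> 'a set \<Rightarrow> 'a set \<Rightarrow> nat \<Rightarrow> (nat \<Rightarrow> 'a) \<Rightarrow> (nat \<Rightarrow> 'a set) \<Rightarrow> bool" where
  "diff_tower D k E n t F \<longleftrightarrow>
     E = adjoin k (t ` {..<n}) \<and> F 0 = k \<and> F n = E \<and>
     (\<forall>i\<le>n. diff_subfield D (F i)) \<and>
     (\<forall>i<n. F (Suc i) = adjoin (F i) {t i})"

definition liouvillian_ext :: "('a::field \<Rightarrow> 'a) \<Rightarrow> 'a set \<Rightarrow> 'a set \<Rightarrow> bool" where
  "liouvillian_ext D k E \<longleftrightarrow>
     (\<exists>n t F. diff_tower D k E n t F \<and>
        (\<forall>i<n. D (t i) \<in> F i \<or> (t i \<noteq> 0 \<and> D (t i) / t i \<in> F i) \<or> algebraic_over (F i) (t i)))"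

definition iterated_antiderivative_ext :: "('a::field \<Rightarrow> 'a) \<Rightarrow> 'a set \<Rightarrow> 'a set \<Rightarrow> bool" where
  "iterated_antiderivative_ext D k E \<longleftrightarrow>
     (\<exists>n t F. diff_tower D k E n t F \<and> (\<forall>i<n. D (t i) \<in> F i))"

definition satisfies_lhde :: "('a::field \<Rightarrow> 'a) \<Rightarrow> 'a set \<Rightarrow> 'a \<Rightarrow> bool" where
  "satisfies_lhde D F y \<longleftrightarrow>
     (\<exists>m a. m \<ge> 1 \<and> (\<forall>j<m. a j \<in> F) \<and> (D ^^ m) y + (\<Sum>j<m. a j * (D ^^ j) y) = 0)"

end

theory Submission
  imports "HOL-Algebra.Algebraic_Closure_Type" Defs
begin

text \<open>
  Everything rests on one existence statement. Let \<open>k \<subset> K\<close> be algebraically closed differential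
  fields, and let \<open>K\<close> lie in the algebraic closure of a liouvillian tower over \<open>k\<close>. Then some
  \<open>u \<in> K - k\<close> satisfies \<open>u' = a u + b\<close> with \<open>a, b \<in> k\<close> (\<open>first_order_element_closed\<close>).

  The proof is an induction that removes the lowest generator \<open>t\<close> of the tower. If \<open>t\<close> lies in \<open>k\<close>
  or in \<open>K\<close>, there is little to do. Otherwise the algebraic closure of \<open>K(t)\<close> lies in a shorter
  tower over the algebraic closure of \<open>k(t)\<close>, and the induction gives \<open>u\<close> in the former, outside
  the latter, with \<open>u' = a u + b\<close> and \<open>a, b\<close> algebraic over \<open>k(t)\<close>. Expand \<open>u, a, b\<close> in Puiseux
  series in \<open>1/t\<close> (\<open>puiseux_root\<close>, \<open>puiseux_expansion\<close>). The coefficients of \<open>u\<close> lie in \<open>K\<close> and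
  those of \<open>a, b\<close> in \<open>k\<close> (\<open>algebraic_series_coefficients\<close>), and not all coefficients of \<open>u\<close> lie in
  \<open>k\<close>, because \<open>u\<close> would then be algebraic over \<open>k(t)\<close> (\<open>algebraic_if_coefficients\<close>). If
  \<open>f = t'\<close> or \<open>f = t'/t\<close> lies in \<open>k\<close>, the derivative of \<open>c t\<^sup>r\<close> is \<open>c' t\<^sup>r\<close> plus \<open>r f c\<close> times \<open>t\<^sup>r\<^sup>-\<^sup>1\<close>
  or \<open>t\<^sup>r\<close>. So comparing coefficients shows that the first coefficient of \<open>u\<close> outside \<open>k\<close> satisfies a
  first-order equation over \<open>k\<close> (\<open>first_order_coefficient\<close>).

  For the given fields this is applied inside an algebraic closure, to which the derivation extends
  (\<open>extend_derivation\<close>). It yields \<open>u\<close> algebraic over \<open>K\<close> and transcendental over \<open>k\<close> with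
  \<open>u' = a u + b\<close>, where \<open>a, b\<close> are algebraic over \<open>k\<close>, and one has to come back to \<open>K\<close>.

  If \<open>k\<close> is algebraically closed, then \<open>a, b \<in> k\<close>, and the coefficients of the minimal polynomial of
  \<open>u\<close> over \<open>K\<close> satisfy a triangular system of first-order equations over \<open>k\<close>. The highest one outside
  \<open>k\<close> is the element required in part III (\<open>first_order_descent\<close>). Part IV follows by replacing \<open>u\<close>
  by \<open>u + b/a\<close> or \<open>u/b\<close>.

  For arbitrary \<open>k\<close>, the element \<open>u\<close> lies in a finite-dimensional \<open>k\<close>-space that is closed under the
  derivation. The same holds for its conjugates over \<open>K\<close>, and then for the coefficients of the
  minimal polynomial, which are polynomials in the conjugates. One of these coefficients is
  transcendental over \<open>k\<close> and satisfies a linear homogeneous equation (\<open>holonomic_descent\<close>). Adjoining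
  it to \<open>k\<close> lowers a transcendence degree (\<open>independent_generators_decrease\<close>), so that after
  finitely many steps \<open>K\<close> is algebraic over the field reached. Then \<open>K\<close> is generated by finitely many
  further elements (\<open>algebraic_intermediate_finite\<close>), which satisfy linear equations because they are
  algebraic. This is part I.

  Part II repeats the induction without algebraic closures. As there are no new constants, an
  antiderivative is transcendental or already present (\<open>algebraic_antiderivative\<close>), so \<open>K(t)\<close> embeds
  into Laurent series in \<open>1/t\<close> and \<open>k\<close> is relatively algebraically closed in \<open>E\<close>. The equation now
  has \<open>a = 0\<close>, and the comparison of coefficients keeps this (\<open>antiderivative_element\<close>).
\<close>

section \<open>Subfields and polynomials over them\<close>

lemma subfield_closed:
  assumes "subfield F"
  shows subfield_0: "0 \<in> F" and subfield_1: "1 \<in> F"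
    and subfield_add: "x \<in> F \<Longrightarrow> y \<in> F \<Longrightarrow> x + y \<in> F"
    and subfield_mult: "x \<in> F \<Longrightarrow> y \<in> F \<Longrightarrow> x * y \<in> F"
    and subfield_uminus: "x \<in> F \<Longrightarrow> - x \<in> F"
    and subfield_inverse: "x \<in> F \<Longrightarrow> inverse x \<in> F"
  using assms by (auto simp: subfield_def)

lemma subfield_diff: "subfield F \<Longrightarrow> x \<in> F \<Longrightarrow> y \<in> F \<Longrightarrow> x - y \<in> F"
  using subfield_add[of F x "- y"] subfield_uminus[of F y] by simp

lemma subfield_divide: "subfield F \<Longrightarrow> x \<in> F \<Longrightarrow> y \<in> F \<Longrightarrow> x / y \<in> F"
  by (simp add: divide_inverse subfield_mult subfield_inverse)

lemma subfield_sum: "subfield F \<Longrightarrow> (\<And>i. i \<in> A \<Longrightarrow> f i \<in> F) \<Longrightarrow> sum f A \<in> F"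
  by (induction A rule: infinite_finite_induct) (auto simp: subfield_0 subfield_add)

lemma subfield_power: "subfield F \<Longrightarrow> x \<in> F \<Longrightarrow> x ^ n \<in> F"
  by (induction n) (auto simp: subfield_1 subfield_mult)

lemma subfield_of_nat: "subfield F \<Longrightarrow> of_nat n \<in> F"
  by (induction n) (auto simp: subfield_0 subfield_1 subfield_add)

lemma subfield_of_int: "subfield F \<Longrightarrow> of_int n \<in> F"
  by (cases n) (auto simp: subfield_of_nat subfield_uminus simp del: of_nat_Suc)

lemmas subfield_intros = subfield_0 subfield_1 subfield_add subfield_mult subfield_uminus
  subfield_inverse subfield_diff subfield_divide subfield_sum  subfield_power
  subfield_of_nat subfield_of_int

lemma subfield_UNIV: "subfield UNIV"
  by (simp add: subfield_def)

lemma subfield_hull: "subfield (subfield hull S)"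
  by (rule hull_in) (fastforce simp: subfield_def)

definition polys_over :: "'a::field set \<Rightarrow> 'a poly set" where
  "polys_over F = {p. \<forall>i. coeff p i \<in> F}"

lemma polys_overI: "(\<And>i. coeff p i \<in> F) \<Longrightarrow> p \<in> polys_over F"
  by (simp add: polys_over_def)

lemma polys_overD: "p \<in> polys_over F \<Longrightarrow> coeff p i \<in> F"
  by (simp add: polys_over_def)

lemma polys_over_mono: "F \<subseteq> G \<Longrightarrow> p \<in> polys_over F \<Longrightarrow> p \<in> polys_over G"
  by (auto simp: polys_over_def)

context
  fixes F :: "'a::field set" assumes F: "subfield F"
begin

lemma polys_over_0: "0 \<in> polys_over F"
  by (auto simp: polys_over_def subfield_0[OF F])

lemma polys_over_pCons: "c \<in> F \<Longrightarrow> p \<in> polys_over F \<Longrightarrow> pCons c p \<in> polys_over F"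
  by (auto simp: polys_over_def coeff_pCons split: nat.splits)

lemma polys_over_1: "1 \<in> polys_over F"
  unfolding one_pCons by (intro polys_over_pCons polys_over_0 subfield_1[OF F])

lemma polys_over_add: "p \<in> polys_over F \<Longrightarrow> q \<in> polys_over F \<Longrightarrow> p + q \<in> polys_over F"
  by (auto simp: polys_over_def subfield_add[OF F])

lemma polys_over_uminus: "p \<in> polys_over F \<Longrightarrow> - p \<in> polys_over F"
  by (auto simp: polys_over_def subfield_uminus[OF F])

lemma polys_over_diff: "p \<in> polys_over F \<Longrightarrow> q \<in> polys_over F \<Longrightarrow> p - q \<in> polys_over F"
  by (auto simp: polys_over_def subfield_diff[OF F])

lemma polys_over_smult: "c \<in> F \<Longrightarrow> q \<in> polys_over F \<Longrightarrow> smult c q \<in> polys_over F"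
  by (auto simp: polys_over_def subfield_mult[OF F])

lemma polys_over_monom: "c \<in> F \<Longrightarrow> monom c n \<in> polys_over F"
  by (auto simp: polys_over_def subfield_0[OF F])

lemma polys_over_mult: "p \<in> polys_over F \<Longrightarrow> q \<in> polys_over F \<Longrightarrow> p * q \<in> polys_over F"
  by (auto simp: polys_over_def coeff_mult intro!: subfield_sum[OF F] subfield_mult[OF F])

lemma polys_over_sum: "(\<And>i. i \<in> A \<Longrightarrow> f i \<in> polys_over F) \<Longrightarrow> sum f A \<in> polys_over F"
  by (auto simp: polys_over_def coeff_sum intro!: subfield_sum[OF F])

lemma polys_over_pderiv: "p \<in> polys_over F \<Longrightarrow> pderiv p \<in> polys_over F"
  by (auto simp: polys_over_def coeff_pderiv simp del: of_nat_Suc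
      intro!: subfield_mult[OF F] subfield_of_nat[OF F])

lemma polys_over_pcompose: "p \<in> polys_over F \<Longrightarrow> q \<in> polys_over F \<Longrightarrow> p \<circ>\<^sub>p q \<in> polys_over F"
proof (induction p)
  case (pCons c p)
  have "c \<in> F" using polys_overD[OF pCons.prems(1), of 0] by simp
  moreover have "p \<in> polys_over F"
    using pCons.prems(1) by (intro polys_overI) (metis coeff_pCons_Suc polys_overD)
  ultimately show ?case
    using pCons by (auto simp: pcompose_pCons intro!: polys_over_add polys_over_mult
        polys_over_pCons polys_over_0)
qed (simp add: polys_over_0)

lemma poly_in_subfield: "p \<in> polys_over F \<Longrightarrow> x \<in> F \<Longrightarrow> poly p x \<in> F"
  by (auto simp: polys_over_def poly_altdef intro!: subfield_intros[OF F])

text \<open>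
  Long division only divides by the leading coefficient of the divisor, so it stays inside \<open>F[X]\<close>.
\<close>

lemma polys_over_division:
  assumes "q \<in> polys_over F" "q \<noteq> 0" "p \<in> polys_over F"
  shows "\<exists>s\<in>polys_over F. \<exists>r\<in>polys_over F. p = s * q + r \<and> (r = 0 \<or> degree r < degree q)"
  using assms(3)
proof (induction "degree p" arbitrary: p rule: less_induct)
  case less
  show ?case
  proof (cases "p = 0 \<or> degree p < degree q")
    case True
    then show ?thesis using less.prems polys_over_0 by (intro bexI[of _ 0] bexI[of _ p]) auto
  next
    case False
    define m where "m = monom (lead_coeff p / lead_coeff q) (degree p - degree q)"
    define p' where "p' = p - m * q"
    have m: "m \<in> polys_over F"
      unfolding m_def using less.prems assms by (intro polys_over_monom subfield_divide[OF F] polys_overD)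
    have p': "p' \<in> polys_over F"
      unfolding p'_def using less.prems assms m by (intro polys_over_diff polys_over_mult)
    have lq: "lead_coeff q \<noteq> 0" using assms by simp
    have m0: "m \<noteq> 0" using False assms unfolding m_def by (auto simp: monom_eq_0_iff)
    have deg: "degree (m * q) = degree p"
      using m0 assms False by (subst degree_mult_eq) (auto simp: m_def degree_monom_eq)
    have lead: "coeff (m * q) (degree p) = lead_coeff p"
      using lead_coeff_mult[of m q] lq False unfolding deg by (simp add: m_def degree_monom_eq)
    have le: "degree p' \<le> degree p" unfolding p'_def using deg degree_diff_le[of p "degree p" "m * q"] by simp
    have c0: "coeff p' (degree p) = 0" unfolding p'_def using lead by simp
    show ?thesis
    proof (cases "degree p' < degree p")
      case True
      from less.hyps[OF True p'] obtain s r where sr: "s \<in> polys_over F" "r \<in> polys_over F"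
        "p' = s * q + r" "r = 0 \<or> degree r < degree q" by blast
      have "p = (s + m) * q + r" using sr(3) unfolding p'_def by (simp add: algebra_simps)
      then show ?thesis using sr m polys_over_add by blast
    next
      case False
      then have "p' = 0" using le c0 by (metis leading_coeff_0_iff order_le_imp_less_or_eq)
      then have "p = m * q + 0" unfolding p'_def by simp
      then show ?thesis using m polys_over_0 by blast
    qed
  qed
qed

text \<open>
  Take a polynomial of least degree and make it monic. Division with remainder turns minimality of
  the degree into divisibility; both forms are used later.
\<close>

lemma minimal_polynomial:
  assumes "algebraic_over F x"
  obtains p where "p \<in> polys_over F" "lead_coeff p = 1" "degree p > 0" "poly p x = 0"
    "\<And>q. q \<in> polys_over F \<Longrightarrow> poly q x = 0 \<Longrightarrow> \<exists>s\<in>polys_over F. q = s * p"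
    "\<And>q. q \<in> polys_over F \<Longrightarrow> poly q x = 0 \<Longrightarrow> q \<noteq> 0 \<Longrightarrow> degree p \<le> degree q"
proof -
  define P where "P p \<longleftrightarrow> p \<noteq> 0 \<and> p \<in> polys_over F \<and> poly p x = 0" for p
  have "\<exists>p. P p" using assms by (auto simp: algebraic_over_def P_def polys_over_def)
  define p0 where "p0 = arg_min degree P"
  have p0: "P p0" and min: "\<And>q. P q \<Longrightarrow> degree p0 \<le> degree q"
    using arg_min_nat_lemma[of P _ degree] \<open>\<exists>p. P p\<close> unfolding p0_def by blast+
  define p where "p = smult (inverse (lead_coeff p0)) p0"
  have l0: "lead_coeff p0 \<noteq> 0" using p0 by (simp add: P_def)
  have p: "p \<in> polys_over F" "lead_coeff p = 1" "poly p x = 0" "degree p = degree p0"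
    using p0 l0 by (auto simp: p_def P_def intro!: polys_over_smult subfield_inverse[OF F] polys_overD)
  have pn: "p \<noteq> 0" using p(2) by auto
  have min': "degree p \<le> degree q" if "q \<in> polys_over F" "poly q x = 0" "q \<noteq> 0" for q
    using min[of q] that p(4) by (auto simp: P_def)
  show thesis
  proof (rule that[of p])
    show "degree p > 0"
    proof (rule ccontr)
      assume "\<not> degree p > 0"
      then obtain c where "p = [:c:]" by (metis degree_eq_zeroE gr0I)
      with p(3) pn show False by simp
    qed
  next
    fix q assume q: "q \<in> polys_over F" "poly q x = 0"
    obtain s r where sr: "s \<in> polys_over F" "r \<in> polys_over F" "q = s * p + r"
      "r = 0 \<or> degree r < degree p"
      using polys_over_division[OF p(1) pn q(1)] by blast
    have "poly r x = 0" using q(2) p(3) sr(3) by simp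
    then have "r = 0" using min'[of r] sr by fastforce
    with sr show "\<exists>s\<in>polys_over F. q = s * p" by auto
  qed (use p min' in auto)
qed

end

text \<open>
  In characteristic zero the derivative of \<open>p\<close> is nonzero and of smaller degree, so that it cannot
  vanish at \<open>x\<close>.
\<close>

lemma minimal_polynomial_separable:
  fixes x :: "'a::field_char_0"
  assumes F: "subfield F" and "p \<in> polys_over F" "degree p > 0"
    "\<And>q. q \<in> polys_over F \<Longrightarrow> poly q x = 0 \<Longrightarrow> q \<noteq> 0 \<Longrightarrow> degree p \<le> degree q"
  shows "poly (pderiv p) x \<noteq> 0"
proof
  assume "poly (pderiv p) x = 0"
  moreover have "pderiv p \<noteq> 0" using assms by (simp add: pderiv_eq_0_iff)
  ultimately have "degree p \<le> degree (pderiv p)"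
    using assms(4) polys_over_pderiv[OF F assms(2)] by blast
  then show False using assms(3) by (simp add: degree_pderiv)
qed

section \<open>Linear algebra over a subfield\<close>

text \<open>
  One Gaussian elimination serves two purposes. A system with coefficients in \<open>F\<close> has a nonzero
  solution in \<open>F\<close> if there are more unknowns than equations, and also if it has a nonzero solution
  in a larger field. Eliminating one unknown by means of one equation preserves either hypothesis.
\<close>

lemma homogeneous_system:
  assumes F: "subfield F"
  shows "finite I \<Longrightarrow> (\<And>r i. r \<in> R \<Longrightarrow> i \<in> I \<Longrightarrow> A r i \<in> F) \<Longrightarrow>
    finite R \<and> card R < card I \<or> (\<exists>c. (\<exists>i\<in>I. c i \<noteq> 0) \<and> (\<forall>r\<in>R. (\<Sum>i\<in>I. A r i * c i) = 0)) \<Longrightarrow>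
    \<exists>e. (\<forall>i\<in>I. e i \<in> F) \<and> (\<exists>i\<in>I. e i \<noteq> 0) \<and> (\<forall>r\<in>R. (\<Sum>i\<in>I. A r i * e i) = 0)"
proof (induction "card I" arbitrary: I R A)
  case 0
  then show ?case by auto
next
  case (Suc n)
  show ?case
  proof (cases "\<forall>r\<in>R. \<forall>i\<in>I. A r i = 0")
    case True
    obtain i where "i \<in> I" using Suc.hyps(2) by (metis card.empty equals0I nat.distinct(1))
    then show ?thesis using True subfield_1[OF F] by (intro exI[of _ "\<lambda>_. 1"]) auto
  next
    case False
    then obtain r0 i0 where i0: "r0 \<in> R" "i0 \<in> I" "A r0 i0 \<noteq> 0" by auto
    define J where "J = I - {i0}"
    define S where "S = R - {r0}"
    define B where "B r i = A r i - A r i0 / A r0 i0 * A r0 i" for r i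
    have key: "(\<Sum>i\<in>I. A r i * x i) = (\<Sum>i\<in>J. B r i * x i)"
      if "x i0 = - (\<Sum>i\<in>J. A r0 i * x i) / A r0 i0" for r x
    proof -
      have "(\<Sum>i\<in>I. A r i * x i) = A r i0 * x i0 + (\<Sum>i\<in>J. A r i * x i)"
        unfolding J_def using i0 Suc.prems(1) by (simp add: sum.remove)
      also have "\<dots> = (\<Sum>i\<in>J. A r i * x i) - A r i0 / A r0 i0 * (\<Sum>i\<in>J. A r0 i * x i)"
        by (simp add: that)
      also have "\<dots> = (\<Sum>i\<in>J. B r i * x i)"
        unfolding B_def sum_distrib_left sum_subtractf[symmetric]
        by (rule sum.cong) (auto simp: algebra_simps)
      finally show ?thesis .
    qed
    have fin: "n = card J" "finite J" using Suc.hyps(2) Suc.prems(1) i0 by (auto simp: J_def)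
    have BF: "B r i \<in> F" if "r \<in> S" "i \<in> J" for r i
      unfolding B_def using that Suc.prems(2) i0 by (auto simp: J_def S_def intro!: subfield_intros[OF F])
    have "finite S \<and> card S < card J \<or> (\<exists>c. (\<exists>i\<in>J. c i \<noteq> 0) \<and> (\<forall>r\<in>S. (\<Sum>i\<in>J. B r i * c i) = 0))"
      using Suc.prems(3)
    proof
      assume R: "finite R \<and> card R < card I"
      then have "card R > 0" using i0(1) by (auto simp: card_gt_0_iff)
      then have "finite S \<and> card S < card J" using R i0 Suc.prems(1) by (auto simp: S_def J_def)
      then show ?thesis ..
    next
      assume "\<exists>c. (\<exists>i\<in>I. c i \<noteq> 0) \<and> (\<forall>r\<in>R. (\<Sum>i\<in>I. A r i * c i) = 0)"
      then obtain c where c: "\<exists>i\<in>I. c i \<noteq> 0" "\<And>r. r \<in> R \<Longrightarrow> (\<Sum>i\<in>I. A r i * c i) = 0" by blast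
      have ci0: "c i0 = - (\<Sum>i\<in>J. A r0 i * c i) / A r0 i0"
      proof -
        have "0 = A r0 i0 * c i0 + (\<Sum>i\<in>J. A r0 i * c i)"
          using c(2)[OF i0(1)] i0 Suc.prems(1) by (simp add: J_def sum.remove)
        then show ?thesis using i0 by (simp add: field_simps eq_neg_iff_add_eq_0)
      qed
      have "\<exists>i\<in>J. c i \<noteq> 0"
      proof (rule ccontr)
        assume "\<not> ?thesis"
        then have "c i0 = 0" using ci0 by (auto intro!: sum.neutral)
        with \<open>\<not> ?thesis\<close> c(1) show False by (auto simp: J_def)
      qed
      moreover have "(\<Sum>i\<in>J. B r i * c i) = 0" if "r \<in> S" for r
        using key[of c r] ci0 c(2)[of r] that by (simp add: S_def)
      ultimately show ?thesis by blast
    qed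
    from Suc.hyps(1)[OF fin BF this] obtain e where e: "\<forall>i\<in>J. e i \<in> F" "\<exists>i\<in>J. e i \<noteq> 0"
      "\<forall>r\<in>S. (\<Sum>i\<in>J. B r i * e i) = 0" by blast
    define e' where "e' = e(i0 := - (\<Sum>i\<in>J. A r0 i * e i) / A r0 i0)"
    have eqJ: "(\<Sum>i\<in>J. a i * e' i) = (\<Sum>i\<in>J. a i * e i)" for a
      by (rule sum.cong) (auto simp: e'_def J_def)
    have "(\<Sum>i\<in>J. B r0 i * e i) = 0" using i0 by (auto simp: B_def intro!: sum.neutral)
    then have "(\<Sum>i\<in>I. A r i * e' i) = 0" if "r \<in> R" for r
      using key[of e' r] e(3) that unfolding eqJ by (cases "r = r0") (auto simp: e'_def S_def)
    moreover have "\<forall>i\<in>I. e' i \<in> F"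
      using e i0 Suc.prems(2) by (auto simp: e'_def J_def intro!: subfield_intros[OF F])
    moreover have "\<exists>i\<in>I. e' i \<noteq> 0" using e(2) by (auto simp: e'_def J_def)
    ultimately show ?thesis by blast
  qed
qed

definition fspan :: "'a::field set \<Rightarrow> 'a set \<Rightarrow> 'a set" where
  "fspan F B = {\<Sum>b\<in>B. c b * b | c. \<forall>b\<in>B. c b \<in> F}"

definition fsubspace :: "'a::field set \<Rightarrow> 'a set \<Rightarrow> bool" where
  "fsubspace F V \<longleftrightarrow> 0 \<in> V \<and> (\<forall>x\<in>V. \<forall>y\<in>V. x + y \<in> V) \<and> (\<forall>c\<in>F. \<forall>x\<in>V. c * x \<in> V)"

lemma fsubspace_sum: "fsubspace F V \<Longrightarrow> (\<And>i. i \<in> A \<Longrightarrow> f i \<in> V) \<Longrightarrow> sum f A \<in> V"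
  by (induction A rule: infinite_finite_induct) (auto simp: fsubspace_def)

lemma fsubspace_fspan:
  assumes F: "subfield F"
  shows "fsubspace F (fspan F B)"
proof -
  have "0 \<in> fspan F B"
    unfolding fspan_def using subfield_0[OF F] by (intro CollectI exI[of _ "\<lambda>_. 0"]) auto
  moreover have "x + y \<in> fspan F B" if xy: "x \<in> fspan F B" "y \<in> fspan F B" for x y
  proof -
    obtain c d where "\<forall>b\<in>B. c b \<in> F" "x = (\<Sum>b\<in>B. c b * b)" "\<forall>b\<in>B. d b \<in> F" "y = (\<Sum>b\<in>B. d b * b)"
      using xy unfolding fspan_def by auto
    then show ?thesis unfolding fspan_def
      by (intro CollectI exI[of _ "\<lambda>b. c b + d b"])
        (auto simp: sum.distrib algebra_simps subfield_add[OF F])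
  qed
  moreover have "a * x \<in> fspan F B" if ax: "x \<in> fspan F B" "a \<in> F" for x a
  proof -
    obtain c where "\<forall>b\<in>B. c b \<in> F" "x = (\<Sum>b\<in>B. c b * b)"
      using ax unfolding fspan_def by auto
    then show ?thesis unfolding fspan_def using ax
      by (intro CollectI exI[of _ "\<lambda>b. a * c b"])
        (auto simp: sum_distrib_left algebra_simps subfield_mult[OF F])
  qed
  ultimately show ?thesis by (auto simp: fsubspace_def)
qed

lemma fspan_superset:
  assumes F: "subfield F" and "finite B"
  shows "B \<subseteq> fspan F B"
proof
  fix b assume b: "b \<in> B"
  have "(\<Sum>x\<in>B. (if x = b then 1 else 0) * x) = (\<Sum>x\<in>B. if x = b then x else 0)"
    by (rule sum.cong) auto
  also have "\<dots> = b" using b assms by simp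
  finally show "b \<in> fspan F B" unfolding fspan_def using subfield_0[OF F] subfield_1[OF F]
    by (intro CollectI exI[of _ "\<lambda>x. if x = b then 1 else 0"]) auto
qed

lemma fspan_minimal: "fsubspace F V \<Longrightarrow> B \<subseteq> V \<Longrightarrow> fspan F B \<subseteq> V"
  unfolding fspan_def by (auto intro!: fsubspace_sum) (auto simp: fsubspace_def)

text \<open>
  Expressing the vectors by the spanning set turns a dependence into a system with more unknowns
  than equations.
\<close>

lemma fspan_dependent:
  assumes F: "subfield F" and B: "finite B" and "card B < n" and w: "\<And>i. i < n \<Longrightarrow> w i \<in> fspan F B"
  shows "\<exists>e. (\<forall>i<n. e i \<in> F) \<and> (\<exists>i<n. e i \<noteq> 0) \<and> (\<Sum>i<n. e i * w i) = 0"
proof -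
  have "\<forall>i\<in>{..<n}. \<exists>c. (\<forall>b\<in>B. c b \<in> F) \<and> w i = (\<Sum>b\<in>B. c b * b)"
    using w unfolding fspan_def by auto
  from bchoice[OF this] obtain c where c: "\<And>i. i < n \<Longrightarrow> (\<forall>b\<in>B. c i b \<in> F) \<and> w i = (\<Sum>b\<in>B. c i b * b)"
    by auto
  obtain f where f: "bij_betw f {..<card B} B"
    using ex_bij_betw_nat_finite[OF B] by (auto simp: atLeast0LessThan)
  have fB: "f r \<in> B" if "r < card B" for r using f that by (auto simp: bij_betw_def)
  obtain e where e: "\<forall>i\<in>{..<n}. e i \<in> F" "\<exists>i\<in>{..<n}. e i \<noteq> 0"
    "\<forall>r\<in>{..<card B}. (\<Sum>i\<in>{..<n}. c i (f r) * e i) = 0"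
    using homogeneous_system[OF F, of "{..<n}" "{..<card B}" "\<lambda>r i. c i (f r)"] assms(3) c fB by auto
  have "(\<Sum>i<n. e i * w i) = (\<Sum>i<n. \<Sum>b\<in>B. e i * (c i b * b))"
    using c by (auto simp: sum_distrib_left intro!: sum.cong)
  also have "\<dots> = (\<Sum>b\<in>B. \<Sum>i<n. e i * (c i b * b))" by (rule sum.swap)
  also have "\<dots> = (\<Sum>b\<in>B. (\<Sum>i<n. c i b * e i) * b)"
    unfolding sum_distrib_right by (intro sum.cong refl) (simp add: algebra_simps)
  also have "\<dots> = (\<Sum>r<card B. (\<Sum>i<n. c i (f r) * e i) * f r)"
    by (rule sum.reindex_bij_betw[OF f, symmetric])
  also have "\<dots> = 0" using e(3) by (auto intro!: sum.neutral)
  finally show ?thesis using e by auto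
qed

section \<open>Algebraic elements\<close>

text \<open>
  Algebraic elements are handled through finite-dimensional algebras. An element is algebraic if it
  lies in one, and finitely many algebraic elements lie in a common one. Closure under the field
  operations and transitivity then become statements about finite spanning sets.
\<close>

definition finite_algebra :: "'a::field set \<Rightarrow> 'a set \<Rightarrow> bool" where
  "finite_algebra F V \<longleftrightarrow> (\<exists>B. finite B \<and> V = fspan F B) \<and> 1 \<in> V \<and> (\<forall>x\<in>V. \<forall>y\<in>V. x * y \<in> V)"

lemma finite_algebra_subspace: "subfield F \<Longrightarrow> finite_algebra F V \<Longrightarrow> fsubspace F V"
  by (auto simp: finite_algebra_def fsubspace_fspan)

lemma finite_algebra_power: "finite_algebra F V \<Longrightarrow> x \<in> V \<Longrightarrow> x ^ n \<in> V"
  by (induction n) (auto simp: finite_algebra_def)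

text \<open>The powers of \<open>x\<close> cannot all be independent in a finite-dimensional space.\<close>

lemma algebraic_over_if_powers:
  assumes F: "subfield F" and "finite B" "\<And>i. x ^ i \<in> fspan F B"
  shows "algebraic_over F x"
proof -
  define n where "n = Suc (card B)"
  obtain e where e: "\<forall>i<n. e i \<in> F" "\<exists>i<n. e i \<noteq> 0" "(\<Sum>i<n. e i * x ^ i) = 0"
    using fspan_dependent[OF F assms(2), of n "\<lambda>i. x ^ i"] assms(3) by (auto simp: n_def)
  define p where "p = (\<Sum>i<n. monom (e i) i)"
  have co: "coeff p i = (if i < n then e i else 0)" for i
    by (auto simp: p_def coeff_sum if_distrib cong: if_cong)
  have "p \<noteq> 0" using e(2) co by (metis coeff_0)
  moreover have "poly p x = 0" using e(3) by (simp add: p_def poly_sum poly_monom)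
  ultimately show ?thesis unfolding algebraic_over_def
    using co e(1) subfield_0[OF F] by (intro exI[of _ p]) auto
qed

lemma finite_algebra_algebraic:
  "subfield F \<Longrightarrow> finite_algebra F V \<Longrightarrow> x \<in> V \<Longrightarrow> algebraic_over F x"
  using algebraic_over_if_powers finite_algebra_power unfolding finite_algebra_def by metis

lemma algebraic_over_mono: "F \<subseteq> G \<Longrightarrow> algebraic_over F x \<Longrightarrow> algebraic_over G x"
  by (auto simp: algebraic_over_def)

lemma algebraic_over_self:
  assumes F: "subfield F" and "x \<in> F"
  shows "algebraic_over F x"
  unfolding algebraic_over_def using assms
  by (intro exI[of _ "[:- x, 1:]"]) (auto simp: coeff_pCons subfield_intros[OF F] split: nat.splits)

definition span_product :: "'a::field set \<Rightarrow> 'a set \<Rightarrow> 'a set \<Rightarrow> 'a set" where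
  "span_product F B C = fspan F ((\<lambda>(b, c). b * c) ` (B \<times> C))"

lemma span_product_mult:
  assumes F: "subfield F" and fin: "finite B" "finite C" and "x \<in> fspan F B" "y \<in> fspan F C"
  shows "x * y \<in> span_product F B C"
proof -
  let ?V = "span_product F B C"
  have V: "fsubspace F ?V" unfolding span_product_def by (rule fsubspace_fspan[OF F])
  have gen: "b * c \<in> ?V" if "b \<in> B" "c \<in> C" for b c
    unfolding span_product_def using that fin by (intro subsetD[OF fspan_superset[OF F]]) auto
  have "fspan F B \<subseteq> {x. \<forall>c\<in>C. x * c \<in> ?V}"
    using V gen by (intro fspan_minimal) (auto simp: fsubspace_def algebra_simps)
  then have "fspan F C \<subseteq> {y. x * y \<in> ?V}"
    using V assms(4) by (intro fspan_minimal) (auto simp: fsubspace_def algebra_simps)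
  then show ?thesis using assms(5) by blast
qed

text \<open>
  The products of generators span an algebra that contains both factors. The minimality clause
  allows closure properties of \<open>U\<close> to be checked on products \<open>x y\<close> only.
\<close>

lemma finite_algebra_product:
  assumes F: "subfield F" and V: "finite_algebra F V" and W: "finite_algebra F W"
  obtains U where "finite_algebra F U" "V \<subseteq> U" "W \<subseteq> U"
    "\<And>T. fsubspace F T \<Longrightarrow> (\<And>x y. x \<in> V \<Longrightarrow> y \<in> W \<Longrightarrow> x * y \<in> T) \<Longrightarrow> U \<subseteq> T"
    "\<And>x y. x \<in> V \<Longrightarrow> y \<in> W \<Longrightarrow> x * y \<in> U"
proof -
  obtain B C where B: "finite B" "V = fspan F B" and C: "finite C" "W = fspan F C"
    using V W by (auto simp: finite_algebra_def)
  define U where "U = span_product F B C"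
  have prod: "x * y \<in> U" if "x \<in> V" "y \<in> W" for x y
    using span_product_mult[OF F B(1) C(1)] that B C by (simp add: U_def)
  have sub: "V \<subseteq> U" "W \<subseteq> U"
    using prod[of _ 1] prod[of 1] V W by (auto simp: finite_algebra_def)
  have Us: "fsubspace F U" unfolding U_def span_product_def by (rule fsubspace_fspan[OF F])
  have gen: "U \<subseteq> T" if "fsubspace F T" "\<And>x y. x \<in> V \<Longrightarrow> y \<in> W \<Longrightarrow> x * y \<in> T" for T
    unfolding U_def span_product_def
    using that fspan_superset[OF F B(1)] fspan_superset[OF F C(1)] B C
    by (intro fspan_minimal) auto
  have 1: "x * y * z \<in> U" if "x \<in> V" "y \<in> W" "z \<in> U" for x y z
  proof -
    have "U \<subseteq> {z. x * y * z \<in> U}"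
    proof (rule gen)
      fix v w assume vw: "v \<in> V" "w \<in> W"
      have "(x * v) * (y * w) \<in> U" using that vw V W by (intro prod) (auto simp: finite_algebra_def)
      then show "v * w \<in> {z. x * y * z \<in> U}" by (simp add: algebra_simps)
    qed (use Us in \<open>auto simp: fsubspace_def algebra_simps\<close>)
    then show ?thesis using that by auto
  qed
  have "x * z \<in> U" if "x \<in> U" "z \<in> U" for x z
  proof -
    have "U \<subseteq> {x. x * z \<in> U}"
      by (rule gen) (use Us 1 that in \<open>auto simp: fsubspace_def algebra_simps\<close>)
    then show ?thesis using that by auto
  qed
  moreover have "\<exists>B. finite B \<and> U = fspan F B"
    unfolding U_def span_product_def by (rule exI, rule conjI[OF _ refl]) (use B C in simp)
  moreover have "1 \<in> V" using V unfolding finite_algebra_def by (elim conjE)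
  then have "1 \<in> U" using sub by (rule_tac subsetD)
  ultimately have "finite_algebra F U" unfolding finite_algebra_def by (intro conjI ballI) simp_all
  from that[OF this sub gen prod] show ?thesis .
qed

text \<open>
  A monic relation expresses \<open>x\<^sup>d\<close>, and hence every higher power of \<open>x\<close>, by lower powers with
  coefficients in \<open>V\<close>. So \<open>V[x]\<close> is finite-dimensional over \<open>F\<close>. For \<open>V = F\<close> this concerns \<open>F[x]\<close>;
  for larger \<open>V\<close> it is the step behind the transitivity of algebraicity.
\<close>

lemma powers_in_span_of_monic_relation:
  assumes F: "subfield F" and V: "finite_algebra F V"
    and p: "lead_coeff p = 1" "\<And>i. coeff p i \<in> V" "poly p x = 0"
  obtains B where "finite B" "\<And>v n. v \<in> V \<Longrightarrow> v * x ^ n \<in> fspan F B"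
    "\<And>T. fsubspace F T \<Longrightarrow> (\<And>v n. v \<in> V \<Longrightarrow> v * x ^ n \<in> T) \<Longrightarrow> fspan F B \<subseteq> T"
proof -
  obtain B where B: "finite B" "V = fspan F B" using V by (auto simp: finite_algebra_def)
  define d where "d = degree p"
  define C where "C = (\<lambda>i. x ^ i) ` {..<d}"
  define U where "U = span_product F B C"
  have fC: "finite C" by (simp add: C_def)
  have Vs: "fsubspace F V" using finite_algebra_subspace[OF F V] .
  have Us: "fsubspace F U" unfolding U_def span_product_def by (rule fsubspace_fspan[OF F])
  have low: "v * x ^ i \<in> U" if "v \<in> V" "i < d" for v i
    unfolding U_def using that B fC fspan_superset[OF F fC]
    by (intro span_product_mult[OF F]) (auto simp: C_def)
  have all: "\<forall>v\<in>V. v * x ^ n \<in> U" for n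
  proof (induction n rule: less_induct)
    case (less n)
    show ?case
    proof (cases "n < d")
      case True then show ?thesis using low by blast
    next
      case False
      have "0 = (\<Sum>i<d. coeff p i * x ^ i) + x ^ d"
        using p(1,3) by (simp add: poly_altdef d_def flip: lessThan_Suc_atMost)
      then have xd: "x ^ d = - (\<Sum>i<d. coeff p i * x ^ i)" by (simp add: eq_neg_iff_add_eq_0 add.commute)
      have "x ^ n = x ^ d * x ^ (n - d)" using False by (simp flip: power_add)
      also have "\<dots> = (\<Sum>i<d. (- 1) * coeff p i * x ^ (i + (n - d)))"
        unfolding xd by (simp add: sum_distrib_right power_add mult.assoc sum_negf)
      finally have xn: "x ^ n = \<dots>" .
      show ?thesis
      proof
        fix v assume v: "v \<in> V"
        have "(v * ((- 1) * coeff p i)) * x ^ (i + (n - d)) \<in> U" if "i < d" for i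
        proof -
          have "i + (n - d) < n" using that False by simp
          moreover have "v * ((- 1) * coeff p i) \<in> V"
            using V Vs v p(2) F unfolding finite_algebra_def fsubspace_def
            by (metis subfield_1 subfield_uminus)
          ultimately show ?thesis using less.IH by blast
        qed
        then have "(\<Sum>i<d. (v * ((- 1) * coeff p i)) * x ^ (i + (n - d))) \<in> U"
          by (intro fsubspace_sum[OF Us]) auto
        then show "v * x ^ n \<in> U" unfolding xn by (simp add: sum_distrib_left mult.assoc)
      qed
    qed
  qed
  show ?thesis
  proof (rule that)
    show "finite ((\<lambda>(b, c). b * c) ` (B \<times> C))" using B fC by auto
    show "v * x ^ n \<in> fspan F ((\<lambda>(b, c). b * c) ` (B \<times> C))" if "v \<in> V" for v n
      using all that by (auto simp: U_def span_product_def)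
    show "fspan F ((\<lambda>(b, c). b * c) ` (B \<times> C)) \<subseteq> T"
      if "fsubspace F T" "\<And>v n. v \<in> V \<Longrightarrow> v * x ^ n \<in> T" for T
      using that fspan_superset[OF F B(1)] B by (intro fspan_minimal) (auto simp: C_def)
  qed
qed

lemma finite_algebra_base: "subfield F \<Longrightarrow> finite_algebra F F"
proof -
  assume F: "subfield F"
  have "F = fspan F {1}" by (auto simp: fspan_def)
  then show ?thesis using subfield_1[OF F] subfield_mult[OF F] unfolding finite_algebra_def
    by (metis finite.emptyI finite.insertI)
qed

text \<open>
  The ring \<open>F[x]\<close>, which is a field as soon as \<open>x\<close> is algebraic over \<open>F\<close>.
\<close>

definition eval_ring :: "'a::field set \<Rightarrow> 'a \<Rightarrow> 'a set" where
  "eval_ring F x = (\<lambda>p. poly p x) ` polys_over F"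

lemma finite_algebra_eval_ring:
  assumes F: "subfield F" and x: "algebraic_over F x"
  shows "finite_algebra F (eval_ring F x)"
proof -
  obtain p where p: "p \<in> polys_over F" "lead_coeff p = 1" "poly p x = 0"
    using minimal_polynomial[OF F x] by metis
  obtain B where B: "finite B" "\<And>v n. v \<in> F \<Longrightarrow> v * x ^ n \<in> fspan F B"
    "\<And>T. fsubspace F T \<Longrightarrow> (\<And>v n. v \<in> F \<Longrightarrow> v * x ^ n \<in> T) \<Longrightarrow> fspan F B \<subseteq> T"
    using powers_in_span_of_monic_relation[OF F finite_algebra_base[OF F] p(2) polys_overD[OF p(1)] p(3)] by metis
  have ev: "fsubspace F (eval_ring F x)"
    unfolding fsubspace_def
  proof (intro conjI ballI)
    show "0 \<in> eval_ring F x"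
      unfolding eval_ring_def by (intro image_eqI[of _ _ 0] polys_over_0[OF F]) auto
    fix a b assume ab: "a \<in> eval_ring F x" "b \<in> eval_ring F x"
    then obtain p q where "p \<in> polys_over F" "q \<in> polys_over F" "a = poly p x" "b = poly q x"
      unfolding eval_ring_def by auto
    then show "a + b \<in> eval_ring F x"
      unfolding eval_ring_def by (intro image_eqI[of _ _ "p + q"] polys_over_add[OF F]) auto
  next
    fix c a assume ca: "c \<in> F" "a \<in> eval_ring F x"
    then obtain p where "p \<in> polys_over F" "a = poly p x"
      unfolding eval_ring_def by auto
    then show "c * a \<in> eval_ring F x"
      unfolding eval_ring_def using ca by (intro image_eqI[of _ _ "smult c p"] polys_over_smult[OF F]) auto
  qed
  have "eval_ring F x \<subseteq> fspan F B"
    unfolding eval_ring_def poly_altdef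
    using B(2) by (auto intro!: fsubspace_sum[OF fsubspace_fspan[OF F]] polys_overD)
  moreover have "v * x ^ n \<in> eval_ring F x" if "v \<in> F" for v n
    unfolding eval_ring_def using that by (intro image_eqI[of _ _ "monom v n"]) (auto simp: poly_monom polys_over_monom[OF F])
  then have "fspan F B \<subseteq> eval_ring F x" by (intro B(3)[OF ev])
  ultimately have "eval_ring F x = fspan F B" by blast
  moreover have "1 \<in> eval_ring F x" 
    unfolding eval_ring_def by (intro image_eqI[of _ _ 1] polys_over_1[OF F]) auto
  moreover have "a * b \<in> eval_ring F x" if "a \<in> eval_ring F x" "b \<in> eval_ring F x" for a b
  proof -
    obtain p q where "p \<in> polys_over F" "q \<in> polys_over F" "a = poly p x" "b = poly q x"
      using \<open>a \<in> _\<close> \<open>b \<in> _\<close> unfolding eval_ring_def by auto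
    then show ?thesis
      unfolding eval_ring_def by (intro image_eqI[of _ _ "p * q"] polys_over_mult[OF F]) auto
  qed
  ultimately show ?thesis using B(1) unfolding finite_algebra_def by blast
qed

lemma eval_ring_gen: "subfield F \<Longrightarrow> x \<in> eval_ring F x"
  unfolding eval_ring_def
  by (intro image_eqI[of _ _ "[:0, 1:]"]) (auto intro!: polys_over_pCons polys_over_0 subfield_0 subfield_1)

lemma eval_ring_base: "subfield F \<Longrightarrow> F \<subseteq> eval_ring F x"
  unfolding eval_ring_def
  by (auto intro!: image_eqI[of _ _ "[:_:]"] polys_over_pCons polys_over_0)

text \<open>Reversing the order of the coefficients of a polynomial inverts its nonzero roots.\<close>

lemma algebraic_over_inverse:
  assumes F: "subfield F" and x: "algebraic_over F x"
  shows "algebraic_over F (inverse x)"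
proof (cases "x = 0")
  case True then show ?thesis using x by simp
next
  case False
  obtain p where p: "p \<noteq> 0" "\<forall>i. coeff p i \<in> F" "poly p x = 0"
    using x by (auto simp: algebraic_over_def)
  have "poly (reflect_poly p) (inverse x) = 0"
    using poly_reflect_poly_nz[of "inverse x" p] False p by simp
  then show ?thesis unfolding algebraic_over_def using p subfield_0[OF F]
    by (intro exI[of _ "reflect_poly p"]) (auto simp: coeff_reflect_poly)
qed

lemma algebraic_common_algebra:
  assumes F: "subfield F"
  shows "finite C \<Longrightarrow> (\<And>c. c \<in> C \<Longrightarrow> algebraic_over F c) \<Longrightarrow> \<exists>V. finite_algebra F V \<and> C \<subseteq> V"
proof (induction C rule: finite_induct)
  case empty
  then show ?case using finite_algebra_base[OF F] by auto
next
  case (insert c C)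
  then obtain V where V: "finite_algebra F V" "C \<subseteq> V" by auto
  have W: "finite_algebra F (eval_ring F c)" using finite_algebra_eval_ring[OF F] insert by auto
  obtain U where "finite_algebra F U" "V \<subseteq> U" "eval_ring F c \<subseteq> U"
    using finite_algebra_product[OF F V(1) W] by metis
  then show ?case using V eval_ring_gen[OF F, of c] by blast
qed

lemma subfield_algebraic:
  assumes F: "subfield F"
  shows "subfield {x. algebraic_over F x}"
proof -
  have *: "algebraic_over F (x + y) \<and> algebraic_over F (x * y)"
    if xy: "algebraic_over F x" "algebraic_over F y" for x y
  proof -
    obtain V where V: "finite_algebra F V" "{x, y} \<subseteq> V"
      using algebraic_common_algebra[OF F, of "{x, y}"] xy by auto
    then have "x + y \<in> V" "x * y \<in> V"
      using finite_algebra_subspace[OF F V(1)] by (auto simp: fsubspace_def finite_algebra_def)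
    then show ?thesis using finite_algebra_algebraic[OF F V(1)] by auto
  qed
  have m1: "algebraic_over F (- 1)" using algebraic_over_self[OF F] subfield_intros[OF F] by auto
  have "algebraic_over F (- x)" if "algebraic_over F x" for x
    using *[OF m1 that] by simp
  then show ?thesis unfolding subfield_def
    using * algebraic_over_inverse[OF F] algebraic_over_self[OF F] subfield_0[OF F] subfield_1[OF F] by auto
qed

text \<open>
  The finitely many coefficients of an equation for \<open>x\<close> lie in a common finite-dimensional algebra
  \<open>V\<close>, and all powers of \<open>x\<close> lie in the finite-dimensional space \<open>V[x]\<close>.
\<close>

lemma algebraic_over_trans:
  assumes F: "subfield F" and x: "algebraic_over {y. algebraic_over F y} x"
  shows "algebraic_over F x"
proof -
  obtain p where p: "p \<in> polys_over {y. algebraic_over F y}" "lead_coeff p = 1" "poly p x = 0"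
    using minimal_polynomial[OF subfield_algebraic[OF F] x] by metis
  obtain V where V: "finite_algebra F V" "coeff p ` {..degree p} \<subseteq> V"
    using algebraic_common_algebra[OF F, of "coeff p ` {..degree p}"] p(1) by (auto simp: polys_over_def)
  have "coeff p i \<in> V" for i
  proof (cases "i \<le> degree p")
    case True then show ?thesis using V by auto
  next
    case False then show ?thesis using finite_algebra_subspace[OF F V(1)]
      by (simp add: coeff_eq_0 fsubspace_def)
  qed
  from powers_in_span_of_monic_relation[OF F V(1) p(2) this p(3)] obtain B where
    "finite B" "\<And>v n. v \<in> V \<Longrightarrow> v * x ^ n \<in> fspan F B" by metis
  moreover have "1 \<in> V" using V by (auto simp: finite_algebra_def)
  ultimately show ?thesis using algebraic_over_if_powers[OF F, of B x] by (metis mult_1)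
qed

section \<open>Relative algebraic closure and simple extensions\<close>

text \<open>
  Being defined for arbitrary sets, this is a closure operator with the exchange property
  (\<open>acl_exchange\<close>). This suffices for counting transcendental generators.
\<close>

definition acl :: "'a::field set \<Rightarrow> 'a set" where
  "acl S = {x. algebraic_over (subfield hull S) x}"

lemma subfield_acl: "subfield (acl S)"
  unfolding acl_def by (rule subfield_algebraic[OF subfield_hull])

lemma hull_subset_acl: "subfield hull S \<subseteq> acl S"
  using algebraic_over_self[OF subfield_hull] by (auto simp: acl_def)

lemma acl_superset: "S \<subseteq> acl S"
  by (rule subset_trans[OF hull_subset hull_subset_acl])

lemma acl_mono: "S \<subseteq> T \<Longrightarrow> acl S \<subseteq> acl T"
  unfolding acl_def using algebraic_over_mono[OF hull_mono] by blast

lemma acl_idem: "acl (acl S) = acl S"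
proof
  show "acl (acl S) \<subseteq> acl S"
  proof
    fix x assume "x \<in> acl (acl S)"
    then have "algebraic_over (acl S) x"
      by (simp add: acl_def[of "acl S"] hull_same[of subfield "acl S", OF subfield_acl])
    then show "x \<in> acl S" unfolding acl_def using algebraic_over_trans[OF subfield_hull] by blast
  qed
qed (rule acl_superset)

lemma acl_minimal: "S \<subseteq> acl T \<Longrightarrow> acl S \<subseteq> acl T"
  using acl_mono[of S "acl T"] acl_idem by blast

lemma acl_subfield: "subfield F \<Longrightarrow> acl F = {x. algebraic_over F x}"
  by (simp add: acl_def hull_same)

lemma acl_hull: "acl (subfield hull S) = acl S"
  by (simp add: acl_def)

lemma acl_adjoin: "acl (adjoin k S) = acl (k \<union> S)"
  by (simp add: adjoin_def acl_hull)

lemma acl_acl_Un: "acl (acl A \<union> B) = acl (A \<union> B)"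
proof
  have "acl A \<subseteq> acl (A \<union> B)" by (rule acl_mono) auto
  then show "acl (acl A \<union> B) \<subseteq> acl (A \<union> B)"
    using acl_superset[of "A \<union> B"] by (intro acl_minimal) auto
  show "acl (A \<union> B) \<subseteq> acl (acl A \<union> B)"
    using acl_superset[of A] by (intro acl_mono) auto
qed

lemma subfield_adjoin: "subfield (adjoin k S)"
  unfolding adjoin_def by (rule subfield_hull)

lemma adjoin_superset: "k \<union> S \<subseteq> adjoin k S"
  unfolding adjoin_def by (rule hull_subset)

lemma adjoin_minimal: "subfield F \<Longrightarrow> k \<subseteq> F \<Longrightarrow> S \<subseteq> F \<Longrightarrow> adjoin k S \<subseteq> F"
  unfolding adjoin_def by (rule hull_minimal) auto

lemma adjoin_mono: "k \<subseteq> k' \<Longrightarrow> S \<subseteq> T \<Longrightarrow> adjoin k S \<subseteq> adjoin k' T"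
  unfolding adjoin_def by (rule hull_mono) auto

lemma adjoin_adjoin: "adjoin (adjoin k S) T = adjoin k (S \<union> T)"
  unfolding adjoin_def by (simp add: hull_Un_left[of subfield "k \<union> S" T, symmetric] Un_assoc)

lemma adjoin_empty: "subfield k \<Longrightarrow> adjoin k {} = k"
  unfolding adjoin_def by (simp add: hull_same)

lemma adjoin_redundant: "subfield k \<Longrightarrow> S \<subseteq> k \<Longrightarrow> adjoin k S = k"
  unfolding adjoin_def by (simp add: hull_same Un_absorb2)

text \<open>
  The fractions on the right already form a field, because nonvanishing of the denominators at \<open>t\<close>
  is inherited by products.
\<close>

lemma adjoin_simple:
  assumes F: "subfield F"
  shows "adjoin F {t} = {poly p t / poly q t | p q. p \<in> polys_over F \<and> q \<in> polys_over F \<and> poly q t \<noteq> 0}"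
    (is "_ = ?R")
proof
  let ?A = "adjoin F {t}"
  have A: "subfield ?A" by (rule subfield_adjoin)
  have "poly p t \<in> ?A" if "p \<in> polys_over F" for p
    using that adjoin_superset[of F "{t}"] polys_over_mono[of F ?A p] poly_in_subfield[OF A] by auto
  then show "?R \<subseteq> ?A" using subfield_divide[OF A] by auto
  have mem: "poly p t / poly q t \<in> ?R" if "p \<in> polys_over F" "q \<in> polys_over F" "poly q t \<noteq> 0" for p q
    using that by blast
  have "subfield ?R"
    unfolding subfield_def
  proof (intro conjI ballI)
    show "0 \<in> ?R" using mem[of 0 1] polys_over_0[OF F] polys_over_1[OF F] by simp
    show "1 \<in> ?R" using mem[of 1 1] polys_over_1[OF F] by simp
    fix x y assume xy: "x \<in> ?R" "y \<in> ?R"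
    then obtain p q p' q' where *: "x = poly p t / poly q t" "p \<in> polys_over F" "q \<in> polys_over F" "poly q t \<noteq> 0"
      "y = poly p' t / poly q' t" "p' \<in> polys_over F" "q' \<in> polys_over F" "poly q' t \<noteq> 0" by auto
    have "x + y = poly (p * q' + p' * q) t / poly (q * q') t"
      using * by (simp add: add_frac_eq)
    then show "x + y \<in> ?R"
      using * mem[of "p * q' + p' * q" "q * q'"] polys_over_mult[OF F] polys_over_add[OF F] by simp
    have "x * y = poly (p * p') t / poly (q * q') t"
      using * by simp
    then show "x * y \<in> ?R"
      using * mem[of "p * p'" "q * q'"] polys_over_mult[OF F] by simp
  next
    fix x assume x: "x \<in> ?R"
    then obtain p q where *: "x = poly p t / poly q t" "p \<in> polys_over F" "q \<in> polys_over F" "poly q t \<noteq> 0"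
      by auto
    show "- x \<in> ?R" using * mem[of "- p" q] polys_over_uminus[OF F] by simp
    show "inverse x \<in> ?R"
    proof (cases "poly p t = 0")
      case True then show ?thesis using * mem[of 0 1] polys_over_0[OF F] polys_over_1[OF F] by simp
    next
      case False then show ?thesis using * mem[of q p] by simp
    qed
  qed
  moreover have "F \<subseteq> ?R"
  proof
    fix c assume "c \<in> F"
    then show "c \<in> ?R"
      using mem[of "[:c:]" 1] polys_over_pCons[OF F _ polys_over_0[OF F]] polys_over_1[OF F] by simp
  qed
  moreover have "t \<in> ?R"
    using mem[of "[:0, 1:]" 1] polys_over_pCons[OF F] polys_over_0[OF F] polys_over_1[OF F] subfield_0[OF F] subfield_1[OF F] by simp
  ultimately show "?A \<subseteq> ?R" by (intro adjoin_minimal) auto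
qed

text \<open>
  The constant term of the minimal polynomial of a nonzero \<open>y \<in> F[x]\<close> does not vanish, so the
  equation can be solved for \<open>1/y\<close> as a polynomial in \<open>y\<close>.
\<close>

lemma subfield_eval_ring:
  assumes F: "subfield F" and x: "algebraic_over F x"
  shows "subfield (eval_ring F x)"
proof -
  have V: "finite_algebra F (eval_ring F x)" by (rule finite_algebra_eval_ring[OF F x])
  have Vs: "fsubspace F (eval_ring F x)" by (rule finite_algebra_subspace[OF F V])
  have inv: "inverse y \<in> eval_ring F x" if y: "y \<in> eval_ring F x" for y
  proof (cases "y = 0")
    case True then show ?thesis using y by simp
  next
    case False
    have "algebraic_over F y" by (rule finite_algebra_algebraic[OF F V y])
    then obtain p where p: "p \<in> polys_over F" "lead_coeff p = 1" "degree p > 0" "poly p y = 0"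
      "\<And>q. q \<in> polys_over F \<Longrightarrow> poly q y = 0 \<Longrightarrow> q \<noteq> 0 \<Longrightarrow> degree p \<le> degree q"
      using minimal_polynomial[OF F] by metis
    obtain c q where pq: "p = pCons c q" by (cases p)
    have q: "q \<in> polys_over F"
      using p(1) unfolding pq by (intro polys_overI) (metis coeff_pCons_Suc polys_overD)
    have c: "c \<in> F" using polys_overD[OF p(1), of 0] pq by simp
    have q0: "q \<noteq> 0" using p(3) pq by auto
    have "c \<noteq> 0"
    proof
      assume "c = 0"
      then have "poly q y = 0" using p(4) pq False by simp
      then have "degree p \<le> degree q" using p(5) q q0 by blast
      then show False using pq q0 by simp
    qed
    have "y * poly q y = - c" using p(4) pq by (simp add: eq_neg_iff_add_eq_0 add.commute)
    then have "inverse y = (- inverse c) * poly q y" using \<open>c \<noteq> 0\<close> False by (simp add: field_simps)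
    moreover have "poly q y \<in> eval_ring F x"
      unfolding poly_altdef using q finite_algebra_power[OF V y] Vs
      by (intro fsubspace_sum[OF Vs]) (auto simp: fsubspace_def polys_overD)
    ultimately show ?thesis
      using Vs subfield_uminus[OF F subfield_inverse[OF F c]] unfolding fsubspace_def by metis
  qed
  have "- y \<in> eval_ring F x" if "y \<in> eval_ring F x" for y
  proof -
    have "(- 1) * y \<in> eval_ring F x"
      using Vs that subfield_uminus[OF F subfield_1[OF F]] unfolding fsubspace_def by blast
    then show ?thesis by simp
  qed
  with inv Vs V show ?thesis by (simp add: subfield_def fsubspace_def finite_algebra_def)
qed

lemma adjoin_algebraic:
  assumes F: "subfield F" and x: "algebraic_over F x"
  shows "adjoin F {x} = eval_ring F x"
proof
  show "adjoin F {x} \<subseteq> eval_ring F x"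
    using eval_ring_base[OF F] eval_ring_gen[OF F] by (intro adjoin_minimal subfield_eval_ring[OF F x]) auto
  show "eval_ring F x \<subseteq> adjoin F {x}"
    unfolding eval_ring_def using adjoin_superset[of F "{x}"]
    by (auto intro!: poly_in_subfield[OF subfield_adjoin] elim: polys_over_mono[rotated])
qed

text \<open>
  Up to a factor from \<open>F[t]\<close>, a polynomial over \<open>F(t)\<close> comes from a polynomial whose coefficients are
  themselves polynomials over \<open>F\<close>, by evaluating the inner variable at \<open>t\<close>.
\<close>

abbreviation eval_inner :: "'a::field \<Rightarrow> 'a poly poly \<Rightarrow> 'a poly" where
  "eval_inner t \<equiv> map_poly (\<lambda>q. poly q t)"

lemma clear_denominators:
  assumes F: "subfield F" and "p \<in> polys_over (adjoin F {t})"
  shows "\<exists>P s. (\<forall>i. coeff P i \<in> polys_over F) \<and> s \<in> polys_over F \<and> poly s t \<noteq> 0 \<and> eval_inner t P = smult (poly s t) p"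
  using assms(2)
proof (induction p)
  case 0
  then show ?case using polys_over_0[OF F] polys_over_1[OF F] by (intro exI[of _ 0] exI[of _ 1]) auto
next
  case (pCons c p)
  have "p \<in> polys_over (adjoin F {t})"
    using pCons.prems by (intro polys_overI) (metis coeff_pCons_Suc polys_overD)
  then obtain P s where P: "\<And>i. coeff P i \<in> polys_over F" "s \<in> polys_over F" "poly s t \<noteq> 0" "eval_inner t P = smult (poly s t) p"
    using pCons.IH by blast
  have "c \<in> adjoin F {t}" using polys_overD[OF pCons.prems, of 0] by simp
  then obtain n m where nm: "n \<in> polys_over F" "m \<in> polys_over F" "poly m t \<noteq> 0" "c = poly n t / poly m t"
    unfolding adjoin_simple[OF F] by auto
  have "eval_inner t (pCons (n * s) (smult m P)) = smult (poly (m * s) t) (pCons c p)"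
  proof (rule poly_eqI)
    fix i
    have "poly s t * coeff p j = poly (coeff P j) t" for j
      using arg_cong[OF P(4), of "\<lambda>p. coeff p j"] by (simp add: coeff_map_poly)
    then show "coeff (eval_inner t (pCons (n * s) (smult m P))) i = coeff (smult (poly (m * s) t) (pCons c p)) i"
      using nm(3) by (simp add: coeff_map_poly coeff_pCons nm(4) field_simps split: nat.split)
  qed
  moreover have "coeff (pCons (n * s) (smult m P)) i \<in> polys_over F" for i
    using nm P polys_over_mult[OF F] by (auto simp: coeff_pCons split: nat.split)
  ultimately show ?case using nm P polys_over_mult[OF F]
    by (intro exI[of _ "pCons (n * s) (smult m P)"] exI[of _ "m * s"]) auto
qed

lemma algebraic_over_adjoin:
  assumes F: "subfield F" and "algebraic_over (adjoin F {t}) x"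
  obtains P where "\<And>i. coeff P i \<in> polys_over F" "eval_inner t P \<noteq> 0" "poly (eval_inner t P) x = 0"
proof -
  obtain p where p: "p \<noteq> 0" "p \<in> polys_over (adjoin F {t})" "poly p x = 0"
    using assms(2) by (auto simp: algebraic_over_def polys_over_def)
  obtain P s where "\<And>i. coeff P i \<in> polys_over F" "s \<in> polys_over F" "poly s t \<noteq> 0" "eval_inner t P = smult (poly s t) p"
    using clear_denominators[OF F p(2)] by blast
  then show thesis using p by (intro that[of P]) auto
qed

lemma poly_eq_sum:
  fixes p :: "'a::field poly"
  assumes "degree p \<le> n"
  shows "poly p x = (\<Sum>i\<le>n. coeff p i * x ^ i)"
proof -
  have "(\<Sum>i\<le>degree p. coeff p i * x ^ i) = (\<Sum>i\<le>n. coeff p i * x ^ i)"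
    using assms by (intro sum.mono_neutral_left) (auto simp: coeff_eq_0)
  then show ?thesis by (simp add: poly_altdef)
qed

lemma degree_map_poly_le: "f 0 = 0 \<Longrightarrow> degree (map_poly f p) \<le> degree p"
  by (intro degree_le) (auto simp: coeff_map_poly coeff_eq_0)

lemma poly_eval_inner:
  "poly (eval_inner t P) x = poly (\<Sum>i\<le>degree P. smult (x ^ i) (coeff P i)) t"
proof -
  have "poly (eval_inner t P) x = (\<Sum>i\<le>degree P. coeff (eval_inner t P) i * x ^ i)"
    by (intro poly_eq_sum degree_map_poly_le) simp 
  then show ?thesis by (simp add: coeff_map_poly poly_sum mult.commute)
qed

text \<open>
  A relation between \<open>x\<close> and \<open>t\<close> over \<open>k\<close> can be read as an equation for \<open>t\<close> over \<open>k(x)\<close>. This equation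
  is nontrivial, because otherwise a nonzero polynomial over \<open>k\<close> would vanish at \<open>x\<close>.
\<close>

lemma acl_exchange:
  assumes "x \<in> acl (k \<union> {t})" "x \<notin> acl k"
  shows "t \<in> acl (k \<union> {x})"
proof -
  define F where "F = subfield hull k"
  have F: "subfield F" unfolding F_def by (rule subfield_hull)
  have hull: "subfield hull (k \<union> {y}) = adjoin F {y}" for y
    unfolding F_def adjoin_def by (rule hull_Un_left)
  have nx: "\<not> algebraic_over F x" using assms(2) by (simp add: acl_def F_def)
  have "algebraic_over (adjoin F {t}) x" using assms(1) by (simp only: acl_def hull mem_Collect_eq)
  then obtain P where P: "\<And>i. coeff P i \<in> polys_over F" "eval_inner t P \<noteq> 0" "poly (eval_inner t P) x = 0"
    using algebraic_over_adjoin[OF F] by metis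
  define R where "R = (\<Sum>i\<le>degree P. smult (x ^ i) (coeff P i))"
  let ?A = "adjoin F {x}"
  have A: "subfield ?A" "F \<subseteq> ?A" "x \<in> ?A" using subfield_adjoin adjoin_superset[of F "{x}"] by auto
  have "R \<in> polys_over ?A"
    unfolding R_def using P(1) A
    by (intro polys_over_sum polys_over_smult subfield_power) (auto intro: polys_over_mono)
  moreover have "poly R t = 0" using P(3) unfolding R_def poly_eval_inner .
  moreover have "R \<noteq> 0"
  proof
    assume "R = 0"
    obtain i where "coeff P i \<noteq> 0" using P(2) by (metis leading_coeff_0_iff map_poly_0)
    then obtain j where ij: "coeff (coeff P i) j \<noteq> 0" by (metis leading_coeff_0_iff)
    define Q where "Q = map_poly (\<lambda>q. coeff q j) P"
    have "coeff Q i \<noteq> 0" using ij by (simp add: Q_def coeff_map_poly)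
    then have "Q \<noteq> 0" by auto
    have "poly Q x = (\<Sum>i\<le>degree P. coeff Q i * x ^ i)"
      unfolding Q_def by (intro poly_eq_sum degree_map_poly_le) simp
    also have "\<dots> = coeff R j" by (simp add: R_def Q_def coeff_sum coeff_map_poly mult.commute)
    finally have "poly Q x = 0" using \<open>R = 0\<close> by simp
    moreover have "\<forall>i. coeff Q i \<in> F" using P(1) by (auto simp: Q_def coeff_map_poly polys_over_def)
    ultimately show False using nx \<open>Q \<noteq> 0\<close> by (auto simp: algebraic_over_def)
  qed
  ultimately have "algebraic_over ?A t" by (auto simp: algebraic_over_def polys_over_def)
  then show ?thesis by (simp only: acl_def hull mem_Collect_eq)
qed

text \<open>
  Write \<open>y = p(t)/q(t)\<close>. Then \<open>t\<close> is a root of \<open>p - y q\<close>, whose coefficients are algebraic over \<open>F\<close>.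
  Hence \<open>p = y q\<close> as polynomials, and \<open>y\<close> is a quotient of coefficients.
\<close>

lemma algebraic_in_transcendental_extension:
  assumes F: "subfield F" and t: "\<not> algebraic_over F t" and "y \<in> adjoin F {t}" "algebraic_over F y"
  shows "y \<in> F"
proof (rule ccontr)
  assume "y \<notin> F"
  obtain p q where pq: "p \<in> polys_over F" "q \<in> polys_over F" "poly q t \<noteq> 0" "y = poly p t / poly q t"
    using assms(3) unfolding adjoin_simple[OF F] by auto
  define A where "A = {x. algebraic_over F x}"
  have A: "subfield A" "F \<subseteq> A" "y \<in> A"
    unfolding A_def using subfield_algebraic[OF F] algebraic_over_self[OF F] assms by auto
  define r where "r = p - smult y q"
  have "r \<in> polys_over A" unfolding r_def using A pq
    by (intro polys_over_diff polys_over_smult) (auto intro: polys_over_mono)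
  moreover have "poly r t = 0" using pq by (simp add: r_def)
  moreover have "\<not> algebraic_over A t" using t algebraic_over_trans[OF F] unfolding A_def by blast
  ultimately have "r = 0" by (auto simp: algebraic_over_def polys_over_def)
  have "q \<noteq> 0" using pq by auto
  then obtain i where i: "coeff q i \<noteq> 0" by (metis leading_coeff_0_iff)
  have "coeff p i = y * coeff q i" using \<open>r = 0\<close> unfolding r_def by (metis coeff_smult eq_iff_diff_eq_0)
  then have "y = coeff p i / coeff q i" using i by simp
  then show False using \<open>y \<notin> F\<close> subfield_divide[OF F] pq by (metis polys_overD)
qed

section \<open>Derivations\<close>

lemma derivation_add: "derivation D \<Longrightarrow> D (x + y) = D x + D y"
  and derivation_mult: "derivation D \<Longrightarrow> D (x * y) = D x * y + x * D y"
  by (auto simp: derivation_def)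

context
  fixes D :: "'a::field \<Rightarrow> 'a" assumes D: "derivation D"
begin

lemma derivation_0: "D 0 = 0"
  using derivation_add[OF D, of 0 0] unfolding add_0_left by (simp only: add_cancel_right_right)

lemma derivation_1: "D 1 = 0"
  using derivation_mult[OF D, of 1 1] unfolding mult_1_left mult_1_right by (simp only: add_cancel_right_right)

lemma derivation_uminus: "D (- x) = - D x"
  using derivation_add[OF D, of x "- x"] derivation_0 by (simp add: eq_neg_iff_add_eq_0 add.commute)

lemma derivation_diff: "D (x - y) = D x - D y"
  using derivation_add[OF D, of x "- y"] derivation_uminus by simp

lemma derivation_sum: "D (sum f A) = (\<Sum>i\<in>A. D (f i))"
  by (induction A rule: infinite_finite_induct) (auto simp: derivation_0 derivation_add[OF D])

lemma derivation_of_nat: "D (of_nat n) = 0"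
  by (induction n) (auto simp: derivation_0 derivation_1 derivation_add[OF D])

lemma derivation_inverse: "D (inverse x) = - D x * inverse x * inverse x"
proof (cases "x = 0")
  case False
  have "D x * inverse x + x * D (inverse x) = 0"
    using derivation_mult[OF D, of x "inverse x"] False derivation_1 by simp
  then have "x * D (inverse x) = - (D x * inverse x)" by (simp add: eq_neg_iff_add_eq_0 add.commute)
  then have "inverse x * (x * D (inverse x)) = - (D x * inverse x * inverse x)" by simp
  then show ?thesis using False by (simp add: mult.assoc[symmetric])
qed (simp add: derivation_0)

lemma derivation_poly:
  "D (poly p x) = poly (map_poly D p) x + poly (pderiv p) x * D x"
  by (induction p)
     (auto simp: derivation_0 derivation_add[OF D] derivation_mult[OF D] map_poly_pCons pderiv_pCons algebra_simps)

lemma polys_over_map_derivation: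
  "(\<And>x. x \<in> F \<Longrightarrow> D x \<in> G) \<Longrightarrow> p \<in> polys_over F \<Longrightarrow> map_poly D p \<in> polys_over G"
  by (auto simp: polys_over_def coeff_map_poly derivation_0)

text \<open>The elements of \<open>F\<close> whose derivative lies in \<open>F\<close> form a subfield.\<close>

lemma derivation_hull:
  assumes "S \<subseteq> F" "subfield F" "\<And>x. x \<in> S \<Longrightarrow> D x \<in> F" "x \<in> subfield hull S"
  shows "D x \<in> F"
proof -
  have "subfield {x \<in> F. D x \<in> F}"
    unfolding subfield_def
    by (auto simp: derivation_0 derivation_1 derivation_uminus derivation_inverse derivation_add[OF D]
        derivation_mult[OF D] intro!: subfield_intros[OF assms(2)])
  then have "subfield hull S \<subseteq> {x \<in> F. D x \<in> F}"
    by (rule hull_minimal[rotated]) (use assms in auto)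
  then show ?thesis using assms(4) by auto
qed

lemma diff_subfield_adjoin:
  assumes "diff_subfield D k" "\<And>x. x \<in> S \<Longrightarrow> D x \<in> adjoin k S"
  shows "diff_subfield D (adjoin k S)"
  unfolding diff_subfield_def
proof (intro conjI ballI subfield_adjoin)
  fix x assume x: "x \<in> adjoin k S"
  have "D y \<in> adjoin k S" if "y \<in> k \<union> S" for y
  proof (cases "y \<in> k")
    case True
    then have "D y \<in> k" using assms(1) by (simp add: diff_subfield_def)
    then show ?thesis using adjoin_superset[of k S] by (rule_tac subsetD) auto
  next
    case False
    then show ?thesis using that assms(2) by simp
  qed
  then show "D x \<in> adjoin k S"
    using derivation_hull[OF adjoin_superset subfield_adjoin] x unfolding adjoin_def by metis
qed

end

text \<open>
  Differentiating \<open>p(x) = 0\<close> for the minimal polynomial \<open>p\<close> of \<open>x\<close> gives \<open>p\<^sup>D(x) + p'(x) x' = 0\<close>, where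
  \<open>p\<^sup>D\<close> has the differentiated coefficients, and \<open>p'(x) \<noteq> 0\<close> by separability.
\<close>

lemma derivation_algebraic:
  fixes D :: "'a::field_char_0 \<Rightarrow> 'a"
  assumes D: "derivation D" and F: "subfield F" and G: "subfield G" "F \<subseteq> G"
    and DF: "\<And>x. x \<in> F \<Longrightarrow> D x \<in> G" and x: "algebraic_over F x" "x \<in> G"
  shows "D x \<in> G"
proof -
  obtain p where p: "p \<in> polys_over F" "degree p > 0" "poly p x = 0"
    "\<And>q. q \<in> polys_over F \<Longrightarrow> poly q x = 0 \<Longrightarrow> q \<noteq> 0 \<Longrightarrow> degree p \<le> degree q"
    using minimal_polynomial[OF F x(1)] by metis
  have n0: "poly (pderiv p) x \<noteq> 0" by (rule minimal_polynomial_separable[OF F p(1,2,4)])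
  have "0 = poly (map_poly D p) x + poly (pderiv p) x * D x"
    using derivation_poly[OF D, of p x] p(3) derivation_0[OF D] by simp
  then have "D x = - poly (map_poly D p) x / poly (pderiv p) x"
    using n0 by (simp add: field_simps eq_neg_iff_add_eq_0)
  moreover have "map_poly D p \<in> polys_over G" by (rule polys_over_map_derivation[OF D DF p(1)])
  moreover have "pderiv p \<in> polys_over G"
    using polys_over_mono[OF G(2) p(1)] polys_over_pderiv[OF G(1)] by blast
  ultimately show ?thesis using poly_in_subfield[OF G(1)] x(2) by (auto intro!: subfield_intros[OF G(1)])
qed

lemma derivation_acl:
  fixes D :: "'a::field_char_0 \<Rightarrow> 'a"
  assumes D: "derivation D" and "\<And>x. x \<in> S \<Longrightarrow> D x \<in> acl S" and x: "x \<in> acl S"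
  shows "D x \<in> acl S"
proof (rule derivation_algebraic[OF D subfield_hull[of S] subfield_acl hull_subset_acl])
  show "D y \<in> acl S" if "y \<in> subfield hull S" for y
    using derivation_hull[OF D acl_superset subfield_acl] assms(2) that by blast
qed (use x in \<open>auto simp: acl_def\<close>)

lemma diff_subfield_acl:
  fixes D :: "'a::field_char_0 \<Rightarrow> 'a"
  assumes "derivation D" "\<And>x. x \<in> S \<Longrightarrow> D x \<in> acl S"
  shows "diff_subfield D (acl S)"
  using derivation_acl[OF assms] subfield_acl by (auto simp: diff_subfield_def)

lemma diff_subfield_acl_self:
  fixes D :: "'a::field_char_0 \<Rightarrow> 'a"
  assumes D: "derivation D" and F: "diff_subfield D F"
  shows "diff_subfield D (acl F)"
proof (rule diff_subfield_acl[OF D])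
  fix x assume "x \<in> F"
  then have "D x \<in> F" using F by (simp add: diff_subfield_def)
  then show "D x \<in> acl F" by (rule subsetD[OF acl_superset])
qed

lemma derivation_eval_ring:
  fixes D :: "'a::field_char_0 \<Rightarrow> 'a"
  assumes D: "derivation D" and F: "diff_subfield D F" and x: "algebraic_over F x" and "y \<in> eval_ring F x"
  shows "D y \<in> eval_ring F x"
proof -
  have sF: "subfield F" and dF: "\<And>x. x \<in> F \<Longrightarrow> D x \<in> F" using F by (auto simp: diff_subfield_def)
  have G: "subfield (eval_ring F x)" "F \<subseteq> eval_ring F x" by (rule subfield_eval_ring[OF sF x], rule eval_ring_base[OF sF])
  have "algebraic_over F y"
    by (rule finite_algebra_algebraic[OF sF finite_algebra_eval_ring[OF sF x] assms(4)])
  then show ?thesis using derivation_algebraic[OF D sF G] dF G(2) assms(4) by blast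
qed

text \<open>
  Differentiate \<open>p(u) = 0\<close> and subtract \<open>d a p(u)\<close>, where \<open>d\<close> is the degree of \<open>p\<close>. The leading terms
  cancel, so that what remains is a polynomial relation for \<open>u\<close> of degree less than \<open>d\<close>, hence
  trivial. Its coefficients are the asserted equations, in which each coefficient of \<open>p\<close> is coupled
  only to the next higher one.
\<close>

lemma minimal_polynomial_first_order:
  fixes D :: "'a::field_char_0 \<Rightarrow> 'a"
  assumes D: "derivation D" and K: "diff_subfield D K" and u: "algebraic_over K u"
    and ab: "a \<in> K" "b \<in> K" "D u = a * u + b"
  obtains p where "p \<in> polys_over K" "lead_coeff p = 1" "degree p > 0" "poly p u = 0"
    "\<And>i. D (coeff p i) = of_nat (degree p - i) * a * coeff p i - of_nat (Suc i) * b * coeff p (Suc i)"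
proof -
  have sK: "subfield K" and dK: "\<And>x. x \<in> K \<Longrightarrow> D x \<in> K" using K by (auto simp: diff_subfield_def)
  obtain p where p: "p \<in> polys_over K" "lead_coeff p = 1" "degree p > 0" "poly p u = 0"
    "\<And>q. q \<in> polys_over K \<Longrightarrow> poly q u = 0 \<Longrightarrow> q \<noteq> 0 \<Longrightarrow> degree p \<le> degree q"
    using minimal_polynomial[OF sK u] by metis
  define d where "d = degree p"
  define q where "q = map_poly D p + pderiv p * [:b, a:] - smult (of_nat d * a) p"
  have q: "q \<in> polys_over K" unfolding q_def using p(1) ab
    by (intro polys_over_diff[OF sK] polys_over_add[OF sK] polys_over_mult[OF sK] polys_over_smult[OF sK]
      polys_over_pderiv[OF sK] polys_over_pCons[OF sK] polys_over_0[OF sK]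
      polys_over_map_derivation[OF D dK] subfield_intros[OF sK]) auto
  have co: "coeff q i = D (coeff p i) + of_nat (Suc i) * b * coeff p (Suc i) + of_nat i * a * coeff p i - of_nat d * a * coeff p i" for i
  proof (cases i)
    case 0
    then show ?thesis by (simp add: q_def coeff_map_poly derivation_0[OF D] coeff_pderiv algebra_simps)
  next
    case (Suc j)
    then show ?thesis by (simp add: q_def coeff_map_poly derivation_0[OF D] coeff_pderiv algebra_simps)
  qed
  have "poly q u = D (poly p u) - of_nat d * a * poly p u"
    unfolding derivation_poly[OF D] q_def using ab by (simp add: algebra_simps)
  then have "poly q u = 0" using p(4) derivation_0[OF D] by simp
  have "q = 0"
  proof (rule ccontr)
    assume "q \<noteq> 0"
    then have le: "d \<le> degree q" using p(5) q \<open>poly q u = 0\<close> d_def by blast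
    have "coeff q i = 0" if "i \<ge> d" for i
    proof (cases "i = d")
      case True
      then show ?thesis using p(2) by (simp add: co d_def derivation_1[OF D] coeff_eq_0)
    next
      case False
      then show ?thesis using that by (simp add: co d_def derivation_0[OF D] coeff_eq_0)
    qed
    with le show False using \<open>q \<noteq> 0\<close> by (metis leading_coeff_0_iff)
  qed
  have "D (coeff p i) = of_nat (d - i) * a * coeff p i - of_nat (Suc i) * b * coeff p (Suc i)" for i
  proof (cases "i \<le> d")
    case True
    then show ?thesis using co[of i] \<open>q = 0\<close> by (simp add: of_nat_diff algebra_simps)
  next
    case False
    then show ?thesis by (simp add: d_def derivation_0[OF D] coeff_eq_0)
  qed
  then show thesis using that[OF p(1,2,3,4)] by (simp add: d_def)
qed

text \<open>
  The equations of the preceding lemma are triangular, so the highest coefficient outside \<open>k\<close>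
  satisfies a first-order equation over \<open>k\<close>. There is such a coefficient since \<open>u\<close> is not algebraic
  over \<open>k\<close>.
\<close>

lemma first_order_descent:
  fixes D :: "'a::field_char_0 \<Rightarrow> 'a"
  assumes D: "derivation D" and K: "diff_subfield D K" and k: "subfield k" "k \<subseteq> K"
    and u: "algebraic_over K u" "\<not> algebraic_over k u"
    and ab: "a \<in> k" "b \<in> k" "D u = a * u + b"
  obtains v a' b' where "v \<in> K - k" "a' \<in> k" "b' \<in> k" "D v = a' * v + b'"
proof -
  obtain p where p: "p \<in> polys_over K" "lead_coeff p = 1" "degree p > 0" "poly p u = 0"
    "\<And>i. D (coeff p i) = of_nat (degree p - i) * a * coeff p i - of_nat (Suc i) * b * coeff p (Suc i)"
    using minimal_polynomial_first_order[OF D K u(1), of a b] ab k by blast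
  have "\<exists>i. coeff p i \<notin> k"
    using u(2) p(2,4) unfolding algebraic_over_def by (metis coeff_0 zero_neq_one)
  moreover have bnd: "i \<le> degree p" if "coeff p i \<notin> k" for i
    using that subfield_0[OF k(1)] by (metis coeff_eq_0 not_le)
  ultimately obtain i where i: "coeff p i \<notin> k" "\<And>j. coeff p j \<notin> k \<Longrightarrow> j \<le> i"
    using Nat.ex_has_greatest_nat[of "\<lambda>i. coeff p i \<notin> k" _ "degree p"] by blast
  have "coeff p (Suc i) \<in> k" using i(2)[of "Suc i"] by auto
  then show thesis
    using i(1) p(1,5) ab polys_overD[OF p(1)]
    by (intro that[of "coeff p i" "of_nat (degree p - i) * a" "- (of_nat (Suc i) * b * coeff p (Suc i))"])
      (auto simp del: of_nat_Suc intro!: subfield_intros[OF k(1)])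
qed

text \<open>
  The element \<open>c\<close> is the average of the conjugates of \<open>t\<close> over \<open>K\<close>, read off from the second highest
  coefficient of the minimal polynomial. All conjugates have the same derivative \<open>t'\<close>.
\<close>

lemma algebraic_antiderivative:
  fixes D :: "'a::field_char_0 \<Rightarrow> 'a"
  assumes D: "derivation D" and K: "diff_subfield D K" and t: "algebraic_over K t" "D t \<in> K"
  obtains c where "c \<in> K" "D (t - c) = 0"
proof -
  have sK: "subfield K" using K by (auto simp: diff_subfield_def)
  obtain p where p: "p \<in> polys_over K" "lead_coeff p = 1" "degree p > 0"
    "\<And>i. D (coeff p i) = of_nat (degree p - i) * 0 * coeff p i - of_nat (Suc i) * D t * coeff p (Suc i)"
    using minimal_polynomial_first_order[OF D K t(1), of 0 "D t"] t(2) subfield_0[OF sK] by auto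
  define d where "d = degree p"
  obtain e where e: "d = Suc e" using p(3) unfolding d_def by (metis gr0_implies_Suc)
  define c where "c = - coeff p e / of_nat d"
  have d0: "(of_nat d :: 'a) \<noteq> 0" using e by (metis of_nat_eq_0_iff nat.distinct(1))
  have "D (coeff p e) = - (of_nat d * D t)" using p(4)[of e] p(2) e d_def by simp
  moreover have "coeff p e = - (of_nat d * c)" using d0 by (simp add: c_def)
  ultimately have "of_nat d * D c = of_nat d * D t"
    by (simp add: derivation_uminus[OF D] derivation_mult[OF D] derivation_of_nat[OF D])
  then have "D (t - c) = 0" using d0 by (simp add: derivation_diff[OF D])
  moreover have "c \<in> K" unfolding c_def using polys_overD[OF p(1)] by (intro subfield_intros[OF sK])
  ultimately show thesis using that by blast
qed

section \<open>Field homomorphisms on subfields\<close>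

definition field_hom_on :: "'a::field set \<Rightarrow> ('a \<Rightarrow> 'b::field) \<Rightarrow> bool" where
  "field_hom_on F h \<longleftrightarrow> (\<forall>x\<in>F. \<forall>y\<in>F. h (x + y) = h x + h y \<and> h (x * y) = h x * h y) \<and> h 1 = 1"

context
  fixes F :: "'a::field set" and h :: "'a \<Rightarrow> 'b::field"
  assumes F: "subfield F" and h: "field_hom_on F h"
begin

lemma hom_add: "x \<in> F \<Longrightarrow> y \<in> F \<Longrightarrow> h (x + y) = h x + h y"
  and hom_mult: "x \<in> F \<Longrightarrow> y \<in> F \<Longrightarrow> h (x * y) = h x * h y"
  and hom_1: "h 1 = 1"
  using h by (auto simp: field_hom_on_def)

lemma hom_0: "h 0 = 0"
  using hom_add[OF subfield_0[OF F] subfield_0[OF F]] unfolding add_0_left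
  by (simp only: add_cancel_right_right)

lemma hom_uminus: "x \<in> F \<Longrightarrow> h (- x) = - h x"
  using hom_add[of x "- x"] subfield_uminus[OF F, of x] hom_0 by (simp add: eq_neg_iff_add_eq_0 add.commute)

lemma hom_diff: "x \<in> F \<Longrightarrow> y \<in> F \<Longrightarrow> h (x - y) = h x - h y"
  using hom_add[of x "- y"] hom_uminus subfield_uminus[OF F] by auto

lemma hom_eq_0: "x \<in> F \<Longrightarrow> h x = 0 \<longleftrightarrow> x = 0"
proof
  assume x: "x \<in> F" "h x = 0"
  show "x = 0"
  proof (rule ccontr)
    assume "x \<noteq> 0"
    then have "h x * h (inverse x) = 1"
      using hom_mult[of x "inverse x"] x subfield_inverse[OF F] hom_1 by auto
    then show False using x by simp
  qed
qed (simp add: hom_0)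

lemma hom_inverse: "x \<in> F \<Longrightarrow> h (inverse x) = inverse (h x)"
proof (cases "x = 0")
  case False
  assume "x \<in> F"
  then have "h x * h (inverse x) = 1"
    using hom_mult[of x "inverse x"] subfield_inverse[OF F] hom_1 False by auto
  then show ?thesis by (metis inverse_unique)
qed (simp add: hom_0)

lemma hom_sum: "(\<And>i. i \<in> A \<Longrightarrow> f i \<in> F) \<Longrightarrow> h (sum f A) = (\<Sum>i\<in>A. h (f i))"
proof (induction A rule: infinite_finite_induct)
  case (insert i A)
  then have "sum f A \<in> F" by (intro subfield_sum[OF F]) auto
  then show ?case using insert hom_add by simp
qed (auto simp: hom_0)

lemma map_poly_hom_add:
  "p \<in> polys_over F \<Longrightarrow> q \<in> polys_over F \<Longrightarrow> map_poly h (p + q) = map_poly h p + map_poly h q"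
  by (intro poly_eqI) (auto simp: coeff_map_poly hom_0 hom_add polys_overD)

lemma map_poly_hom_diff:
  "p \<in> polys_over F \<Longrightarrow> q \<in> polys_over F \<Longrightarrow> map_poly h (p - q) = map_poly h p - map_poly h q"
  by (intro poly_eqI) (auto simp: coeff_map_poly hom_0 hom_diff polys_overD)

lemma map_poly_hom_mult:
  "p \<in> polys_over F \<Longrightarrow> q \<in> polys_over F \<Longrightarrow> map_poly h (p * q) = map_poly h p * map_poly h q"
  by (intro poly_eqI)
     (auto simp: coeff_map_poly hom_0 coeff_mult hom_mult polys_overD hom_sum subfield_mult[OF F])

lemma map_poly_hom_pderiv:
  assumes "p \<in> polys_over F"
  shows "map_poly h (pderiv p) = pderiv (map_poly h p)"
proof (rule poly_eqI)
  fix i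
  have "h (of_nat n) = of_nat n" for n
    by (induction n) (auto simp: hom_0 hom_1 hom_add subfield_1[OF F] subfield_of_nat[OF F])
  then show "coeff (map_poly h (pderiv p)) i = coeff (pderiv (map_poly h p)) i"
    using assms by (simp add: coeff_map_poly hom_0 coeff_pderiv hom_mult polys_overD subfield_of_nat[OF F] del: of_nat_Suc)
qed

lemma hom_poly: "p \<in> polys_over F \<Longrightarrow> x \<in> F \<Longrightarrow> h (poly p x) = poly (map_poly h p) (h x)"
proof (induction p)
  case (pCons c p)
  have "c \<in> F" using polys_overD[OF pCons.prems(1), of 0] by simp
  moreover have p: "p \<in> polys_over F"
    using pCons.prems(1) by (intro polys_overI) (metis coeff_pCons_Suc polys_overD)
  moreover have "poly p x \<in> F" using poly_in_subfield[OF F p pCons.prems(2)] .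
  ultimately show ?case using pCons subfield_mult[OF F]
    by (simp add: map_poly_pCons hom_0 hom_add hom_mult)
qed (simp add: hom_0)

lemma map_poly_hom_eq_0: "p \<in> polys_over F \<Longrightarrow> map_poly h p = 0 \<longleftrightarrow> p = 0"
  by (auto simp: poly_eq_iff coeff_map_poly hom_0 hom_eq_0 polys_overD)

lemma subfield_hom_image: "subfield (h ` F)"
  unfolding subfield_def
proof (intro conjI ballI)
  show "0 \<in> h ` F" using hom_0 subfield_0[OF F] by (metis imageI)
  show "1 \<in> h ` F" using hom_1 subfield_1[OF F] by (metis imageI)
  fix x y assume "x \<in> h ` F" "y \<in> h ` F"
  then obtain a b where "a \<in> F" "b \<in> F" "x = h a" "y = h b" by auto
  then show "x + y \<in> h ` F" "x * y \<in> h ` F"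
    using hom_add hom_mult subfield_add[OF F] subfield_mult[OF F] by (metis imageI)+
next
  fix x assume "x \<in> h ` F"
  then obtain a where "a \<in> F" "x = h a" by auto
  then show "- x \<in> h ` F" "inverse x \<in> h ` F"
    using hom_uminus hom_inverse subfield_uminus[OF F] subfield_inverse[OF F] by (metis imageI)+
qed

text \<open>
  This covers transcendental and algebraic generators alike. That \<open>x\<close> and \<open>y\<close> satisfy the same
  algebraic relations makes the image of a fraction \<open>p(x)/q(x)\<close> well defined.
\<close>

lemma extend_hom:
  assumes rel: "\<And>p. p \<in> polys_over F \<Longrightarrow> poly p x = 0 \<longleftrightarrow> poly (map_poly h p) y = 0"
  obtains h' where "field_hom_on (adjoin F {x}) h'" "\<And>a. a \<in> F \<Longrightarrow> h' a = h a" "h' x = y"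
proof -
  define R where "R z w \<longleftrightarrow> (\<exists>p q. p \<in> polys_over F \<and> q \<in> polys_over F \<and> poly q x \<noteq> 0 \<and> z = poly p x / poly q x
    \<and> w = poly (map_poly h p) y / poly (map_poly h q) y)" for z w
  have ex: "\<exists>w. R z w" if "z \<in> adjoin F {x}" for z
    using that unfolding adjoin_simple[OF F] R_def by blast
  have uniq: "w = w'" if R: "R z w" "R z w'" for z w w'
  proof -
    obtain p q p' q' where *: "p \<in> polys_over F" "q \<in> polys_over F" "poly q x \<noteq> 0" "z = poly p x / poly q x"
      "w = poly (map_poly h p) y / poly (map_poly h q) y"
      "p' \<in> polys_over F" "q' \<in> polys_over F" "poly q' x \<noteq> 0" "z = poly p' x / poly q' x"
      "w' = poly (map_poly h p') y / poly (map_poly h q') y" using R unfolding R_def by blast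
    have "poly (p * q' - p' * q) x = 0" using *(3,4,8,9) by (simp add: field_simps)
    moreover have "p * q' - p' * q \<in> polys_over F"
      by (intro polys_over_diff[OF F] polys_over_mult[OF F] *)
    ultimately have "poly (map_poly h (p * q' - p' * q)) y = 0"
      using rel[of "p * q' - p' * q"] by blast
    then have "poly (map_poly h p) y * poly (map_poly h q') y = poly (map_poly h p') y * poly (map_poly h q) y"
      using * by (simp add: map_poly_hom_diff map_poly_hom_mult polys_over_mult[OF F])
    moreover have "poly (map_poly h q) y \<noteq> 0" "poly (map_poly h q') y \<noteq> 0"
      using rel[OF *(2)] rel[OF *(7)] *(3,8) by simp_all
    ultimately show ?thesis unfolding *(5,10) by (simp add: frac_eq_eq)
  qed
  define h' where "h' z = (SOME w. R z w)" for z
  have h': "h' z = w" if "R z w" for z w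
    unfolding h'_def using someI[of "R z", OF that] uniq that by blast
  have Radd: "R (z + z') (w + w')" and Rmult: "R (z * z') (w * w')" if R: "R z w" "R z' w'" for z w z' w'
  proof -
    obtain p q p' q' where *: "p \<in> polys_over F" "q \<in> polys_over F" "poly q x \<noteq> 0" "z = poly p x / poly q x"
      "w = poly (map_poly h p) y / poly (map_poly h q) y"
      "p' \<in> polys_over F" "q' \<in> polys_over F" "poly q' x \<noteq> 0" "z' = poly p' x / poly q' x"
      "w' = poly (map_poly h p') y / poly (map_poly h q') y" using R unfolding R_def by blast
    have nz: "poly (map_poly h q) y \<noteq> 0" "poly (map_poly h q') y \<noteq> 0"
      using rel[OF *(2)] rel[OF *(7)] *(3,8) by simp_all
    show "R (z + z') (w + w')" unfolding R_def using * nz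
      by (intro exI[of _ "p * q' + p' * q"] exI[of _ "q * q'"])
        (simp add: map_poly_hom_add map_poly_hom_mult polys_over_mult[OF F] polys_over_add[OF F] add_frac_eq)
    show "R (z * z') (w * w')" unfolding R_def using * nz
      by (intro exI[of _ "p * p'"] exI[of _ "q * q'"])
        (simp add: map_poly_hom_mult polys_over_mult[OF F])
  qed
  have Rh: "R z (h' z)" if "z \<in> adjoin F {x}" for z using ex[OF that] h' by metis
  have one: "map_poly h 1 = 1" by (simp add: hom_1 hom_0 map_poly_pCons one_pCons)
  have Rc: "R a (h a)" if "a \<in> F" for a
    unfolding R_def using that polys_over_pCons[OF F that polys_over_0[OF F]] polys_over_1[OF F] one
    by (intro exI[of _ "[:a:]"] exI[of _ 1]) (simp add: map_poly_pCons hom_0)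
  have Rx: "R x y"
    unfolding R_def using polys_over_pCons[OF F subfield_0[OF F] polys_over_1[OF F]] polys_over_1[OF F] one
    by (intro exI[of _ "[:0, 1:]"] exI[of _ 1]) (simp add: map_poly_pCons hom_0 hom_1 one_pCons[symmetric])
  have "h' 1 = 1" using h'[OF Rc[OF subfield_1[OF F]]] hom_1 by simp
  then have "field_hom_on (adjoin F {x}) h'"
    unfolding field_hom_on_def using h'[OF Radd[OF Rh Rh]] h'[OF Rmult[OF Rh Rh]] by simp
  moreover have "h' a = h a" if "a \<in> F" for a using h'[OF Rc[OF that]] .
  ultimately show thesis using that h'[OF Rx] by blast
qed

text \<open>
  For algebraic \<open>x\<close> it suffices that \<open>y\<close> is a root of the image of the minimal polynomial. Since \<open>F[x]\<close>
  is a field, an element that does not vanish has an inverse there, and its image cannot vanish.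
\<close>

lemma algebraic_relations:
  assumes p: "p \<in> polys_over F" "\<And>q. q \<in> polys_over F \<Longrightarrow> poly q x = 0 \<Longrightarrow> \<exists>s\<in>polys_over F. q = s * p"
    and x: "algebraic_over F x" "poly p x = 0" and y: "poly (map_poly h p) y = 0" and q: "q \<in> polys_over F"
  shows "poly q x = 0 \<longleftrightarrow> poly (map_poly h q) y = 0"
proof -
  have *: "poly (map_poly h q) y = 0" if "q \<in> polys_over F" "poly q x = 0" for q
    using p(2)[OF that] p(1) y by (auto simp: map_poly_hom_mult)
  moreover have "poly (map_poly h q) y \<noteq> 0" if nz: "poly q x \<noteq> 0"
  proof -
    have "poly q x \<in> eval_ring F x" using q by (auto simp: eval_ring_def)
    then have "inverse (poly q x) \<in> eval_ring F x"
      using subfield_inverse[OF subfield_eval_ring[OF F x(1)]] by blast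
    then obtain r where r: "r \<in> polys_over F" "inverse (poly q x) = poly r x" unfolding eval_ring_def by auto
    then have "poly (q * r - 1) x = 0" using nz by (simp flip: r(2))
    then have "poly (map_poly h (q * r - 1)) y = 0"
      using q r by (intro * polys_over_mult[OF F] polys_over_diff[OF F] polys_over_1[OF F])
    moreover have "map_poly h 1 = 1" by (simp add: hom_1 hom_0 map_poly_pCons one_pCons)
    ultimately have "poly (map_poly h q) y * poly (map_poly h r) y = 1"
      using q r by (simp add: map_poly_hom_diff map_poly_hom_mult polys_over_mult[OF F] polys_over_1[OF F])
    then show ?thesis by auto
  qed
  ultimately show ?thesis using q by blast
qed

end

lemma field_hom_on_subset: "field_hom_on G h \<Longrightarrow> F \<subseteq> G \<Longrightarrow> field_hom_on F h"
  by (auto simp: field_hom_on_def)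

lemma hom_image_algebraic:
  assumes N: "subfield N" "field_hom_on N h" and F: "F \<subseteq> N" "h ` F \<subseteq> S" and x: "x \<in> N" "algebraic_over F x"
  shows "algebraic_over S (h x)"
proof -
  obtain p where p: "p \<noteq> 0" "p \<in> polys_over F" "poly p x = 0"
    using x(2) by (auto simp: algebraic_over_def polys_over_def)
  have pN: "p \<in> polys_over N" using polys_over_mono[OF F(1) p(2)] .
  have "map_poly h p \<noteq> 0" using map_poly_hom_eq_0[OF N pN] p(1) by simp
  moreover have "coeff (map_poly h p) i \<in> S" for i
    using F(2) polys_overD[OF p(2)] by (auto simp: coeff_map_poly hom_0[OF N])
  moreover have "poly (map_poly h p) (h x) = 0" using hom_poly[OF N pN x(1)] p(3) hom_0[OF N] by simp
  ultimately show ?thesis unfolding algebraic_over_def by blast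
qed

lemma subfield_hom_vimage:
  assumes N: "subfield N" "field_hom_on N h" and S: "subfield S"
  shows "subfield {x \<in> N. h x \<in> S}"
  unfolding subfield_def
  by (auto simp: hom_0[OF N] hom_1[OF N] hom_add[OF N] hom_mult[OF N] hom_uminus[OF N] hom_inverse[OF N]
      intro!: subfield_intros[OF N(1)] subfield_intros[OF S])

lemma hom_adjoin_subset:
  assumes N: "subfield N" "field_hom_on N h" and S: "subfield S" and F: "F \<subseteq> N" "t \<in> N" "h ` F \<subseteq> S" "h t \<in> S"
  shows "h ` adjoin F {t} \<subseteq> S"
proof -
  have "adjoin F {t} \<subseteq> {x \<in> N. h x \<in> S}"
    using F by (intro adjoin_minimal subfield_hom_vimage[OF N S]) auto
  then show ?thesis by auto
qed

text \<open>With this, commutation with derivations has to be checked on the generators of a field only.\<close>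

lemma hom_derivation_subfield:
  assumes M: "diff_subfield D M" and h: "field_hom_on M h" and D: "derivation D" and d: "derivation d"
  shows "subfield {x \<in> M. h (D x) = d (h x)}"
proof -
  have sM: "subfield M" and DM: "\<And>x. x \<in> M \<Longrightarrow> D x \<in> M" using M by (auto simp: diff_subfield_def)
  note H = hom_add[OF sM h] hom_mult[OF sM h] hom_1[OF sM h] hom_0[OF sM h] hom_uminus[OF sM h] hom_inverse[OF sM h]
  show ?thesis unfolding subfield_def
    by (auto simp: H DM derivation_0[OF D] derivation_1[OF D] derivation_add[OF D] derivation_mult[OF D]
        derivation_uminus[OF D] derivation_inverse[OF D]
        derivation_0[OF d] derivation_1[OF d] derivation_add[OF d] derivation_mult[OF d]
        derivation_uminus[OF d] derivation_inverse[OF d] subfield_intros[OF sM])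
qed

text \<open>
  Both \<open>h (D x)\<close> and \<open>d (h x)\<close> are solutions of the equation that arises by differentiating the minimal
  polynomial of \<open>x\<close>, and separability makes this solution unique.
\<close>

lemma hom_derivation_algebraic:
  fixes D :: "'a::field_char_0 \<Rightarrow> 'a"
  assumes M: "diff_subfield D M" and h: "field_hom_on M h" and D: "derivation D" and d: "derivation d"
    and F: "subfield F" "F \<subseteq> M" "\<And>x. x \<in> F \<Longrightarrow> h (D x) = d (h x)" and x: "x \<in> M" "algebraic_over F x"
  shows "h (D x) = d (h x)"
proof -
  have sM: "subfield M" and DM: "\<And>x. x \<in> M \<Longrightarrow> D x \<in> M" using M by (auto simp: diff_subfield_def)
  note H = hom_add[OF sM h] hom_mult[OF sM h] hom_0[OF sM h] hom_poly[OF sM h]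
  obtain p where p: "p \<in> polys_over F" "degree p > 0" "poly p x = 0"
    "\<And>q. q \<in> polys_over F \<Longrightarrow> poly q x = 0 \<Longrightarrow> q \<noteq> 0 \<Longrightarrow> degree p \<le> degree q"
    using minimal_polynomial[OF F(1) x(2)] by metis
  have n0: "poly (pderiv p) x \<noteq> 0" by (rule minimal_polynomial_separable[OF F(1) p(1,2,4)])
  have pM: "p \<in> polys_over M" "pderiv p \<in> polys_over M" "map_poly D p \<in> polys_over M"
    using p(1) F(2) DM polys_over_mono polys_over_pderiv[OF sM] polys_over_map_derivation[OF D, of F M] by blast+
  have eq: "map_poly h (map_poly D p) = map_poly d (map_poly h p)"
    using F(3) p(1) by (intro poly_eqI) (simp add: coeff_map_poly hom_0[OF sM h] derivation_0[OF D] derivation_0[OF d] polys_overD)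
  have "0 = h (D (poly p x))" using p(3) derivation_0[OF D] H by simp
  also have "\<dots> = poly (map_poly d (map_poly h p)) (h x) + poly (map_poly h (pderiv p)) (h x) * h (D x)"
    unfolding derivation_poly[OF D] using pM x DM eq
    by (simp add: H poly_in_subfield[OF sM] subfield_mult[OF sM])
  finally have 1: "0 = \<dots>" .
  have "0 = d (poly (map_poly h p) (h x))" using p(3) derivation_0[OF d] H(4)[OF pM(1) x(1)] H(3) by simp
  also have "\<dots> = poly (map_poly d (map_poly h p)) (h x) + poly (map_poly h (pderiv p)) (h x) * d (h x)"
    unfolding derivation_poly[OF d] map_poly_hom_pderiv[OF sM h pM(1)] by simp
  finally have 2: "0 = \<dots>" .
  have "poly (map_poly h (pderiv p)) (h x) \<noteq> 0"
    using n0 H(4)[OF pM(2) x(1)] hom_eq_0[OF sM h poly_in_subfield[OF sM pM(2) x(1)]] by simp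
  then show ?thesis using 1 2 by (metis add_left_cancel mult_left_cancel)
qed

section \<open>Primitive elements and extension of derivations\<close>

text \<open>
  The element is \<open>z = x + c y\<close>, where \<open>c\<close> avoids the finitely many values for which another pair of
  roots \<open>x', y'\<close> of the equations of \<open>x\<close> and \<open>y\<close> gives the same sum. Then \<open>y\<close> is the only common root of
  its own equation and of \<open>p(z - c X)\<close>, so its minimal polynomial over \<open>F(z)\<close> is linear.
\<close>

lemma primitive_element:
  fixes F :: "'a::{alg_closed_field, field_char_0} set"
  assumes F: "subfield F" and x: "algebraic_over F x" and y: "algebraic_over F y"
  obtains z where "algebraic_over F z" "x \<in> eval_ring F z" "y \<in> eval_ring F z"
proof -
  obtain p where p: "p \<in> polys_over F" "p \<noteq> 0" "poly p x = 0"
    using x by (auto simp: algebraic_over_def polys_over_def)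
  obtain q where q: "q \<in> polys_over F" "q \<noteq> 0" "poly q y = 0"
    using y by (auto simp: algebraic_over_def polys_over_def)
  define B where "B = (\<lambda>(x', y'). (x' - x) / (y - y')) ` ({x'. poly p x' = 0} \<times> {y'. poly q y' = 0})"
  have "finite B" unfolding B_def using poly_roots_finite p(2) q(2) by blast
  moreover have "infinite (range (of_nat :: nat \<Rightarrow> 'a))"
    using inj_of_nat finite_imageD infinite_UNIV_nat by blast
  ultimately obtain n where n: "of_nat n \<notin> B" by (meson finite_subset image_subsetI)
  define c :: 'a where "c = of_nat n"
  have c: "c \<in> F" unfolding c_def by (rule subfield_of_nat[OF F])
  define z where "z = x + c * y"
  have "subfield {x. algebraic_over F x}" by (rule subfield_algebraic[OF F])
  then have z: "algebraic_over F z" unfolding z_def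
    using x y algebraic_over_self[OF F c] subfield_add subfield_mult by blast
  define G where "G = eval_ring F z"
  have G: "subfield G" "F \<subseteq> G" "z \<in> G"
    unfolding G_def by (rule subfield_eval_ring[OF F z], rule eval_ring_base[OF F], rule eval_ring_gen[OF F])
  have "algebraic_over G y" using algebraic_over_mono[OF G(2) y] .
  then obtain r where r: "r \<in> polys_over G" "lead_coeff r = 1" "degree r > 0" "poly r y = 0"
    "\<And>q. q \<in> polys_over G \<Longrightarrow> poly q y = 0 \<Longrightarrow> \<exists>s\<in>polys_over G. q = s * r"
    "\<And>q. q \<in> polys_over G \<Longrightarrow> poly q y = 0 \<Longrightarrow> q \<noteq> 0 \<Longrightarrow> degree r \<le> degree q"
    using minimal_polynomial[OF G(1)] by metis
  have roots: "poly s y' = 0" if "s \<in> polys_over G" "poly s y = 0" "poly r y' = 0" for s y'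
    using r(5)[OF that(1,2)] that(3) by auto
  obtain r1 where r1: "r = [:- y, 1:] * r1" using r(4) by (metis dvdE poly_eq_0_iff_dvd)
  have "r1 \<noteq> 0" using r(2) r1 by auto
  have "degree r1 = 0"
  proof (rule ccontr)
    assume "degree r1 \<noteq> 0"
    then obtain y' where y': "poly r1 y' = 0" using alg_closed_imp_poly_has_root[of r1] by auto
    show False
    proof (cases "y' = y")
      case True
      have "pderiv r = r1 + [:- y, 1:] * pderiv r1"
        unfolding r1 pderiv_mult by (simp add: pderiv_pCons)
      then have "poly (pderiv r) y = 0" using y' True by simp
      then show False using minimal_polynomial_separable[OF G(1) r(1,3,6)] by blast
    next
      case False
      have ry': "poly r y' = 0" using y' r1 by simp
      have "poly q y' = 0" using roots[OF _ q(3) ry'] polys_over_mono[OF G(2) q(1)] by blast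
      moreover have "poly p (z - c * y') = 0"
      proof -
        have "p \<circ>\<^sub>p [:z, - c:] \<in> polys_over G"
          using p(1) c G by (intro polys_over_pcompose polys_over_pCons polys_over_0 subfield_uminus)
            (auto intro: polys_over_mono)
        moreover have "poly (p \<circ>\<^sub>p [:z, - c:]) y = 0" using p(3) by (simp add: poly_pcompose z_def)
        ultimately have "poly (p \<circ>\<^sub>p [:z, - c:]) y' = 0" using roots ry' by blast
        then show ?thesis by (simp add: poly_pcompose mult.commute)
      qed
      moreover have "c = (z - c * y' - x) / (y - y')"
        using False by (simp add: z_def field_simps)
      ultimately have "c \<in> B" unfolding B_def by force
      then show False using n by (simp add: c_def)
    qed
  qed
  then obtain e where "r1 = [:e:]" by (metis degree_eq_zeroE)
  then have "r = [:- y, 1:]" using r(2) r1 \<open>r1 \<noteq> 0\<close> by simp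
  then have "- y \<in> G" using polys_overD[OF r(1), of 0] by simp
  then have "y \<in> G" using subfield_uminus[OF G(1)] by fastforce
  moreover have "x = z - c * y" by (simp add: z_def)
  ultimately have "x \<in> G" using G c subfield_diff subfield_mult by blast
  show thesis by (rule that[OF z]) (use \<open>x \<in> G\<close> \<open>y \<in> G\<close> G_def in auto)
qed

text \<open>
  The derivative of \<open>x\<close> is forced by the equations of \<open>x\<close> over \<open>F\<close>. For the sum and product rules, two
  elements are written as polynomials in a primitive element \<open>z\<close>. On \<open>F[z]\<close> the chain rule defines a
  derivation, and its values satisfy the equations that force the derivatives.
\<close>

lemma extend_derivation:
  fixes F :: "'a::{alg_closed_field, field_char_0} set"
  assumes F: "subfield F" and alg: "\<And>x. algebraic_over F x"
    and dF: "\<And>x. x \<in> F \<Longrightarrow> d x \<in> F" and dadd: "\<And>x y. x \<in> F \<Longrightarrow> y \<in> F \<Longrightarrow> d (x + y) = d x + d y"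
    and dmult: "\<And>x y. x \<in> F \<Longrightarrow> y \<in> F \<Longrightarrow> d (x * y) = d x * y + x * d y"
  obtains D where "derivation D" "\<And>x. x \<in> F \<Longrightarrow> D x = d x"
proof -
  have d0: "d 0 = 0" using dadd[OF subfield_0[OF F] subfield_0[OF F]] unfolding add_0_left
    by (simp only: add_cancel_right_right)
  have dsum: "d (sum f A) = (\<Sum>i\<in>A. d (f i))" if "\<And>i. i \<in> A \<Longrightarrow> f i \<in> F" for f :: "nat \<Rightarrow> 'a" and A
    using that by (induction A rule: infinite_finite_induct) (auto simp: d0 dadd subfield_sum[OF F])
  have mp_add: "map_poly d (g + h) = map_poly d g + map_poly d h" if "g \<in> polys_over F" "h \<in> polys_over F" for g h
    using that by (intro poly_eqI) (simp add: coeff_map_poly d0 dadd polys_overD)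
  have mp_mult: "map_poly d (g * h) = map_poly d g * h + g * map_poly d h" if "g \<in> polys_over F" "h \<in> polys_over F" for g h
    using that by (intro poly_eqI)
      (simp add: coeff_map_poly d0 coeff_mult dsum dmult polys_overD subfield_mult[OF F] sum.distrib)
  \<comment> \<open>The derivative of \<open>g(z)\<close> according to the chain rule if \<open>z\<close> has the derivative \<open>v\<close>.\<close>
  define \<Delta> where "\<Delta> z v g = poly (map_poly d g) z + poly (pderiv g) z * v" for z v g
  have \<Delta>_add: "\<Delta> z v (g + h) = \<Delta> z v g + \<Delta> z v h" if "g \<in> polys_over F" "h \<in> polys_over F" for z v g h
    using that by (simp add: \<Delta>_def mp_add pderiv_add algebra_simps)
  have \<Delta>_mult: "\<Delta> z v (g * h) = \<Delta> z v g * poly h z + poly g z * \<Delta> z v h" if "g \<in> polys_over F" "h \<in> polys_over F" for z v g h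
    using that by (simp add: \<Delta>_def mp_mult pderiv_mult algebra_simps)
  have \<Delta>_const: "\<Delta> z v [:c:] = d c" for z v c
    by (simp add: \<Delta>_def map_poly_pCons d0)
  have \<Delta>_compose: "\<Delta> z v (q \<circ>\<^sub>p g) = \<Delta> (poly g z) (\<Delta> z v g) q"
    if g: "g \<in> polys_over F" and q: "q \<in> polys_over F" for z v g q
    using q
  proof (induction q)
    case 0 then show ?case by (simp add: \<Delta>_def d0)
  next
    case (pCons c q)
    have c: "c \<in> F" using polys_overD[OF pCons.prems(1), of 0] by simp
    have q: "q \<in> polys_over F"
      using pCons.prems(1) by (intro polys_overI) (metis coeff_pCons_Suc polys_overD)
    have qg: "q \<circ>\<^sub>p g \<in> polys_over F" using polys_over_pcompose[OF F q g] .
    have "\<Delta> z v (pCons c q \<circ>\<^sub>p g) = \<Delta> z v ([:c:] + g * (q \<circ>\<^sub>p g))" by (simp add: pcompose_pCons)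
    also have "\<dots> = d c + (\<Delta> z v g * poly q (poly g z) + poly g z * \<Delta> (poly g z) (\<Delta> z v g) q)"
      using c g qg q pCons.IH by (simp add: \<Delta>_add \<Delta>_mult \<Delta>_const polys_over_mult[OF F] polys_over_pCons[OF F] polys_over_0[OF F] poly_pcompose)
    also have "\<dots> = \<Delta> (poly g z) (\<Delta> z v g) (pCons c q)"
      by (simp add: \<Delta>_def map_poly_pCons d0 pderiv_pCons algebra_simps)
    finally show ?case .
  qed
  define V where "V x v \<longleftrightarrow> (\<forall>q\<in>polys_over F. poly q x = 0 \<longrightarrow> \<Delta> x v q = 0)" for x v
  have ex1: "\<exists>!v. V x v" for x
  proof -
    obtain p where p: "p \<in> polys_over F" "degree p > 0" "poly p x = 0"
      "\<And>q. q \<in> polys_over F \<Longrightarrow> poly q x = 0 \<Longrightarrow> \<exists>s\<in>polys_over F. q = s * p"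
      "\<And>q. q \<in> polys_over F \<Longrightarrow> poly q x = 0 \<Longrightarrow> q \<noteq> 0 \<Longrightarrow> degree p \<le> degree q"
      using minimal_polynomial[OF F alg] by metis
    have n0: "poly (pderiv p) x \<noteq> 0" by (rule minimal_polynomial_separable[OF F p(1,2,5)])
    define v where "v = - poly (map_poly d p) x / poly (pderiv p) x"
    have v: "\<Delta> x v p = 0" using n0 by (simp add: \<Delta>_def v_def)
    have "V x v" unfolding V_def
    proof (intro ballI impI)
      fix q assume "q \<in> polys_over F" "poly q x = 0"
      then obtain s where "s \<in> polys_over F" "q = s * p" using p(4) by blast
      then show "\<Delta> x v q = 0" using p(1,3) v \<Delta>_mult by simp
    qed
    moreover have "w = v" if "V x w" for w
    proof -
      have "\<Delta> x w p = 0" using that p(1,3) by (auto simp: V_def)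
      with v have "poly (pderiv p) x * w = poly (pderiv p) x * v"
        unfolding \<Delta>_def by (metis add_left_cancel)
      then show ?thesis using n0 by simp
    qed
    ultimately show ?thesis by blast
  qed
  define D where "D x = (THE v. V x v)" for x
  have VD: "V x (D x)" for x unfolding D_def by (rule theI'[OF ex1])
  have DV: "D x = v" if "V x v" for x v using VD that ex1 by blast
  have D_poly: "D (poly g z) = \<Delta> z (D z) g" if g: "g \<in> polys_over F" for g z
  proof (rule DV, unfold V_def, intro ballI impI)
    fix q assume q: "q \<in> polys_over F" "poly q (poly g z) = 0"
    then have "\<Delta> z (D z) (q \<circ>\<^sub>p g) = 0"
      using VD[of z] polys_over_pcompose[OF F q(1) g] unfolding V_def by (simp add: poly_pcompose)
    then show "\<Delta> (poly g z) (\<Delta> z (D z) g) q = 0" using \<Delta>_compose[OF g q(1)] by simp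
  qed
  have "derivation D"
    unfolding derivation_def
  proof (intro conjI allI)
    fix x y
    obtain z where z: "x \<in> eval_ring F z" "y \<in> eval_ring F z"
      using primitive_element[OF F alg alg, of x y] by metis
    then obtain g h where gh: "g \<in> polys_over F" "h \<in> polys_over F" "x = poly g z" "y = poly h z"
      by (auto simp: eval_ring_def)
    have "D (poly (g + h) z) = D x + D y"
      using gh polys_over_add[OF F] by (simp only: D_poly \<Delta>_add)
    then show "D (x + y) = D x + D y" using gh by simp
    have "D (poly (g * h) z) = D x * y + x * D y"
      using gh polys_over_mult[OF F] by (simp only: D_poly \<Delta>_mult)
    then show "D (x * y) = D x * y + x * D y" using gh by simp
  qed
  moreover have "D x = d x" if "x \<in> F" for x
    using D_poly[of "[:x:]" 0] polys_over_pCons[OF F that polys_over_0[OF F]] \<Delta>_const by simp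
  ultimately show thesis using that by blast
qed

section \<open>Hensel factorisation and Puiseux series\<close>

unbundle fps_syntax

text \<open>
  This is the only case of coprimality that occurs below, a power of a linear polynomial and a
  cofactor without the same root. Induction on the exponent constructs the multipliers.
\<close>

lemma bezout_linear_power:
  fixes h :: "'a::field poly"
  assumes "poly h r \<noteq> 0"
  shows "\<exists>A B. A * [:- r, 1:] ^ s + B * h = 1"
proof (induction s)
  case 0
  show ?case by (intro exI[of _ 1] exI[of _ 0]) simp
next
  case (Suc s)
  then obtain A B where AB: "A * [:- r, 1:] ^ s + B * h = 1" by blast
  define g where "g = [:- r, 1:]"
  define c where "c = poly h r"
  define q where "q = synthetic_div h r"
  have h: "h = g * q + [:c:]" using synthetic_div_correct'[of r h] by (simp add: g_def q_def c_def)
  define e where "e = [:inverse c:]"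
  have ec: "e * [:c:] = 1" using assms by (simp add: e_def c_def one_pCons)
  have "(- A * q * e) * (g * g ^ s) + (B + A * g ^ s * e) * h
    = A * g ^ s * e * (h - g * q) + B * h" by (simp add: algebra_simps)
  also have "\<dots> = A * g ^ s * (e * [:c:]) + B * h" unfolding h by (simp add: algebra_simps)
  also have "\<dots> = 1" using AB ec by (simp add: g_def)
  finally show ?case unfolding g_def power_Suc by blast
qed

text \<open>
  Reducing one multiplier modulo \<open>g\<close> bounds its degree, and comparing degrees then bounds the
  other.
\<close>

lemma bounded_bezout:
  fixes g h r :: "'a::field poly"
  assumes AB: "A * g + B * h = 1" and g: "degree g > 0" and h: "degree h > 0" and r: "degree r < degree g + degree h"
  shows "\<exists>a b. r = g * b + h * a \<and> degree a < degree g \<and> degree b < degree h"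
proof -
  define a where "a = (r * B) mod g"
  define b where "b = r * A + (r * B) div g * h"
  have "r = r * (A * g + B * h)" using AB by simp
  also have "\<dots> = g * (r * A) + h * (r * B)" by (simp add: algebra_simps)
  also have "r * B = (r * B) div g * g + a" unfolding a_def by simp
  finally have eq: "r = g * b + h * a" unfolding b_def by (simp add: algebra_simps)
  have da: "degree a < degree g" unfolding a_def using degree_mod_less[of g "r * B"] g by (metis degree_0 not_less_zero)
  have "degree b < degree h"
  proof (cases "b = 0")
    case True then show ?thesis using h by simp
  next
    case False
    have "g * b = r - h * a" using eq by simp
    moreover have "degree (h * a) < degree g + degree h"
      using degree_mult_le[of h a] da by simp
    then have "degree (r - h * a) < degree g + degree h"
      using r by (meson degree_diff_less)
    moreover have "degree (g * b) = degree g + degree b"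
      using False g by (subst degree_mult_eq) auto
    ultimately show ?thesis by simp
  qed
  with eq da show ?thesis by blast
qed

text \<open>
  The coefficients of the two factors are found one after the other. In the coefficient of index
  \<open>n\<close> of the product, the unknowns of index \<open>n\<close> occur only as \<open>g * H n + G n * h\<close>, which can be given
  any value of degree less than \<open>degree g + degree h\<close>.
\<close>

lemma hensel_sequences:
  fixes g h :: "'a::field poly" and P :: "nat \<Rightarrow> 'a poly"
  assumes AB: "A * g + B * h = 1" and dg: "degree g > 0" and dh: "degree h > 0"
    and P0: "P 0 = g * h" and P: "\<And>i. i > 0 \<Longrightarrow> degree (P i) < degree g + degree h"
  obtains G H where "G 0 = g" "H 0 = h" "\<And>i. i > 0 \<Longrightarrow> degree (G i) < degree g"
    "\<And>i. i > 0 \<Longrightarrow> degree (H i) < degree h" "\<And>i. P i = (\<Sum>l\<le>i. G l * H (i - l))"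
proof -
  \<comment> \<open>Pairs of sequences that are correct up to index \<open>n\<close>; each is continued without changing the
    entries up to \<open>n\<close>, and the diagonal of the resulting chain is correct everywhere.\<close>
  define good where "good n GH \<longleftrightarrow> fst GH 0 = g \<and> snd GH 0 = h \<and>
    (\<forall>i. 0 < i \<and> i \<le> n \<longrightarrow> degree (fst GH i) < degree g \<and> degree (snd GH i) < degree h) \<and>
    (\<forall>i\<le>n. P i = (\<Sum>l\<le>i. fst GH l * snd GH (i - l)))" for n and GH :: "(nat \<Rightarrow> 'a poly) \<times> (nat \<Rightarrow> 'a poly)"
  define agree where "agree n GH GH' \<longleftrightarrow> (\<forall>i\<le>n. fst GH i = fst GH' i \<and> snd GH i = snd GH' i)"
    for n :: nat and GH GH' :: "(nat \<Rightarrow> 'a poly) \<times> (nat \<Rightarrow> 'a poly)"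
  have base: "good 0 (\<lambda>_. g, \<lambda>_. h)" using P0 by (auto simp: good_def)
  have step: "\<exists>y. good (Suc n) y \<and> agree n x y" if good: "good n x" for n x
  proof -
    obtain G H where x: "x = (G, H)" by (cases x)
    define r where "r = P (Suc n) - (\<Sum>l\<in>{1..n}. G l * H (Suc n - l))"
    have "degree (\<Sum>l\<in>{1..n}. G l * H (Suc n - l)) < degree g + degree h"
    proof (rule degree_sum_less)
      fix l assume l: "l \<in> {1..n}"
      then have "degree (G l) < degree g" "degree (H (Suc n - l)) < degree h"
        using good by (auto simp: good_def x)
      then show "degree (G l * H (Suc n - l)) < degree g + degree h"
        using degree_mult_le[of "G l" "H (Suc n - l)"] by linarith
    qed (use dg in simp)
    then have "degree r < degree g + degree h"
      unfolding r_def using P[of "Suc n"] by (intro degree_diff_less) auto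
    from bounded_bezout[OF AB dg dh this] obtain a b where
      ab: "r = g * b + h * a" "degree a < degree g" "degree b < degree h" by blast
    define G' where "G' = G(Suc n := a)"
    define H' where "H' = H(Suc n := b)"
    have same: "G' i = G i" "H' i = H i" if "i \<le> n" for i using that by (auto simp: G'_def H'_def)
    have "P (Suc n) = (\<Sum>l\<le>Suc n. G' l * H' (Suc n - l))"
    proof -
      have "{..Suc n} = insert 0 (insert (Suc n) {1..n})" by auto
      then have "(\<Sum>l\<le>Suc n. G' l * H' (Suc n - l)) = G' 0 * H' (Suc n) + (G' (Suc n) * H' 0 + (\<Sum>l\<in>{1..n}. G' l * H' (Suc n - l)))"
        by simp
      also have "(\<Sum>l\<in>{1..n}. G' l * H' (Suc n - l)) = (\<Sum>l\<in>{1..n}. G l * H (Suc n - l))"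
        by (intro sum.cong) (auto simp: same)
      also have "G' 0 * H' (Suc n) + (G' (Suc n) * H' 0 + \<dots>) = r + (\<Sum>l\<in>{1..n}. G l * H (Suc n - l))"
        using good by (simp add: G'_def H'_def good_def x ab(1) mult.commute)
      finally show ?thesis by (simp add: r_def)
    qed
    moreover have "P i = (\<Sum>l\<le>i. G' l * H' (i - l))" if "i \<le> n" for i
    proof -
      have "(\<Sum>l\<le>i. G' l * H' (i - l)) = (\<Sum>l\<le>i. G l * H (i - l))"
        using that by (intro sum.cong) (auto simp: same)
      then show ?thesis using good that by (simp add: good_def x)
    qed
    ultimately have "good (Suc n) (G', H')"
      using good ab(2,3) by (auto simp: good_def x same le_Suc_eq) (auto simp: G'_def H'_def)
    moreover have "agree n x (G', H')" by (simp add: agree_def x same)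
    ultimately show ?thesis by blast
  qed
  obtain f where f: "\<And>n. good n (f n)" "\<And>n. agree n (f n) (f (Suc n))"
    using dependent_nat_choice[of good agree] base step by metis
  have coh: "fst (f n) i = fst (f i) i \<and> snd (f n) i = snd (f i) i" if "i \<le> n" for n i
    using that
  proof (induction n rule: dec_induct)
    case (step n)
    then show ?case using f(2)[of n] by (simp add: agree_def)
  qed simp
  show thesis
  proof (rule that[of "\<lambda>i. fst (f i) i" "\<lambda>i. snd (f i) i"])
    show "P i = (\<Sum>l\<le>i. fst (f l) l * snd (f (i - l)) (i - l))" for i
    proof -
      have "P i = (\<Sum>l\<le>i. fst (f i) l * snd (f i) (i - l))"
        using f(1)[of i, unfolded good_def, THEN conjunct2, THEN conjunct2, THEN conjunct2, rule_format, of i] by simp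
      also have "\<dots> = (\<Sum>l\<le>i. fst (f l) l * snd (f (i - l)) (i - l))"
      proof (intro sum.cong refl)
        fix l assume "l \<in> {..i}"
        then have "l \<le> i" "i - l \<le> i" by auto
        from coh[OF this(1)] coh[OF this(2)]
        show "fst (f i) l * snd (f i) (i - l) = fst (f l) l * snd (f (i - l)) (i - l)" by metis
      qed
      finally show ?thesis .
    qed
    show "fst (f 0) 0 = g" "snd (f 0) 0 = h" using f(1)[of 0, unfolded good_def, THEN conjunct1] f(1)[of 0, unfolded good_def, THEN conjunct2, THEN conjunct1] .
    fix i :: nat assume i: "i > 0"
    have "degree (fst (f i) i) < degree g \<and> degree (snd (f i) i) < degree h"
      using f(1)[of i, unfolded good_def, THEN conjunct2, THEN conjunct2, THEN conjunct1, rule_format, of i] i by simp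
    then show "degree (fst (f i) i) < degree g" "degree (snd (f i) i) < degree h" by auto
  qed
qed

text \<open>
  A polynomial with power series coefficients is treated as a power series whose coefficients \<open>P i\<close>
  are polynomials. As \<open>q\<close> is monic, \<open>P i\<close> has smaller degree than \<open>q\<close> for \<open>i > 0\<close>.
\<close>

lemma hensel_factorization:
  fixes q :: "'a::field fps poly" and g h :: "'a poly"
  assumes AB: "A * g + B * h = 1" and dg: "degree g > 0" and dh: "degree h > 0"
    and g1: "lead_coeff g = 1" and h1: "lead_coeff h = 1"
    and q0: "map_poly (\<lambda>f. fps_nth f 0) q = g * h" and dq: "degree q = degree g + degree h" "lead_coeff q = 1"
  obtains G H where "q = G * H" "degree G = degree g" "degree H = degree h"
proof -
  define P where "P i = map_poly (\<lambda>f. fps_nth f i) q" for i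
  have P: "coeff (P i) j = fps_nth (coeff q j) i" for i j by (simp add: P_def coeff_map_poly)
  have "degree (P i) < degree g + degree h" if "i > 0" for i
  proof -
    have "coeff (P i) j = 0" if "j \<ge> degree g + degree h" for j
      using that dq \<open>i > 0\<close> by (cases "j = degree q") (auto simp: P coeff_eq_0)
    then show ?thesis using dg by (metis leading_coeff_0_iff degree_0 add_gr_0 not_less)
  qed
  then obtain G H where GH: "G 0 = g" "H 0 = h" "\<And>i. i > 0 \<Longrightarrow> degree (G i) < degree g"
    "\<And>i. i > 0 \<Longrightarrow> degree (H i) < degree h" "\<And>i. P i = (\<Sum>l\<le>i. G l * H (i - l))"
    using hensel_sequences[OF AB dg dh, of P] q0 by (auto simp: P_def)
  have G0: "degree (G i) \<le> degree g" and H0: "degree (H i) \<le> degree h" for i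
    using GH(1,2) GH(3,4)[of i] by (cases "i = 0"; simp add: less_imp_le)+
  have build: "\<exists>F. (\<forall>j. coeff F j = Abs_fps (\<lambda>i. coeff (K i) j)) \<and> degree F = degree k"
    if "\<And>i. degree (K i) \<le> degree k" "K 0 = k" "k \<noteq> 0" for K :: "nat \<Rightarrow> 'a poly" and k
  proof -
    define F where "F = (\<Sum>j\<le>degree k. monom (Abs_fps (\<lambda>i. coeff (K i) j)) j)"
    have F: "coeff F j = Abs_fps (\<lambda>i. coeff (K i) j)" for j
    proof (cases "j \<le> degree k")
      case True then show ?thesis by (simp add: F_def coeff_sum)
    next
      case False
      then have "coeff (K i) j = 0" for i using that(1)[of i] by (intro coeff_eq_0) simp
      with False show ?thesis by (simp add: F_def coeff_sum fps_eq_iff)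
    qed
    have "fps_nth (coeff F (degree k)) 0 = lead_coeff k" using F that(2) by simp
    then have "coeff F (degree k) \<noteq> 0" using that(3) by auto
    then have "degree k \<le> degree F" by (rule le_degree)
    moreover have "degree F \<le> degree k" unfolding F_def
      by (intro degree_sum_le) (auto intro: order_trans[OF degree_monom_le])
    ultimately show ?thesis using F by auto
  qed
  obtain G' where G': "\<And>j. coeff G' j = Abs_fps (\<lambda>i. coeff (G i) j)" "degree G' = degree g"
    using build[of G g] G0 GH(1) g1 by force
  obtain H' where H': "\<And>j. coeff H' j = Abs_fps (\<lambda>i. coeff (H i) j)" "degree H' = degree h"
    using build[of H h] H0 GH(2) h1 by force
  have "q = G' * H'"
  proof (intro poly_eqI fps_ext)
    fix j i
    have "fps_nth (coeff q j) i = coeff (\<Sum>l\<le>i. G l * H (i - l)) j" using P GH(5) by metis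
    also have "\<dots> = (\<Sum>l\<le>i. \<Sum>a\<le>j. coeff (G l) a * coeff (H (i - l)) (j - a))"
      by (simp add: coeff_sum coeff_mult)
    also have "\<dots> = (\<Sum>a\<le>j. \<Sum>l\<le>i. coeff (G l) a * coeff (H (i - l)) (j - a))" by (rule sum.swap)
    also have "\<dots> = fps_nth (coeff (G' * H') j) i"
      by (simp add: coeff_mult fps_sum_nth fps_mult_nth G' H' atLeast0AtMost)
    finally show "fps_nth (coeff q j) i = fps_nth (coeff (G' * H') j) i" .
  qed
  then show thesis using that G' H' by blast
qed

abbreviation ramify :: "nat \<Rightarrow> 'a::field fls \<Rightarrow> 'a fls" where
  "ramify m \<equiv> \<lambda>f. fls_compose_power f m"

lemma field_hom_ramify: "m > 0 \<Longrightarrow> field_hom_on UNIV (ramify m)"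
  by (simp add: field_hom_on_def)

lemma ramify_ramify: "m > 0 \<Longrightarrow> n > 0 \<Longrightarrow> ramify n (ramify m f) = ramify (m * n) f"
proof (rule fls_eqI)
  fix i assume mn: "m > 0" "n > 0"
  show "ramify n (ramify m f) $$ i = ramify (m * n) f $$ i"
  proof (cases "int n dvd i")
    case True
    then obtain j where j: "i = int n * j" by auto
    have "int (m * n) dvd i \<longleftrightarrow> int m dvd j" using mn j by (simp add: mult.commute)
    moreover have "i div int (m * n) = j div int m" using mn j by (simp add: mult.commute)
    ultimately show ?thesis using mn j by (simp add: fls_nth_compose_power)
  next
    case False
    then have "\<not> int (m * n) dvd i" by (metis dvd_mult_right of_nat_mult)
    with False mn show ?thesis by (simp add: fls_nth_compose_power)
  qed
qed

lemma fls_subdegree_ramify: "m > 0 \<Longrightarrow> fls_subdegree (ramify m f) = int m * fls_subdegree f"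
proof (cases "f = 0")
  case False
  assume m: "m > 0"
  show ?thesis
  proof (rule fls_subdegree_eqI)
    show "ramify m f $$ (int m * fls_subdegree f) \<noteq> 0" using False m by (simp add: fls_nth_compose_power)
    fix k assume k: "k < int m * fls_subdegree f"
    show "ramify m f $$ k = 0"
    proof (cases "int m dvd k")
      case True
      then obtain j where "k = int m * j" by auto
      then show ?thesis using k m by (simp add: fls_nth_compose_power)
    qed (use m in \<open>simp add: fls_nth_compose_power\<close>)
  qed
qed simp

text \<open>
  A Puiseux series in \<open>X\<close> is a Laurent series in an \<open>m\<close>-th root of \<open>X\<close>. Renaming this root to \<open>X\<close> turns
  the coefficients \<open>f\<close> of the polynomial into \<open>ramify m f\<close>.
\<close>

definition has_puiseux_root :: "'a::field fls poly \<Rightarrow> bool" where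
  "has_puiseux_root p \<longleftrightarrow> (\<exists>m>0. \<exists>g. poly (map_poly (ramify m) p) g = 0)"

lemma polys_over_UNIV: "p \<in> polys_over UNIV"
  by (simp add: polys_over_def)

lemma has_puiseux_root_mult: "has_puiseux_root p \<Longrightarrow> has_puiseux_root (p * q)"
  unfolding has_puiseux_root_def
  using map_poly_hom_mult[OF subfield_UNIV field_hom_ramify polys_over_UNIV polys_over_UNIV]
  by (metis mult_zero_left poly_mult)

lemma has_puiseux_root_ramify:
  assumes m: "m > 0" and "has_puiseux_root (map_poly (ramify m) p)"
  shows "has_puiseux_root p"
proof -
  obtain n g where n: "n > 0" "poly (map_poly (ramify n) (map_poly (ramify m) p)) g = 0"
    using assms(2) by (auto simp: has_puiseux_root_def)
  have "map_poly (ramify n) (map_poly (ramify m) p) = map_poly (ramify (m * n)) p"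
    using m n(1) by (intro poly_eqI) (simp add: coeff_map_poly ramify_ramify)
  then show ?thesis using m n unfolding has_puiseux_root_def
    by (intro exI[of _ "m * n"]) auto
qed

lemma has_puiseux_root_linear:
  assumes "has_puiseux_root (p \<circ>\<^sub>p [:a, b:])"
  shows "has_puiseux_root p"
proof -
  obtain m g where m: "m > 0" "poly (map_poly (ramify m) (p \<circ>\<^sub>p [:a, b:])) g = 0"
    using assms(1) by (auto simp: has_puiseux_root_def)
  have "poly (map_poly (ramify m) (p \<circ>\<^sub>p [:a, b:])) g = poly (map_poly (ramify m) p) (ramify m a + g * ramify m b)"
  proof (induction p)
    case (pCons c p)
    note H = map_poly_hom_add[OF subfield_UNIV field_hom_ramify[OF m(1)] polys_over_UNIV polys_over_UNIV]
      map_poly_hom_mult[OF subfield_UNIV field_hom_ramify[OF m(1)] polys_over_UNIV polys_over_UNIV]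
    show ?case unfolding pcompose_pCons H by (simp add: map_poly_pCons pCons.IH algebra_simps)
  qed simp
  then show ?thesis using m unfolding has_puiseux_root_def by metis
qed

text \<open>
  For \<open>c\<close> equal to minus the second highest coefficient divided by the degree, the shifted polynomial
  has no second highest coefficient.
\<close>

lemma coeff_pcompose_shift:
  fixes p :: "'a::comm_ring_1 poly"
  assumes n: "degree p = Suc n" and p: "lead_coeff p = 1"
  shows "coeff (p \<circ>\<^sub>p [:c, 1:]) n = coeff p n + of_nat (Suc n) * c"
proof -
  have pc: "monom a i \<circ>\<^sub>p q = smult a (q ^ i)" for a i and q :: "'a poly"
    by (induction i) (auto simp: monom_0 monom_Suc pcompose_pCons)
  have "p \<circ>\<^sub>p [:c, 1:] = (\<Sum>i\<le>Suc n. smult (coeff p i) ([:c, 1:] ^ i))"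
    by (subst poly_as_sum_of_monoms[symmetric]) (simp add: pcompose_sum n pc del: sum.atMost_Suc)
  then have "coeff (p \<circ>\<^sub>p [:c, 1:]) n = (\<Sum>i\<le>Suc n. coeff p i * coeff ([:c, 1:] ^ i) n)"
    by (simp add: coeff_sum del: sum.atMost_Suc)
  also have "\<dots> = (\<Sum>i\<in>{n, Suc n}. coeff p i * coeff ([:c, 1:] ^ i) n)"
  proof (rule sum.mono_neutral_right)
    show "\<forall>i\<in>{..Suc n} - {n, Suc n}. coeff p i * coeff ([:c, 1:] ^ i) n = 0"
    proof
      fix i assume "i \<in> {..Suc n} - {n, Suc n}"
      then have "i < n" by auto
      have "degree ([:c, 1:] ^ i) \<le> degree [:c, 1:] * i" by (rule degree_power_le)
      then have "degree ([:c, 1:] ^ i) < n" using \<open>i < n\<close> by simp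
      then show "coeff p i * coeff ([:c, 1:] ^ i) n = 0" by (simp add: coeff_eq_0)
    qed
  qed auto
  also have "\<dots> = coeff p n + of_nat (Suc n) * c"
    using p n coeff_linear_power[of c n] coeff_linear_poly_power[of n "Suc n" c 1]
    by (simp del: power_Suc of_nat_Suc)
  finally show ?thesis .
qed

text \<open>
  The smallest quotient of the order of the coefficient of \<open>Y\<^sup>j\<close> by \<open>n - j\<close> is, up to sign, a slope of the
  Newton polygon. After a ramification that makes it an integer \<open>a\<close>, the substitution of \<open>X\<^sup>a Y\<close> for \<open>Y\<close>
  makes all coefficients integral, and the coefficient at which the slope is attained a unit.
\<close>

lemma newton_polygon_step:
  fixes p :: "'a::field fls poly"
  assumes n: "degree p = n" and p: "lead_coeff p = 1" and j1: "j1 < n" "coeff p j1 \<noteq> 0"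
  obtains q :: "'a fps poly" and j0 where "degree q = n" "lead_coeff q = 1" "j0 < n" "fps_nth (coeff q j0) 0 \<noteq> 0"
    "\<And>j. coeff p j = 0 \<Longrightarrow> coeff q j = 0" "has_puiseux_root (map_poly fps_to_fls q) \<Longrightarrow> has_puiseux_root p"
proof -
  define S where "S = {j. j < n \<and> coeff p j \<noteq> 0}"
  define \<sigma> where "\<sigma> j = (of_int (fls_subdegree (coeff p j)) / of_nat (n - j) :: rat)" for j
  have S: "finite S" "S \<noteq> {}" using j1 by (auto simp: S_def)
  obtain j0 where j0: "j0 \<in> S" "\<And>j. j \<in> S \<Longrightarrow> \<sigma> j0 \<le> \<sigma> j"
    using arg_min_if_finite[OF S, of \<sigma>] by (metis not_le)
  \<comment> \<open>The smallest quotient is \<open>a / m\<close>.\<close>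
  define m where "m = n - j0"
  define a where "a = fls_subdegree (coeff p j0)"
  have m: "m > 0" "j0 < n" "coeff p j0 \<noteq> 0" using j0(1) by (auto simp: m_def S_def)
  have slope: "a * int (n - j) \<le> int m * fls_subdegree (coeff p j)" if "j \<in> S" for j
  proof -
    have "j < n" using that by (simp add: S_def)
    then have "of_int a * of_nat (n - j) \<le> of_int (fls_subdegree (coeff p j)) * (of_nat m :: rat)"
      using j0(2)[OF that] m by (simp add: \<sigma>_def a_def m_def divide_simps split: if_splits)
    then have "(of_int (a * int (n - j)) :: rat) \<le> of_int (int m * fls_subdegree (coeff p j))"
      by (simp add: mult.commute)
    then show ?thesis by (simp only: of_int_le_iff)
  qed
  define p1 where "p1 = map_poly (ramify m) p"
  define q where "q = smult (fls_X_intpow (- a * int n)) (p1 \<circ>\<^sub>p [:0, fls_X_intpow a:])"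
  have Xpow: "fls_X_intpow a ^ j = (fls_X_intpow (a * int j) :: 'a fls)" for j
    by (induction j) (auto simp: fls_X_intpow_times_fls_X_intpow algebra_simps)
  have cq: "coeff q j = fls_shift (a * (int n - int j)) (ramify m (coeff p j))" for j
    unfolding q_def coeff_smult coeff_pcompose_linear Xpow fls_X_intpow_times_conv_shift(1) fls_shift_fls_shift
    by (simp add: p1_def coeff_map_poly right_diff_distrib)
  have cq0: "coeff q j = 0" if "coeff p j = 0" for j using that by (simp add: cq)
  have cqn: "coeff q n = 1" using p n m by (simp add: cq)
  have dq: "degree q = n"
  proof (rule antisym)
    show "degree q \<le> n" by (intro degree_le) (auto intro!: cq0 simp: n coeff_eq_0)
    show "n \<le> degree q" using cqn by (intro le_degree) simp
  qed
  have int: "fls_subdegree (coeff q j) \<ge> 0" for j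
  proof (cases "coeff p j = 0")
    case True then show ?thesis by (simp add: cq0)
  next
    case nz: False
    have "j \<le> n" using nz n le_degree by blast
    show ?thesis
    proof (cases "j = n")
      case True then show ?thesis using cqn by simp
    next
      case False
      then have jS: "j \<in> S" using nz \<open>j \<le> n\<close> by (simp add: S_def)
      have "ramify m (coeff p j) \<noteq> 0" using nz hom_eq_0[OF subfield_UNIV field_hom_ramify[OF m(1)]] by auto
      then have "fls_subdegree (coeff q j) = int m * fls_subdegree (coeff p j) - a * (int n - int j)"
        by (simp add: cq fls_shift_subdegree fls_subdegree_ramify[OF m(1)])
      then show ?thesis using slope[OF jS] \<open>j \<le> n\<close> by (simp add: of_nat_diff)
    qed
  qed
  define Q where "Q = map_poly fls_regpart q"
  have cQ: "coeff Q j = fls_regpart (coeff q j)" for j by (simp add: Q_def coeff_map_poly)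
  have qQ: "map_poly fps_to_fls Q = q"
    using int by (intro poly_eqI) (simp add: coeff_map_poly cQ)
  have cQn: "coeff Q n = 1" by (simp add: cQ cqn)
  have dQ: "degree Q = n"
  proof (rule antisym)
    show "degree Q \<le> n" by (intro degree_le) (simp add: cQ dq coeff_eq_0)
    show "n \<le> degree Q" using cQn by (intro le_degree) simp
  qed
  show thesis
  proof (rule that[of Q j0])
    have "coeff p j0 $$ a \<noteq> 0" using m(3) by (simp add: a_def)
    moreover have ea: "a * (int n - int j0) = int m * a" using m(2) by (simp add: m_def of_nat_diff)
    have "fps_nth (coeff Q j0) 0 = ramify m (coeff p j0) $$ (a * (int n - int j0))" by (simp add: cQ cq)
    then have "fps_nth (coeff Q j0) 0 = coeff p j0 $$ a" unfolding ea using m(1) by (simp add: fls_nth_compose_power)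
    ultimately show "fps_nth (coeff Q j0) 0 \<noteq> 0" by simp
    show "has_puiseux_root p" if "has_puiseux_root (map_poly fps_to_fls Q)"
    proof -
      have "smult (fls_X_intpow (a * int n)) q = p1 \<circ>\<^sub>p [:0, fls_X_intpow a:]"
      proof -
        have "fls_X_intpow (a * int n) * fls_X_intpow (- a * int n) = (1 :: 'a fls)"
          unfolding fls_X_intpow_times_fls_X_intpow by simp
        then show ?thesis unfolding q_def smult_smult by simp
      qed
      moreover have "smult (fls_X_intpow (a * int n)) q = q * [:fls_X_intpow (a * int n):]" by simp
      ultimately have "has_puiseux_root (p1 \<circ>\<^sub>p [:0, fls_X_intpow a:])"
        using has_puiseux_root_mult that unfolding qQ by metis
      then show ?thesis using has_puiseux_root_linear has_puiseux_root_ramify[OF m(1)] unfolding p1_def by blast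
    qed
  qed (use dQ cQn m cq0 in \<open>auto simp: cQ\<close>)
qed

text \<open>
  Induction on the degree. The second highest coefficient is removed first, and the polynomial is
  rescaled along its Newton polygon. Its reduction modulo \<open>X\<close> is then monic without second highest
  coefficient and different from \<open>Y\<^sup>n\<close>. So it is not a power of a linear polynomial, and it splits
  into two coprime factors. Hensel's lemma lifts the splitting, and a factor has a root by
  induction.
\<close>

theorem puiseux_root:
  fixes p :: "'a::{alg_closed_field, field_char_0} fls poly"
  assumes "degree p > 0"
  shows "has_puiseux_root p"
  using assms
proof (induction "degree p" arbitrary: p rule: less_induct)
  case less
  define n where "n = degree p"
  obtain n' where n': "n = Suc n'" using less.prems by (metis n_def gr0_implies_Suc)
  have monic: "has_puiseux_root p" if dp: "degree p = n" and p1: "lead_coeff p = 1" and p0: "coeff p n' = 0"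
    for p :: "'a fls poly"
  proof (cases "\<forall>j<n. coeff p j = 0")
    case True
    then have "p = monom 1 n" using dp p1 by (intro poly_eqI) (metis coeff_monom coeff_eq_0 linorder_neqE_nat)
    then have "poly (map_poly (ramify 1) p) 0 = 0"
      using n' hom_0[OF subfield_UNIV field_hom_ramify, of 1]
      by (simp add: poly_0_coeff_0 coeff_map_poly del: One_nat_def)
    then show ?thesis unfolding has_puiseux_root_def using zero_less_one by blast
  next
    case False
    then obtain j1 where j1: "j1 < n" "coeff p j1 \<noteq> 0" by auto
    obtain q :: "'a fps poly" and j0 where q: "degree q = n" "lead_coeff q = 1" "j0 < n" "fps_nth (coeff q j0) 0 \<noteq> 0"
      "\<And>j. coeff p j = 0 \<Longrightarrow> coeff q j = 0" "has_puiseux_root (map_poly fps_to_fls q) \<Longrightarrow> has_puiseux_root p"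
      using newton_polygon_step[OF dp p1 j1] by metis
    define q0 where "q0 = map_poly (\<lambda>f. fps_nth f 0) q"
    have cq0: "coeff q0 j = fps_nth (coeff q j) 0" for j by (simp add: q0_def coeff_map_poly)
    have lq0: "coeff q0 n = 1" using q(1,2) by (simp add: cq0)
    have dq0: "degree q0 = n"
    proof (rule antisym)
      show "degree q0 \<le> n" by (intro degree_le) (simp add: cq0 q coeff_eq_0)
      show "n \<le> degree q0" using lq0 by (intro le_degree) simp
    qed
    obtain r where r: "poly q0 r = 0" using alg_closed_imp_poly_has_root[of q0] dq0 n' by auto
    have "q0 \<noteq> 0" using lq0 by auto
    define s where "s = order r q0"
    define g where "g = [:- r, 1:] ^ s"
    obtain h where h: "q0 = g * h" "\<not> [:- r, 1:] dvd h"
      using order_decomp[OF \<open>q0 \<noteq> 0\<close>, of r] unfolding s_def g_def by blast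
    have s: "s > 0" unfolding s_def using r \<open>q0 \<noteq> 0\<close> by (simp add: order_root)
    have dg: "degree g = s" by (simp add: g_def degree_power_eq)
    have lg: "lead_coeff g = 1" by (simp add: g_def lead_coeff_power)
    have lh: "lead_coeff h = 1" using lq0 dq0 lead_coeff_mult[of g h] lg h(1) by simp
    have nsum: "n = s + degree h" using dq0 h(1) dg lg lh degree_mult_eq[of g h] by fastforce
    have dh: "degree h > 0"
    proof (rule ccontr)
      assume "\<not> degree h > 0"
      then have "h = 1" using lh by (metis degree_0_id lead_coeff_pCons(2) gr0I one_pCons degree_eq_zeroE pCons_0_0)
      then have q0: "q0 = [:- r, 1:] ^ n" using h(1) nsum by (simp add: g_def)
      have "coeff q0 n' = of_nat n * (- r)" unfolding q0 using n' coeff_linear_poly_power[of n' n "- r" 1]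
        by (simp del: of_nat_Suc power_Suc)
      moreover have "coeff q0 n' = 0" using q(5)[OF p0] by (simp add: cq0)
      moreover have "(of_nat n :: 'a) \<noteq> 0" using n' by (simp del: of_nat_Suc)
      ultimately have "r = 0" by simp
      then have "q0 = monom 1 n" by (simp add: q0 monom_altdef)
      then show False using q(3,4) cq0[of j0] by simp
    qed
    have "poly h r \<noteq> 0" using h(2) by (simp add: poly_eq_0_iff_dvd)
    then obtain A B where AB: "A * g + B * h = 1" using bezout_linear_power[of h r s] unfolding g_def by blast
    obtain G H where GH: "q = G * H" "degree G = degree g" "degree H = degree h"
      by (rule hensel_factorization[OF AB, of q]) (use dg s dh lg lh h(1) q(1,2) nsum in \<open>auto simp: q0_def\<close>)
    have "fps_to_fls (sum f A) = (\<Sum>i\<in>A. fps_to_fls (f i))" for f :: "nat \<Rightarrow> 'a fps" and A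
      by (induction A rule: infinite_finite_induct) simp_all
    then have split: "map_poly fps_to_fls (G * H) = map_poly fps_to_fls G * map_poly fps_to_fls H"
      by (intro poly_eqI) (simp add: coeff_map_poly coeff_mult fls_times_fps_to_fls)
    have dG: "degree (map_poly fps_to_fls G) = s"
      using GH(2) dg by (subst degree_map_poly) auto
    moreover have "s < degree p" using dp dh nsum by simp
    ultimately have "has_puiseux_root (map_poly fps_to_fls G)"
      using less.hyps s dp n_def by metis
    then show ?thesis using q(6) has_puiseux_root_mult split GH(1) by metis
  qed
  define p1 where "p1 = smult (inverse (lead_coeff p)) p"
  have lp: "lead_coeff p \<noteq> 0" using less.prems by auto
  have p1: "degree p1 = n" "lead_coeff p1 = 1" using lp by (auto simp: p1_def n_def)
  define c where "c = - coeff p1 n' / of_nat n"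
  define p2 where "p2 = p1 \<circ>\<^sub>p [:c, 1:]"
  have "degree p2 = n" by (simp add: p2_def degree_pcompose p1)
  moreover have "lead_coeff p2 = 1" unfolding p2_def by (subst lead_coeff_comp) (use p1 in simp_all)
  moreover have "coeff p2 n' = 0"
  proof -
    have "(of_nat n :: 'a fls) \<noteq> 0" using n' by (metis of_nat_eq_0_iff nat.distinct(1))
    then show ?thesis unfolding p2_def using coeff_pcompose_shift[of p1 n' c] p1 n' by (simp add: c_def del: of_nat_Suc)
  qed
  ultimately have "has_puiseux_root p1" using monic has_puiseux_root_linear unfolding p2_def by blast
  moreover have "p = p1 * [:lead_coeff p:]" using lp by (simp add: p1_def)
  ultimately show ?case using has_puiseux_root_mult by metis
qed

section \<open>Laurent series over subfields and their derivations\<close>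

text \<open>
  The convolution may start at any lower bounds for the orders. This allows several products to be
  expanded over the same range of indices.
\<close>

lemma fls_times_nth_bounds:
  fixes f g :: "'a::field fls"
  assumes "\<And>i. i < a \<Longrightarrow> f $$ i = 0" "\<And>i. i < b \<Longrightarrow> g $$ i = 0"
  shows "(f * g) $$ n = (\<Sum>i=a..n - b. f $$ i * g $$ (n - i))"
proof (cases "f = 0 \<or> g = 0")
  case False
  then have "a \<le> fls_subdegree f" "b \<le> fls_subdegree g"
    using assms by (metis nth_fls_subdegree_nonzero not_le)+
  then show ?thesis unfolding fls_times_nth(2)
    by (intro sum.mono_neutral_left) auto
qed auto

definition series_over :: "'a::field set \<Rightarrow> 'a fls set" where
  "series_over F = {f. \<forall>n. f $$ n \<in> F}"

lemma series_overD: "f \<in> series_over F \<Longrightarrow> f $$ n \<in> F"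
  by (simp add: series_over_def)

text \<open>
  For the inverse of \<open>f\<close>, each coefficient of \<open>f * inverse f = 1\<close> can be solved for the highest
  coefficient of \<open>inverse f\<close> that occurs in it.
\<close>

lemma subfield_series_over:
  assumes F: "subfield F"
  shows "subfield (series_over F)"
proof -
  have inv: "inverse f \<in> series_over F" if f: "f \<in> series_over F" for f
  proof (cases "f = 0")
    case True then show ?thesis using f by simp
  next
    case False
    define g where "g = inverse f"
    define s where "s = fls_subdegree f"
    have fs: "f $$ s \<noteq> 0" using False by (simp add: s_def)
    have fg: "f * g = 1" using False by (simp add: g_def)
    have "g $$ n \<in> F" for n
    proof (induction "nat (n - fls_subdegree g)" arbitrary: n rule: less_induct)
      case less
      show ?case
      proof (cases "n < fls_subdegree g")
        case True then show ?thesis using subfield_0[OF F] by simp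
      next
        case False
        have "(f * g) $$ (s + n) = (\<Sum>i=s..s + n - fls_subdegree g. f $$ i * g $$ (s + n - i))"
          by (rule fls_times_nth_bounds) (simp_all add: s_def)
        also have "{s..s + n - fls_subdegree g} = insert s {s<..s + n - fls_subdegree g}" using False by auto
        finally have "f $$ s * g $$ n = (f * g) $$ (s + n) - (\<Sum>i\<in>{s<..s + n - fls_subdegree g}. f $$ i * g $$ (s + n - i))"
          by simp
        moreover have "(f * g) $$ (s + n) \<in> F" unfolding fg using subfield_0[OF F] subfield_1[OF F] by simp
        moreover have "g $$ (s + n - i) \<in> F" if "i \<in> {s<..s + n - fls_subdegree g}" for i
          using that by (intro less) auto
        moreover have "f $$ i \<in> F" for i using f by (rule series_overD)
        ultimately have "f $$ s * g $$ n \<in> F"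
          by (simp only:) (intro subfield_diff[OF F] subfield_sum[OF F] subfield_mult[OF F])
        then have "(f $$ s * g $$ n) / f $$ s \<in> F" using f by (intro subfield_divide[OF F] series_overD)
        then show ?thesis using fs by simp
      qed
    qed
    then show ?thesis by (simp add: series_over_def g_def)
  qed
  moreover have "f * g \<in> series_over F" if "f \<in> series_over F" "g \<in> series_over F" for f g
    unfolding series_over_def
    by (auto simp: fls_times_nth(2) intro!: subfield_sum[OF F] subfield_mult[OF F] series_overD that)
  ultimately show ?thesis unfolding subfield_def
    by (auto simp: series_over_def subfield_intros[OF F])
qed

lemma series_over_const: "subfield F \<Longrightarrow> c \<in> F \<Longrightarrow> fls_const c \<in> series_over F"
  by (simp add: series_over_def subfield_0)

lemma series_over_X_intpow: "subfield F \<Longrightarrow> fls_X_intpow n \<in> series_over F"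
  by (simp add: series_over_def subfield_0 subfield_1)

lemma nth_truncation: "Abs_fls (\<lambda>n. if n < r then f $$ n else 0) $$ n = (if n < r then f $$ n else 0)"
  by (rule nth_Abs_fls_ex_lower_bound) (auto intro!: exI[of _ "fls_subdegree f"])

text \<open>
  The coefficients below the order of \<open>f\<close> are zero and so belong to \<open>F\<close>. Hence there is a first one
  outside \<open>F\<close>, and \<open>f\<close> is cut there.
\<close>

lemma first_coefficient_outside:
  assumes F: "subfield F" and f: "f \<notin> series_over F"
  obtains r g h where "f = g + h" "g \<in> series_over F" "\<And>n. n < r \<Longrightarrow> h $$ n = 0" "h $$ r = f $$ r" "f $$ r \<notin> F"
    "\<And>n. g $$ n = (if n < r then f $$ n else 0)"
proof -
  define s where "s = fls_subdegree f"
  define P where "P j \<longleftrightarrow> f $$ (s + int j) \<notin> F" for j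
  obtain n where n: "f $$ n \<notin> F" using f by (auto simp: series_over_def)
  then have "n \<ge> s" using subfield_0[OF F] by (metis s_def fls_eq0_below_subdegree not_le)
  then have "P (nat (n - s))" using n by (simp add: P_def)
  define j where "j = (LEAST j. P j)"
  have j: "P j" "\<And>i. i < j \<Longrightarrow> \<not> P i"
    unfolding j_def by (rule LeastI[of P], fact) (rule not_less_Least)
  define r where "r = s + int j"
  have low: "f $$ n \<in> F" if "n < r" for n
  proof (cases "n < s")
    case True then show ?thesis using subfield_0[OF F] by (simp add: s_def)
  next
    case False
    then have "nat (n - s) < j" "n = s + int (nat (n - s))" using that by (auto simp: r_def)
    then show ?thesis using j(2) unfolding P_def by metis
  qed
  define g where "g = Abs_fls (\<lambda>n. if n < r then f $$ n else 0)"
  have g: "g $$ n = (if n < r then f $$ n else 0)" for n unfolding g_def by (rule nth_truncation)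
  show thesis
  proof (rule that[of g "f - g" r])
    show "g \<in> series_over F" using low subfield_0[OF F] by (simp add: series_over_def g)
    show "f $$ r \<notin> F" using j(1) by (simp add: P_def r_def)
  qed (auto simp: g)
qed

definition coeff_derivation :: "('a::field \<Rightarrow> 'a) \<Rightarrow> 'a fls \<Rightarrow> 'a fls" where
  "coeff_derivation D f = Abs_fls (\<lambda>n. D (f $$ n))"

text \<open>
  This is the derivation that acts as \<open>D\<close> on the coefficients and maps \<open>X\<close> to \<open>w X\<^sup>e\<^sup>+\<^sup>1\<close>. If \<open>t\<close> is
  represented by \<open>X\<close> to the power \<open>-m\<close>, then \<open>t' = f\<close> requires \<open>e = m\<close> and \<open>t' = f t\<close> requires \<open>e = 0\<close>, in
  both cases with \<open>w = - f / m\<close>.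
\<close>

definition series_derivation :: "('a::field \<Rightarrow> 'a) \<Rightarrow> 'a \<Rightarrow> nat \<Rightarrow> 'a fls \<Rightarrow> 'a fls" where
  "series_derivation D w e f = coeff_derivation D f + fls_deriv f * (fls_const w * fls_X_intpow (int e + 1))"

context
  fixes D :: "'a::field \<Rightarrow> 'a" assumes D: "derivation D"
begin

lemma coeff_derivation_nth: "coeff_derivation D f $$ n = D (f $$ n)"
  unfolding coeff_derivation_def
  by (rule nth_Abs_fls_ex_lower_bound) (auto simp: derivation_0[OF D] intro!: exI[of _ "fls_subdegree f"])

lemma derivation_coeff_derivation: "derivation (coeff_derivation D)"
  unfolding derivation_def
proof (intro conjI allI fls_eqI)
  fix f g :: "'a fls" and n
  show "coeff_derivation D (f + g) $$ n = (coeff_derivation D f + coeff_derivation D g) $$ n"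
    by (simp add: coeff_derivation_nth derivation_add[OF D])
  define a b where "a = fls_subdegree f" and "b = fls_subdegree g"
  have fa: "i < a \<Longrightarrow> f $$ i = 0" "i < a \<Longrightarrow> coeff_derivation D f $$ i = 0" for i
    by (simp_all add: a_def coeff_derivation_nth derivation_0[OF D])
  have gb: "i < b \<Longrightarrow> g $$ i = 0" "i < b \<Longrightarrow> coeff_derivation D g $$ i = 0" for i
    by (simp_all add: b_def coeff_derivation_nth derivation_0[OF D])
  show "coeff_derivation D (f * g) $$ n = (coeff_derivation D f * g + f * coeff_derivation D g) $$ n"
  proof -
    have "(f * g) $$ n = (\<Sum>i=a..n - b. f $$ i * g $$ (n - i))"
      by (rule fls_times_nth_bounds) (use fa gb in blast)+
    moreover have "(coeff_derivation D f * g) $$ n = (\<Sum>i=a..n - b. coeff_derivation D f $$ i * g $$ (n - i))"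
      by (rule fls_times_nth_bounds) (use fa gb in blast)+
    moreover have "(f * coeff_derivation D g) $$ n = (\<Sum>i=a..n - b. f $$ i * coeff_derivation D g $$ (n - i))"
      by (rule fls_times_nth_bounds) (use fa gb in blast)+
    ultimately show ?thesis
      by (simp add: coeff_derivation_nth derivation_sum[OF D] derivation_mult[OF D] sum.distrib)
  qed
qed

lemma derivation_series_derivation: "derivation (series_derivation D w e)"
  unfolding derivation_def
proof (intro conjI allI)
  fix f g :: "'a fls"
  show "series_derivation D w e (f + g) = series_derivation D w e f + series_derivation D w e g"
    unfolding series_derivation_def derivation_add[OF derivation_coeff_derivation] fls_deriv_add
    by (simp add: distrib_right)
  show "series_derivation D w e (f * g) = series_derivation D w e f * g + f * series_derivation D w e g"
    unfolding series_derivation_def derivation_mult[OF derivation_coeff_derivation] fls_deriv_mult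
    by (simp add: algebra_simps)
qed

lemma series_derivation_nth:
  "series_derivation D w e f $$ n = D (f $$ n) + w * of_int (n - int e) * f $$ (n - int e)"
proof -
  have "fls_deriv f * (fls_const w * fls_X_intpow (int e + 1)) = fls_const w * fls_shift (- (int e + 1)) (fls_deriv f)"
    by (metis fls_X_intpow_times_conv_shift(2) mult.left_commute)
  then show ?thesis
    unfolding series_derivation_def fls_plus_nth coeff_derivation_nth by (simp only: fls_mult_const_nth) simp
qed

lemma series_derivation_const: "series_derivation D w e (fls_const c) = fls_const (D c)"
  by (rule fls_eqI) (auto simp: series_derivation_nth derivation_0[OF D])

lemma series_derivation_X_intpow:
  "series_derivation D w e (fls_X_intpow n) = fls_const (w * of_int n) * fls_X_intpow (n + int e)"
proof (rule fls_eqI)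
  fix i
  show "series_derivation D w e (fls_X_intpow n) $$ i = (fls_const (w * of_int n) * fls_X_intpow (n + int e)) $$ i"
    by (cases "i = n + int e")
      (auto simp: series_derivation_nth derivation_0[OF D] derivation_1[OF D])
qed

lemma series_derivation_over:
  assumes F: "subfield F" and "\<And>x. x \<in> F \<Longrightarrow> D x \<in> F" "w \<in> F" "f \<in> series_over F"
  shows "series_derivation D w e f \<in> series_over F"
  unfolding series_over_def
proof (intro CollectI allI)
  fix n
  show "series_derivation D w e f $$ n \<in> F"
    unfolding series_derivation_nth
    by (intro subfield_add[OF F] subfield_mult[OF F] subfield_of_int[OF F] assms(2) assms(3) series_overD[OF assms(4)])
qed

text \<open>
  Cut \<open>u\<close> into \<open>g + h\<close> before its first coefficient \<open>u $$ r\<close> outside \<open>F\<close>, and move \<open>g\<close> into the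
  inhomogeneous term. If \<open>A\<close> had a pole, the lowest coefficient of \<open>A * h\<close> would express \<open>u $$ r\<close> by
  elements of \<open>F\<close>. So \<open>A\<close> has no pole, and the coefficients of index \<open>r\<close> give the equation. The term
  with \<open>w\<close> contributes only for \<open>e = 0\<close>, because it involves the coefficient of \<open>h\<close> of index \<open>r - e\<close>.
\<close>

lemma first_order_coefficient:
  assumes F: "subfield F" and DF: "\<And>x. x \<in> F \<Longrightarrow> D x \<in> F" and w: "w \<in> F"
    and AB: "A \<in> series_over F" "B \<in> series_over F" and u: "u \<notin> series_over F"
    and eq: "series_derivation D w e u = A * u + B"
  obtains r a b where "u $$ r \<notin> F" "a \<in> F" "b \<in> F" "D (u $$ r) = a * u $$ r + b"
    "A = 0 \<Longrightarrow> e > 0 \<Longrightarrow> a = 0"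
proof -
  have S: "subfield (series_over F)" by (rule subfield_series_over[OF F])
  obtain r g h where gh: "u = g + h" "g \<in> series_over F" "\<And>n. n < r \<Longrightarrow> h $$ n = 0" "h $$ r = u $$ r" "u $$ r \<notin> F"
    using first_coefficient_outside[OF F u] by metis
  define C where "C = B + A * g - series_derivation D w e g"
  have C: "C \<in> series_over F" unfolding C_def
    using AB gh(2) series_derivation_over[OF F DF w gh(2)] by (intro subfield_intros[OF S])
  have eqh: "series_derivation D w e h = A * h + C"
    using eq derivation_add[OF derivation_series_derivation, of w e g h] gh(1)
    by (simp add: C_def algebra_simps)
  have nth: "D (h $$ n) + w * of_int (n - int e) * h $$ (n - int e) = (A * h) $$ n + C $$ n" for n
    using arg_cong[OF eqh, of "\<lambda>f. f $$ n"] by (simp only: series_derivation_nth fls_plus_nth)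
  have As: "A $$ s = 0" if "s < 0" for s
  proof (rule ccontr)
    assume "A $$ s \<noteq> 0"
    define d where "d = fls_subdegree A"
    have "d < 0" using \<open>A $$ s \<noteq> 0\<close> that by (metis d_def fls_subdegree_leI le_less_trans)
    have "A \<noteq> 0" using \<open>A $$ s \<noteq> 0\<close> by auto
    then have Ad: "A $$ d \<noteq> 0" unfolding d_def by (rule nth_fls_subdegree_nonzero)
    have "(A * h) $$ (d + r) = (\<Sum>i=d..d + r - r. A $$ i * h $$ (d + r - i))"
      by (rule fls_times_nth_bounds) (simp_all add: d_def gh(3))
    then have Ah: "(A * h) $$ (d + r) = A $$ d * h $$ r" by simp
    have "A $$ d * h $$ r = - (C $$ (d + r))"
      using nth[of "d + r"] \<open>d < 0\<close> gh(3) unfolding Ah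
      by (simp add: derivation_0[OF D] eq_neg_iff_add_eq_0)
    then have "h $$ r = - (C $$ (d + r)) / A $$ d" using Ad by (simp add: field_simps)
    moreover have "- (C $$ (d + r)) / A $$ d \<in> F"
      using C AB(1) by (intro subfield_divide[OF F] subfield_uminus[OF F] series_overD)
    ultimately show False using gh(4,5) by simp
  qed
  have "(A * h) $$ r = (\<Sum>i=0..r - r. A $$ i * h $$ (r - i))"
    by (rule fls_times_nth_bounds) (simp_all add: gh(3) As)
  then have Ah: "(A * h) $$ r = A $$ 0 * u $$ r" using gh(4) by simp
  define a where "a = A $$ 0 - (if e = 0 then w * of_int r else 0)"
  have "w * of_int (r - int e) * h $$ (r - int e) = (if e = 0 then w * of_int r else 0) * u $$ r"
    using gh(3,4) by auto
  then have "D (u $$ r) = a * u $$ r + C $$ r"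
    using nth[of r] unfolding Ah gh(4) by (simp add: a_def algebra_simps)
  moreover have "a \<in> F" unfolding a_def using w AB(1) by (auto intro!: subfield_intros[OF F] series_overD)
  moreover have "a = 0" if "A = 0" "e > 0" using that by (simp add: a_def)
  ultimately show thesis using that gh(5) C series_overD by blast
qed

end

text \<open>On series without negative exponents the constant term is a ring homomorphism.\<close>

lemma poly_nth_0:
  fixes h :: "'a::field fls"
  assumes q: "\<And>i n. n < 0 \<Longrightarrow> coeff q i $$ n = 0" and h: "\<And>n. n < 0 \<Longrightarrow> h $$ n = 0"
  shows "(\<forall>n<0. poly q h $$ n = 0) \<and> poly q h $$ 0 = poly (map_poly (\<lambda>f. f $$ 0) q) (h $$ 0)"
  using q
proof (induction q)
  case (pCons c q)
  have c: "c $$ n = 0" if "n < 0" for n using pCons.prems[of n 0] that by simp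
  have "coeff q i $$ n = 0" if "n < 0" for n i using pCons.prems[of n "Suc i"] that by simp
  then have IH: "\<And>n. n < 0 \<Longrightarrow> poly q h $$ n = 0" "poly q h $$ 0 = poly (map_poly (\<lambda>f. f $$ 0) q) (h $$ 0)"
    using pCons.IH by blast+
  have mul: "(h * poly q h) $$ n = (\<Sum>i=0..n - 0. h $$ i * poly q h $$ (n - i))" for n
    by (rule fls_times_nth_bounds) (use h IH in auto)
  show ?case using c IH by (auto simp: mul map_poly_pCons)
qed simp

text \<open>
  Let \<open>g\<close> have a first coefficient outside \<open>F\<close>. Subtract the part before it and shift, so that it
  becomes the constant term. The equation transforms accordingly and can be scaled so that its
  coefficients have no poles and one of them has a nonzero constant term. The constant terms then
  form a nontrivial equation over \<open>F\<close> for the coefficient in question.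
\<close>

lemma algebraic_series_coefficients:
  fixes F :: "'a::field set"
  assumes F: "subfield F" "\<And>x. algebraic_over F x \<Longrightarrow> x \<in> F" and g: "algebraic_over (series_over F) g"
  shows "g \<in> series_over F"
proof (rule ccontr)
  assume "g \<notin> series_over F"
  have S: "subfield (series_over F)" by (rule subfield_series_over[OF F(1)])
  from first_coefficient_outside[OF F(1) \<open>g \<notin> series_over F\<close>]
  obtain r g1 h where gh: "g = g1 + h" "g1 \<in> series_over F" "\<And>n. n < r \<Longrightarrow> h $$ n = 0" "h $$ r = g $$ r" "g $$ r \<notin> F"
    by metis
  define h1 where "h1 = fls_shift r h"
  have h1: "\<And>n. n < 0 \<Longrightarrow> h1 $$ n = 0" "h1 $$ 0 = g $$ r" using gh by (auto simp: h1_def)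
  have hX: "h = fls_X_intpow r * h1" by (simp add: h1_def fls_X_intpow_times_conv_shift)
  obtain q where q: "q \<noteq> 0" "q \<in> polys_over (series_over F)" "poly q g = 0"
    using g by (auto simp: algebraic_over_def polys_over_def)
  define q2 where "q2 = q \<circ>\<^sub>p [:g1, fls_X_intpow r:]"
  have "fls_X_intpow r \<noteq> (0 :: 'a fls)" by (metis fls_X_intpow_nonzero)
  then have "q2 \<noteq> 0" unfolding q2_def using q(1) by (subst pcompose_eq_0_iff) auto
  have q2S: "q2 \<in> polys_over (series_over F)" unfolding q2_def
    using q(2) gh(2) series_over_X_intpow[OF F(1)]
    by (intro polys_over_pcompose[OF S] polys_over_pCons[OF S] polys_over_0[OF S])
  have "poly q2 h1 = 0" using q(3) gh(1) by (simp add: q2_def poly_pcompose hX mult.commute)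
  define J where "J = {j. coeff q2 j \<noteq> 0}"
  have J: "finite J" "J \<noteq> {}" unfolding J_def
    using \<open>q2 \<noteq> 0\<close> MOST_coeff_eq_0[of q2] by (auto simp: eventually_cofinite poly_eq_iff)
  define s where "s = Min ((\<lambda>j. fls_subdegree (coeff q2 j)) ` J)"
  obtain j0 where j0: "j0 \<in> J" "s = fls_subdegree (coeff q2 j0)"
    using Min_in[of "(\<lambda>j. fls_subdegree (coeff q2 j)) ` J"] J unfolding s_def by (metis (no_types, lifting) finite_imageI image_iff image_is_empty)
  have smin: "s \<le> fls_subdegree (coeff q2 j)" if "j \<in> J" for j
    unfolding s_def using J that by (intro Min_le) auto
  define q3 where "q3 = smult (fls_X_intpow (- s)) q2"
  have q3: "coeff q3 j $$ n = coeff q2 j $$ (n + s)" for j n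
    unfolding q3_def coeff_smult fls_X_intpow_times_conv_shift(1) by simp
  have "coeff q3 i $$ n = 0" if "n < 0" for n i
  proof (cases "i \<in> J")
    case True
    then show ?thesis using smin[OF True] that by (simp add: q3)
  next
    case False
    then show ?thesis by (simp add: q3 J_def)
  qed
  from poly_nth_0[OF this h1(1)] have "poly q3 h1 $$ 0 = poly (map_poly (\<lambda>f. f $$ 0) q3) (h1 $$ 0)" by blast
  moreover have "poly q3 h1 = 0" using \<open>poly q2 h1 = 0\<close> by (simp add: q3_def)
  ultimately have root: "poly (map_poly (\<lambda>f. f $$ 0) q3) (g $$ r) = 0" using h1(2) by simp
  have "coeff (map_poly (\<lambda>f. f $$ 0) q3) j0 \<noteq> 0"
    using j0 by (simp add: coeff_map_poly q3 J_def)
  then have "map_poly (\<lambda>f. f $$ 0) q3 \<noteq> 0" by auto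
  moreover have "coeff (map_poly (\<lambda>f. f $$ 0) q3) j \<in> F" for j
    using series_overD[OF polys_overD[OF q2S]] by (simp add: coeff_map_poly q3)
  ultimately have "algebraic_over F (g $$ r)" using root unfolding algebraic_over_def by blast
  then show False using F(2) gh(5) by blast
qed

section \<open>Expansion of functions of a transcendental element\<close>

text \<open>
  Read coefficient by coefficient, a linear relation between expansions with coefficients in \<open>F\<close> is
  a system of linear equations over \<open>F\<close>. A solution in \<open>G\<close> forces one in \<open>F\<close>.
\<close>

lemma dependence_descent:
  fixes \<phi> :: "'a::field \<Rightarrow> 'a fls"
  assumes N: "subfield N" and hom: "field_hom_on N \<phi>" and F: "subfield F" "F \<subseteq> G" "G \<subseteq> N"
    and const: "\<And>c. c \<in> G \<Longrightarrow> \<phi> c = fls_const c"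
    and I: "finite I" and h: "\<And>i. i \<in> I \<Longrightarrow> h i \<in> N" "\<And>i. i \<in> I \<Longrightarrow> \<phi> (h i) \<in> series_over F"
    and c: "\<And>i. i \<in> I \<Longrightarrow> c i \<in> G" "\<exists>i\<in>I. c i \<noteq> 0" "(\<Sum>i\<in>I. c i * h i) = 0"
  shows "\<exists>e. (\<forall>i\<in>I. e i \<in> F) \<and> (\<exists>i\<in>I. e i \<noteq> 0) \<and> (\<Sum>i\<in>I. e i * h i) = 0"
proof -
  have exp: "\<phi> (\<Sum>i\<in>I. e i * h i) $$ n = (\<Sum>i\<in>I. \<phi> (h i) $$ n * e i)" if "\<And>i. i \<in> I \<Longrightarrow> e i \<in> G" for e n
  proof -
    have eN: "e i \<in> N" if "i \<in> I" for i using that \<open>\<And>i. i \<in> I \<Longrightarrow> e i \<in> G\<close> F by auto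
    have "\<phi> (\<Sum>i\<in>I. e i * h i) = (\<Sum>i\<in>I. fls_const (e i) * \<phi> (h i))"
      using eN h that by (simp add: hom_sum[OF N hom] hom_mult[OF N hom] subfield_mult[OF N] const)
    then show ?thesis by (simp add: fls_nth_sum mult.commute)
  qed
  have zero: "(\<Sum>i\<in>I. \<phi> (h i) $$ n * c i) = 0" for n
    using exp[of c n, OF c(1)] c(3) hom_0[OF N hom] by simp
  have "\<exists>e. (\<forall>i\<in>I. e i \<in> F) \<and> (\<exists>i\<in>I. e i \<noteq> 0) \<and> (\<forall>n\<in>UNIV. (\<Sum>i\<in>I. \<phi> (h i) $$ n * e i) = 0)"
    by (rule homogeneous_system[OF F(1) I]) (use h(2) c(2) zero in \<open>auto simp: series_overD\<close>)
  then obtain e where e: "\<forall>i\<in>I. e i \<in> F" "\<exists>i\<in>I. e i \<noteq> 0" "\<forall>n\<in>UNIV. (\<Sum>i\<in>I. \<phi> (h i) $$ n * e i) = 0"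
    by blast
  have "\<phi> (\<Sum>i\<in>I. e i * h i) = 0" using exp[of e] e F by (intro fls_eqI) auto
  moreover have "(\<Sum>i\<in>I. e i * h i) \<in> N" using e(1) F h by (intro subfield_sum[OF N] subfield_mult[OF N]) auto
  ultimately have "(\<Sum>i\<in>I. e i * h i) = 0" using hom_eq_0[OF N hom] by blast
  then show ?thesis using e by blast
qed

text \<open>
  An algebraic relation between \<open>x\<close> and \<open>t\<close> over \<open>G\<close> is a linear relation between the monomials
  \<open>x\<^sup>i t\<^sup>j\<close>, and their expansions have coefficients in \<open>F\<close>. So there is a relation over \<open>F\<close> as well. It
  does not become trivial as an equation for \<open>x\<close>, since \<open>t\<close> is transcendental over \<open>F\<close>.
\<close>

lemma algebraic_if_coefficients:
  fixes \<phi> :: "'a::field \<Rightarrow> 'a fls"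
  assumes N: "subfield N" and hom: "field_hom_on N \<phi>" and F: "subfield F" "F \<subseteq> G" "subfield G" "G \<subseteq> N"
    and const: "\<And>c. c \<in> G \<Longrightarrow> \<phi> c = fls_const c"
    and t: "t \<in> N" "\<phi> t \<in> series_over F" "\<not> algebraic_over F t"
    and x: "x \<in> N" "\<phi> x \<in> series_over F" "algebraic_over (adjoin G {t}) x"
  shows "algebraic_over (adjoin F {t}) x"
proof -
  obtain P where P: "\<And>i. coeff P i \<in> polys_over G" "eval_inner t P \<noteq> 0" "poly (eval_inner t P) x = 0"
    using algebraic_over_adjoin[OF F(3) x(3)] by metis
  define d where "d = degree P"
  define m where "m = Max ((\<lambda>i. degree (coeff P i)) ` {..d})"
  define I where "I = {..d} \<times> {..m}"
  have I: "finite I" by (simp add: I_def)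
  have expand: "poly (\<Sum>i\<le>d. smult (x ^ i) (\<Sum>j\<le>m. monom (e (i, j)) j)) t = (\<Sum>ij\<in>I. e ij * (x ^ fst ij * t ^ snd ij))" for e
  proof -
    have "poly (\<Sum>i\<le>d. smult (x ^ i) (\<Sum>j\<le>m. monom (e (i, j)) j)) t = (\<Sum>i\<le>d. \<Sum>j\<le>m. e (i, j) * (x ^ i * t ^ j))"
      by (simp add: poly_sum poly_monom sum_distrib_left algebra_simps)
    then show ?thesis by (simp add: I_def sum.cartesian_product case_prod_unfold)
  qed
  have mono: "(\<Sum>j\<le>m. monom (coeff (coeff P i) j) j) = coeff P i" if "i \<le> d" for i
    unfolding m_def using that by (intro poly_as_sum_of_monoms' Max_ge) auto
  have "(\<Sum>ij\<in>I. coeff (coeff P (fst ij)) (snd ij) * (x ^ fst ij * t ^ snd ij)) = 0"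
    using P(3) unfolding poly_eval_inner expand[of "\<lambda>ij. coeff (coeff P (fst ij)) (snd ij)", symmetric]
    using mono by (simp add: d_def)
  moreover have "\<exists>ij\<in>I. coeff (coeff P (fst ij)) (snd ij) \<noteq> 0"
  proof (rule ccontr)
    assume "\<not> ?thesis"
    then have "coeff P i = 0" if "i \<le> d" for i using mono[OF that, symmetric] that by (auto simp: I_def)
    then have "P = 0" by (metis d_def leading_coeff_0_iff order_refl)
    then show False using P(2) by simp
  qed
  moreover have "\<phi> (x ^ i * t ^ j) \<in> series_over F" "x ^ i * t ^ j \<in> N" for i j
  proof -
    note S = subfield_series_over[OF F(1)]
    have pow: "\<phi> (y ^ i) \<in> series_over F \<and> y ^ i \<in> N" if "y \<in> N" "\<phi> y \<in> series_over F" for y i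
      using that by (induction i)
        (auto simp: hom_1[OF N hom] hom_mult[OF N hom] subfield_1[OF S] subfield_1[OF N] subfield_mult[OF S] subfield_mult[OF N])
    show "\<phi> (x ^ i * t ^ j) \<in> series_over F" "x ^ i * t ^ j \<in> N"
      using pow[OF x(1,2), of i] pow[OF t(1,2), of j] by (auto simp: hom_mult[OF N hom] subfield_mult[OF S] subfield_mult[OF N])
  qed
  ultimately obtain e where e: "\<forall>ij\<in>I. e ij \<in> F" "\<exists>ij\<in>I. e ij \<noteq> 0" "(\<Sum>ij\<in>I. e ij * (x ^ fst ij * t ^ snd ij)) = 0"
    using dependence_descent[OF N hom F(1,2,4) const I, of "\<lambda>ij. x ^ fst ij * t ^ snd ij" "\<lambda>ij. coeff (coeff P (fst ij)) (snd ij)"]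
      polys_overD[OF P(1)] by blast
  define Q where "Q = (\<lambda>i. \<Sum>j\<le>m. monom (e (i, j)) j)"
  have Qc: "coeff (Q i) j = (if j \<le> m then e (i, j) else 0)" for i j by (simp add: Q_def coeff_sum)
  have QF: "Q i \<in> polys_over F" if "i \<le> d" for i
    using e(1) that subfield_0[OF F(1)] by (intro polys_overI) (auto simp: Qc I_def)
  define R where "R = (\<Sum>i\<le>d. monom (poly (Q i) t) i)"
  have Rc: "coeff R i = (if i \<le> d then poly (Q i) t else 0)" for i by (simp add: R_def coeff_sum)
  have "poly R x = 0"
    using e(3) expand[of e] by (simp add: R_def Q_def poly_sum poly_monom mult.commute)
  moreover have "coeff R i \<in> adjoin F {t}" for i
  proof -
    note A = subfield_adjoin[of F "{t}"]
    have "poly (Q i) t \<in> adjoin F {t}" if "i \<le> d"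
      using poly_in_subfield[OF A polys_over_mono[OF _ QF[OF that]]] adjoin_superset[of F "{t}"] by auto
    then show ?thesis using subfield_0[OF A] by (simp add: Rc)
  qed
  moreover have "R \<noteq> 0"
  proof
    assume "R = 0"
    obtain i j where ij: "i \<le> d" "j \<le> m" "e (i, j) \<noteq> 0" using e(2) by (auto simp: I_def)
    then have "Q i \<noteq> 0" using Qc[of i j] by auto
    moreover have "poly (Q i) t = 0" using Rc[of i] ij \<open>R = 0\<close> by simp
    ultimately show False using t(3) QF[OF ij(1)] by (auto simp: algebraic_over_def polys_over_def)
  qed
  ultimately show ?thesis unfolding algebraic_over_def by blast
qed

text \<open>The variable \<open>X\<close> represents \<open>1/t\<close>.\<close>

lemma expansion_at_infinity:
  fixes K :: "'a::field set"
  assumes K: "subfield K" and t: "\<not> algebraic_over K t"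
  obtains \<phi> where "field_hom_on (adjoin K {t}) \<phi>" "\<And>c. c \<in> K \<Longrightarrow> \<phi> c = fls_const c" "\<phi> t = fls_X_intpow (- 1)"
proof -
  have hom: "field_hom_on K (fls_const :: 'a \<Rightarrow> 'a fls)"
    by (auto simp: field_hom_on_def fls_plus_const)
  have "poly p t = 0 \<longleftrightarrow> poly (map_poly fls_const p) (fls_X_intpow (- 1)) = 0" if p: "p \<in> polys_over K" for p
  proof -
    have pow: "fls_X_intpow (- 1) ^ i = (fls_X_intpow (- int i) :: 'a fls)" for i
    proof (induction i)
      case (Suc i)
      have "- 1 + - int i = - int (Suc i)" by simp
      then show ?case by (simp only: power_Suc Suc fls_X_intpow_times_fls_X_intpow)
    qed simp
    have nth: "poly (map_poly fls_const p) (fls_X_intpow (- 1)) $$ (- int j) = coeff p j" for j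
    proof -
      have "poly (map_poly fls_const p) (fls_X_intpow (- 1)) = (\<Sum>i\<le>degree p. fls_const (coeff p i) * fls_X_intpow (- int i))"
      proof -
        have "poly (map_poly fls_const p) (fls_X_intpow (- 1))
          = (\<Sum>i\<le>degree p. coeff (map_poly fls_const p) i * fls_X_intpow (- 1) ^ i)"
          by (intro poly_eq_sum degree_map_poly_le) simp
        then show ?thesis unfolding pow by (simp add: coeff_map_poly)
      qed
      then have "poly (map_poly fls_const p) (fls_X_intpow (- 1)) $$ (- int j) = (\<Sum>i\<le>degree p. if i = j then coeff p i else 0)"
        by (simp add: fls_nth_sum if_distrib cong: if_cong)
      then show ?thesis by (simp add: coeff_eq_0)
    qed
    have "p = 0" if "poly (map_poly fls_const p) (fls_X_intpow (- 1)) = 0"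
      using nth that by (intro poly_eqI) simp
    moreover have "p = 0" if "poly p t = 0" using p that t by (auto simp: algebraic_over_def polys_over_def)
    ultimately show ?thesis by auto
  qed
  from extend_hom[OF K hom this] show thesis using that by metis
qed

text \<open>
  The expansion of \<open>u\<close> has a coefficient outside \<open>k\<close>, because \<open>u\<close> is not algebraic over \<open>k(t)\<close>. The first
  such coefficient is the required element \<open>v\<close>. If \<open>t\<close> is an antiderivative, so that \<open>e > 0\<close>, and
  \<open>u' = b\<close>, then \<open>v'\<close> lies in \<open>k\<close>.
\<close>

lemma first_order_from_expansion:
  fixes D :: "'a::field \<Rightarrow> 'a"
  assumes D: "derivation D" and k: "diff_subfield D k" and K: "diff_subfield D K" "k \<subseteq> K"
    and N: "diff_subfield D N" "K \<subseteq> N" and hom: "field_hom_on N \<phi>" and const: "\<And>c. c \<in> K \<Longrightarrow> \<phi> c = fls_const c"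
    and compat: "\<And>x. x \<in> N \<Longrightarrow> \<phi> (D x) = series_derivation D w e (\<phi> x)" and w: "w \<in> k"
    and t: "t \<in> N" "\<phi> t \<in> series_over k" "\<not> algebraic_over k t"
    and u: "u \<in> N" "\<phi> u \<in> series_over K" "algebraic_over (adjoin K {t}) u" "\<not> algebraic_over (adjoin k {t}) u"
    and ab: "a \<in> N" "b \<in> N" "\<phi> a \<in> series_over k" "\<phi> b \<in> series_over k" "D u = a * u + b"
  obtains v a' b' where "v \<in> K - k" "a' \<in> k" "b' \<in> k" "D v = a' * v + b'" "a = 0 \<Longrightarrow> e > 0 \<Longrightarrow> a' = 0"
proof -
  have sk: "subfield k" "\<And>x. x \<in> k \<Longrightarrow> D x \<in> k" and sK: "subfield K" and sN: "subfield N"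
    using k K N by (auto simp: diff_subfield_def)
  have nu: "\<phi> u \<notin> series_over k"
    using algebraic_if_coefficients[OF sN hom sk(1) K(2) sK N(2) const t u(1) _ u(3)] u(4) by blast
  have "series_derivation D w e (\<phi> u) = \<phi> a * \<phi> u + \<phi> b"
    using compat[OF u(1)] ab u(1) by (simp add: hom_add[OF sN hom] hom_mult[OF sN hom] subfield_mult[OF sN])
  from first_order_coefficient[OF D sk w ab(3,4) nu this]
  obtain r a' b' where *: "\<phi> u $$ r \<notin> k" "a' \<in> k" "b' \<in> k" "D (\<phi> u $$ r) = a' * \<phi> u $$ r + b'"
    "\<phi> a = 0 \<Longrightarrow> e > 0 \<Longrightarrow> a' = 0" by metis
  moreover have "\<phi> u $$ r \<in> K" using u(2) by (rule series_overD)
  moreover have "\<phi> a = 0" if "a = 0" using that hom_0[OF sN hom] by simp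
  ultimately show thesis using that by blast
qed

section \<open>First-order elements in liouvillian towers\<close>

text \<open>
  The element \<open>z\<close> is mapped to a Puiseux root of its minimal polynomial over \<open>K(t)\<close>, whose
  ramification index is \<open>m\<close>. The homomorphism commutes with the derivations on \<open>K\<close> and at \<open>t\<close>, hence
  on \<open>K(t)\<close> and on its algebraic extension.
\<close>

lemma puiseux_expansion:
  fixes D :: "'a::{alg_closed_field, field_char_0} \<Rightarrow> 'a"
  assumes D: "derivation D" and K: "diff_subfield D K" and t: "\<not> algebraic_over K t"
    and f: "f \<in> K" "D t = f \<or> D t = f * t" and z: "algebraic_over (adjoin K {t}) z"
  obtains \<psi> m w e where "m > 0" "field_hom_on (adjoin (adjoin K {t}) {z}) \<psi>" "\<And>c. c \<in> K \<Longrightarrow> \<psi> c = fls_const c"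
    "\<psi> t = fls_X_intpow (- int m)" "w = - f / of_nat m"
    "diff_subfield D (adjoin (adjoin K {t}) {z})"
    "\<And>x. x \<in> adjoin (adjoin K {t}) {z} \<Longrightarrow> \<psi> (D x) = series_derivation D w e (\<psi> x)"
proof -
  define G where "G = adjoin K {t}"
  define N where "N = adjoin G {z}"
  have sK: "subfield K" and DK: "\<And>x. x \<in> K \<Longrightarrow> D x \<in> K" using K by (auto simp: diff_subfield_def)
  have sG: "subfield G" unfolding G_def by (rule subfield_adjoin)
  have G: "K \<subseteq> G" "t \<in> G" using adjoin_superset[of K "{t}"] by (auto simp: G_def)
  have z: "algebraic_over G z" using assms(6) by (simp add: G_def)
  have sN: "subfield N" unfolding N_def by (rule subfield_adjoin)
  have N: "G \<subseteq> N" "z \<in> N" using adjoin_superset[of G "{z}"] by (auto simp: N_def)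
  have dG: "diff_subfield D G" unfolding G_def
  proof (rule diff_subfield_adjoin[OF D K])
    fix x assume "x \<in> {t}"
    then show "D x \<in> adjoin K {t}" using f G subfield_mult[OF sG] unfolding G_def by auto
  qed
  have Neq: "N = eval_ring G z" unfolding N_def by (rule adjoin_algebraic[OF sG z])
  have dN: "diff_subfield D N" unfolding diff_subfield_def
    using sN derivation_eval_ring[OF D dG z] unfolding Neq by blast
  obtain \<phi> where \<phi>: "field_hom_on G \<phi>" "\<And>c. c \<in> K \<Longrightarrow> \<phi> c = fls_const c" "\<phi> t = fls_X_intpow (- 1)"
    using expansion_at_infinity[OF sK t] unfolding G_def by metis
  obtain p where p: "p \<in> polys_over G" "lead_coeff p = 1" "degree p > 0" "poly p z = 0"
    "\<And>q. q \<in> polys_over G \<Longrightarrow> poly q z = 0 \<Longrightarrow> \<exists>s\<in>polys_over G. q = s * p"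
    using minimal_polynomial[OF sG z] by metis
  have "degree p \<le> degree (map_poly \<phi> p)"
    using p(2) hom_1[OF sG \<phi>(1)] hom_0[OF sG \<phi>(1)] by (intro le_degree) (simp add: coeff_map_poly)
  then have "has_puiseux_root (map_poly \<phi> p)" using p(3) by (intro puiseux_root) linarith
  then obtain m \<gamma> where m: "m > 0" "poly (map_poly (ramify m) (map_poly \<phi> p)) \<gamma> = 0"
    by (auto simp: has_puiseux_root_def)
  define \<phi>' where "\<phi>' x = ramify m (\<phi> x)" for x
  have h': "field_hom_on G \<phi>'" using \<phi>(1) m(1) by (auto simp: field_hom_on_def \<phi>'_def)
  have "map_poly (ramify m) (map_poly \<phi> p) = map_poly \<phi>' p"
    by (intro poly_eqI) (simp add: coeff_map_poly \<phi>'_def hom_0[OF sG \<phi>(1)])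
  then have "poly (map_poly \<phi>' p) \<gamma> = 0" using m(2) by simp
  then have rel: "poly q z = 0 \<longleftrightarrow> poly (map_poly \<phi>' q) \<gamma> = 0" if "q \<in> polys_over G" for q
    using algebraic_relations[OF sG h' p(1,5) z p(4)] that by blast
  obtain \<psi> where \<psi>: "field_hom_on N \<psi>" "\<And>a. a \<in> G \<Longrightarrow> \<psi> a = \<phi>' a"
    using extend_hom[OF sG h' rel] unfolding N_def by metis
  have \<psi>c: "\<psi> c = fls_const c" if "c \<in> K" for c
    using that G m(1) by (auto simp: \<psi>(2) \<phi>'_def \<phi>(2))
  have \<psi>t: "\<psi> t = fls_X_intpow (- int m)"
    using G(2) m(1) unfolding \<psi>(2)[OF G(2)] \<phi>'_def \<phi>(3) by (subst fls_compose_power_X_intpow) simp_all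
  define w where "w = - f / of_nat m"
  \<comment> \<open>With this choice the image of \<open>t\<close> satisfies the differential equation of \<open>t\<close>.\<close>
  define e where "e = (if D t = f then m else 0)"
  define \<delta> where "\<delta> = series_derivation D w e"
  have \<delta>: "derivation \<delta>" unfolding \<delta>_def by (rule derivation_series_derivation[OF D])
  have "\<psi> (D t) = \<delta> (\<psi> t)"
  proof -
    have wm: "w * of_int (- int m) = f" using m(1) by (simp add: w_def)
    have "\<delta> (\<psi> t) = fls_const f * fls_X_intpow (- int m + int e)"
      unfolding \<delta>_def \<psi>t series_derivation_X_intpow[OF D] wm by (rule refl)
    also have "\<dots> = \<psi> (D t)"
    proof (cases "D t = f")
      case True
      then show ?thesis using \<psi>c[OF f(1)] by (simp add: e_def)
    next
      case False
      then have "D t = f * t" using f(2) by blast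
      then have "\<psi> (D t) = \<psi> f * \<psi> t" using hom_mult[OF sN \<psi>(1), of f t] f(1) G N by auto
      then show ?thesis using False by (simp add: e_def \<psi>t \<psi>c[OF f(1)])
    qed
    finally show ?thesis by simp
  qed
  moreover have "\<psi> (D c) = \<delta> (\<psi> c)" if "c \<in> K" for c
    using that DK by (simp add: \<psi>c \<delta>_def series_derivation_const[OF D])
  ultimately have "G \<subseteq> {x \<in> N. \<psi> (D x) = \<delta> (\<psi> x)}"
    unfolding G_def using G N
    by (intro adjoin_minimal hom_derivation_subfield[OF dN \<psi>(1) D \<delta>]) auto
  then have cG: "\<psi> (D x) = \<delta> (\<psi> x)" if "x \<in> G" for x using that by auto
  have compat: "\<psi> (D x) = \<delta> (\<psi> x)" if "x \<in> N" for x
  proof (rule hom_derivation_algebraic[OF dN \<psi>(1) D \<delta> sG N(1) cG that])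
    show "algebraic_over G x"
      by (rule finite_algebra_algebraic[OF sG finite_algebra_eval_ring[OF sG z]]) (use that Neq in simp)
  qed
  show thesis
    by (rule that[OF m(1) \<psi>(1)[unfolded N_def G_def] \<psi>c \<psi>t w_def dN[unfolded N_def G_def]])
      (use compat in \<open>auto simp: N_def G_def \<delta>_def\<close>)
qed

text \<open>
  Two applications of the theorem on primitive elements put \<open>u\<close>, \<open>a\<close> and \<open>b\<close> into one simple extension
  of \<open>K(t)\<close>, where they can be expanded. The coefficients of \<open>u\<close> lie in \<open>K\<close> and those of \<open>a\<close> and \<open>b\<close>
  in \<open>k\<close>, since \<open>K\<close> and \<open>k\<close> are algebraically closed.
\<close>

lemma first_order_descent_transcendental:
  fixes D :: "'a::{alg_closed_field, field_char_0} \<Rightarrow> 'a"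
  assumes D: "derivation D" and k: "diff_subfield D k" "acl k = k" and K: "diff_subfield D K" "acl K = K" "k \<subseteq> K"
    and t: "t \<notin> K" "f \<in> k" "D t = f \<or> D t = f * t"
    and u: "u \<in> acl (K \<union> {t}) - acl (k \<union> {t})"
    and ab: "a \<in> acl (k \<union> {t})" "b \<in> acl (k \<union> {t})" "D u = a * u + b"
  obtains v a' b' where "v \<in> K - k" "a' \<in> k" "b' \<in> k" "D v = a' * v + b'"
proof -
  have sk: "subfield k" and sK: "subfield K" using k K by (auto simp: diff_subfield_def)
  have acl1: "acl (F \<union> {t}) = {x. algebraic_over (adjoin F {t}) x}" for F
    using acl_adjoin[of F "{t}"] acl_subfield[OF subfield_adjoin, of F "{t}"] by simp
  have closedK: "\<And>x. algebraic_over K x \<Longrightarrow> x \<in> K" and closedk: "\<And>x. algebraic_over k x \<Longrightarrow> x \<in> k"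
    using acl_subfield[OF sK] acl_subfield[OF sk] K(2) k(2) by auto
  define G where "G = adjoin K {t}"
  have sG: "subfield G" unfolding G_def by (rule subfield_adjoin)
  have kG: "adjoin k {t} \<subseteq> G" unfolding G_def by (rule adjoin_mono[OF K(3)]) simp
  have u1: "algebraic_over G u" "\<not> algebraic_over (adjoin k {t}) u" using u unfolding acl1 G_def by blast+
  have ab1: "algebraic_over (adjoin k {t}) a" "algebraic_over (adjoin k {t}) b" using ab unfolding acl1 by blast+
  obtain z1 where z1: "algebraic_over G z1" "u \<in> eval_ring G z1" "a \<in> eval_ring G z1"
    using primitive_element[OF sG u1(1) algebraic_over_mono[OF kG ab1(1)]] by metis
  obtain z where z: "algebraic_over G z" "z1 \<in> eval_ring G z" "b \<in> eval_ring G z"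
    using primitive_element[OF sG z1(1) algebraic_over_mono[OF kG ab1(2)]] by metis
  define N where "N = adjoin G {z}"
  have Neq: "N = eval_ring G z" unfolding N_def by (rule adjoin_algebraic[OF sG z(1)])
  have sN: "subfield N" unfolding N_def by (rule subfield_adjoin)
  have GN: "G \<subseteq> N" unfolding N_def using adjoin_superset[of G] by auto
  have "eval_ring G z1 \<subseteq> N"
    unfolding eval_ring_def using z(2) Neq GN poly_in_subfield[OF sN] polys_over_mono by blast
  then have uabN: "u \<in> N" "a \<in> N" "b \<in> N" using z1 z Neq by auto
  have nt: "\<not> algebraic_over K t" and fK: "f \<in> K" using t(1,2) K(3) closedK by blast+
  obtain \<psi> m w e where \<psi>: "m > 0" "field_hom_on N \<psi>" "\<And>c. c \<in> K \<Longrightarrow> \<psi> c = fls_const c"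
    "\<psi> t = fls_X_intpow (- int m)" "w = - f / of_nat m" "diff_subfield D N"
    "\<And>x. x \<in> N \<Longrightarrow> \<psi> (D x) = series_derivation D w e (\<psi> x)"
    by (rule puiseux_expansion[OF D K(1) nt fK t(3) z(1)[unfolded G_def], folded G_def, folded N_def], rule that)
  have KN: "K \<subseteq> N" "t \<in> N" using GN adjoin_superset[of K "{t}"] by (auto simp: G_def)
  have coeffs: "\<psi> x \<in> series_over F"
    if "x \<in> N" "algebraic_over (adjoin F {t}) x" "subfield F" "F \<subseteq> K" "\<And>x. algebraic_over F x \<Longrightarrow> x \<in> F" for F x
  proof (rule algebraic_series_coefficients[OF that(3,5)])
    have "F \<subseteq> N" using that(4) KN by blast
    have "\<psi> ` adjoin F {t} \<subseteq> series_over F"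
      using that(4) KN \<psi>(3) series_over_const[OF that(3)] series_over_X_intpow[OF that(3), of "- int m", folded \<psi>(4)]
      by (intro hom_adjoin_subset[OF sN \<psi>(2) subfield_series_over[OF that(3)]]) auto
    moreover have "adjoin F {t} \<subseteq> N" using KN \<open>F \<subseteq> N\<close> by (intro adjoin_minimal[OF sN]) auto
    ultimately show "algebraic_over (series_over F) (\<psi> x)"
      by (intro hom_image_algebraic[OF sN \<psi>(2) _ _ that(1,2)])
  qed
  have wk: "w \<in> k" unfolding \<psi>(5) using t(2)
    by (intro subfield_divide[OF sk] subfield_uminus[OF sk] subfield_of_nat[OF sk])
  show thesis
  proof (rule first_order_from_expansion[OF D k(1) K(1,3) \<psi>(6) KN(1) \<psi>(2,3,7) wk KN(2) _ _ uabN(1) _ _ _ uabN(2,3) _ _ ab(3)])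
    show "\<psi> t \<in> series_over k" unfolding \<psi>(4) by (rule series_over_X_intpow[OF sk])
    show "\<not> algebraic_over k t" using closedk K(3) t(1) by blast
    show "\<psi> u \<in> series_over K" by (rule coeffs[OF uabN(1) _ sK order_refl closedK]) (use u1 in \<open>simp add: G_def\<close>)
    show "algebraic_over (adjoin K {t}) u" "\<not> algebraic_over (adjoin k {t}) u" using u1 by (auto simp: G_def)
    show "\<psi> a \<in> series_over k" "\<psi> b \<in> series_over k"
      using coeffs[OF _ _ sk K(3) closedk] uabN ab1 by blast+
  qed (use that in blast)+
qed

text \<open>
  The induction removes the lowest generator \<open>t 0\<close>. If it lies in neither field, then \<open>k\<close> and \<open>K\<close> are
  replaced by the algebraic closures \<open>L\<close> and \<open>M\<close> of \<open>k(t 0)\<close> and \<open>K(t 0)\<close>. These differ: for \<open>x \<in> K - k\<close>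
  algebraic over \<open>k(t 0)\<close>, the exchange property would make \<open>t 0\<close> algebraic over \<open>k(x)\<close> and so an
  element of \<open>K\<close>.
\<close>

theorem first_order_element_closed:
  fixes D :: "'a::{alg_closed_field, field_char_0} \<Rightarrow> 'a" and n :: nat
  assumes D: "derivation D"
  shows "diff_subfield D k \<Longrightarrow> acl k = k \<Longrightarrow> diff_subfield D K \<Longrightarrow> acl K = K \<Longrightarrow> k \<subseteq> K \<Longrightarrow>
    K \<subseteq> acl (k \<union> t ` {..<n}) \<Longrightarrow>
    (\<And>i. i < n \<Longrightarrow> D (t i) \<in> acl (k \<union> t ` {..<i}) \<or> t i \<noteq> 0 \<and> D (t i) / t i \<in> acl (k \<union> t ` {..<i})
      \<or> t i \<in> acl (k \<union> t ` {..<i})) \<Longrightarrow> K \<noteq> k \<Longrightarrow>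
    \<exists>u\<in>K - k. \<exists>a\<in>k. \<exists>b\<in>k. D u = a * u + b"
proof (induction n arbitrary: t k K)
  case 0
  then show ?case by auto
next
  case (Suc n)
  have sk: "subfield k" and sK: "subfield K" and Dk: "\<And>x. x \<in> k \<Longrightarrow> D x \<in> k" and DK: "\<And>x. x \<in> K \<Longrightarrow> D x \<in> K"
    using Suc.prems by (auto simp: diff_subfield_def)
  define s where "s i = t (Suc i)" for i
  have img: "t ` {..<Suc i} = insert (t 0) (s ` {..<i})" for i
    by (auto simp: s_def image_iff lessThan_Suc_eq_insert_0)
  have step0: "D (t 0) \<in> k \<or> t 0 \<noteq> 0 \<and> D (t 0) / t 0 \<in> k \<or> t 0 \<in> k"
    using Suc.prems(7)[of 0] Suc.prems(2) by simp
  show ?case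
  proof (cases "t 0 \<in> k")
    case True
    have eq: "k \<union> t ` {..<Suc i} = k \<union> s ` {..<i}" for i using True by (auto simp: img)
    have "D (s i) \<in> acl (k \<union> s ` {..<i}) \<or> s i \<noteq> 0 \<and> D (s i) / s i \<in> acl (k \<union> s ` {..<i})
        \<or> s i \<in> acl (k \<union> s ` {..<i})" if "i < n" for i
      using Suc.prems(7)[of "Suc i"] that unfolding eq by (simp add: s_def)
    then show ?thesis
      using Suc.IH[of k K s] Suc.prems(1-6,8) unfolding eq by blast
  next
    case tk: False
    then obtain f where f: "f \<in> k" "D (t 0) = f \<or> D (t 0) = f * t 0"
      using step0 by (metis nonzero_eq_divide_eq)
    show ?thesis
    proof (cases "t 0 \<in> K")
      case True
      have "D (t 0) = 0 * t 0 + f \<or> D (t 0) = f * t 0 + 0" using f(2) by simp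
      then have "\<exists>a\<in>k. \<exists>b\<in>k. D (t 0) = a * t 0 + b" using f(1) subfield_0[OF sk] by blast
      with True tk show ?thesis by blast
    next
      case tK: False
      define L where "L = acl (k \<union> {t 0})"
      define M where "M = acl (K \<union> {t 0})"
      have dt: "D (t 0) \<in> acl (F \<union> {t 0})" if "k \<subseteq> F" for F
      proof -
        have "f \<in> acl (F \<union> {t 0})" "t 0 \<in> acl (F \<union> {t 0})"
          using that f(1) acl_superset[of "F \<union> {t 0}"] by auto
        then show ?thesis using f(2) subfield_mult[OF subfield_acl] by metis
      qed
      have dd: "diff_subfield D (acl (F \<union> {t 0}))" if F: "k \<subseteq> F" "\<And>x. x \<in> F \<Longrightarrow> D x \<in> F" for F
      proof (rule diff_subfield_acl[OF D])
        fix x assume "x \<in> F \<union> {t 0}"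
        then consider "x \<in> F" | "x = t 0" by auto
        then show "D x \<in> acl (F \<union> {t 0})"
        proof cases
          case 1
          then have "D x \<in> F \<union> {t 0}" using F(2) by simp
          then show ?thesis by (rule subsetD[OF acl_superset])
        next
          case 2
          then show ?thesis using dt[OF F(1)] by simp
        qed
      qed
      have dL: "diff_subfield D L" unfolding L_def by (rule dd[OF order_refl Dk])
      have dM: "diff_subfield D M" unfolding M_def by (rule dd[OF Suc.prems(5) DK])
      have LM: "L \<subseteq> M" unfolding L_def M_def using Suc.prems(5) by (intro acl_mono) auto
      have eq: "acl (L \<union> s ` {..<i}) = acl (k \<union> t ` {..<Suc i})" for i
        unfolding L_def acl_acl_Un img by simp
      have "M \<noteq> L"
      proof
        assume "M = L"
        obtain x where x: "x \<in> K" "x \<notin> k" using Suc.prems(5,8) by blast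
        have "x \<in> M" unfolding M_def by (rule subsetD[OF acl_superset]) (use x in simp)
        then have "x \<in> L" using \<open>M = L\<close> by simp
        then have "x \<in> acl (k \<union> {t 0})" unfolding L_def .
        then have "t 0 \<in> acl (k \<union> {x})" by (rule acl_exchange) (use x(2) Suc.prems(2) in simp)
        moreover have "acl (k \<union> {x}) \<subseteq> K" using acl_mono[of "k \<union> {x}" K] x(1) Suc.prems(4,5) by auto
        ultimately show False using tK by blast
      qed
      have "\<exists>u\<in>M - L. \<exists>a\<in>L. \<exists>b\<in>L. D u = a * u + b"
      proof (rule Suc.IH[OF dL _ dM _ LM, of s])
        show "acl L = L" "acl M = M" unfolding L_def M_def by (rule acl_idem)+
        show "M \<subseteq> acl (L \<union> s ` {..<n})" unfolding eq M_def
        proof (intro acl_minimal Un_least Suc.prems(6))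
          have "t 0 \<in> acl (k \<union> t ` {..<Suc n})" by (rule subsetD[OF acl_superset]) simp
          then show "{t 0} \<subseteq> acl (k \<union> t ` {..<Suc n})" by simp
        qed
        show "D (s i) \<in> acl (L \<union> s ` {..<i}) \<or> s i \<noteq> 0 \<and> D (s i) / s i \<in> acl (L \<union> s ` {..<i})
          \<or> s i \<in> acl (L \<union> s ` {..<i})" if "i < n" for i
          unfolding eq using Suc.prems(7)[of "Suc i"] that by (simp add: s_def)
      qed (fact \<open>M \<noteq> L\<close>)
      then obtain u a b where *: "u \<in> M - L" "a \<in> L" "b \<in> L" "D u = a * u + b" by blast
      obtain v a' b' where "v \<in> K - k" "a' \<in> k" "b' \<in> k" "D v = a' * v + b'"
        by (rule first_order_descent_transcendental[OF D Suc.prems(1,2,3,4,5) tK f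
            *[unfolded L_def M_def]], rule that)
      then show ?thesis by blast
    qed
  qed
qed

section \<open>Elements of finite-dimensional differential modules\<close>

text \<open>
  The finite-dimensional space spanned by \<open>B\<close> is closed under \<open>D\<close>. In this form the property is
  visibly inherited by sums and products, whereas the equivalent existence of a linear homogeneous
  equation is not.
\<close>

definition holonomic :: "('a::field \<Rightarrow> 'a) \<Rightarrow> 'a set \<Rightarrow> 'a \<Rightarrow> bool" where
  "holonomic D F y \<longleftrightarrow> (\<exists>B. finite B \<and> y \<in> fspan F B \<and> (\<forall>b\<in>B. D b \<in> fspan F B))"

lemma fspan_mono:
  assumes F: "subfield F" and "finite C" "B \<subseteq> C"
  shows "fspan F B \<subseteq> fspan F C"
  using fspan_superset[OF F assms(2)] assms(3) by (intro fspan_minimal fsubspace_fspan[OF F]) auto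

lemma fspan_derivation_closed:
  assumes D: "derivation D" and F: "diff_subfield D F" and B: "finite B" "\<And>b. b \<in> B \<Longrightarrow> D b \<in> fspan F B"
    and x: "x \<in> fspan F B"
  shows "D x \<in> fspan F B"
proof -
  have sF: "subfield F" and dF: "\<And>x. x \<in> F \<Longrightarrow> D x \<in> F" using F by (auto simp: diff_subfield_def)
  have V: "fsubspace F (fspan F B)" by (rule fsubspace_fspan[OF sF])
  have "fsubspace F {x \<in> fspan F B. D x \<in> fspan F B}"
    using V dF by (simp add: fsubspace_def derivation_0[OF D] derivation_add[OF D] derivation_mult[OF D])
  then have "fspan F B \<subseteq> {x \<in> fspan F B. D x \<in> fspan F B}"
    by (rule fspan_minimal) (use B fspan_superset[OF sF B(1)] in auto)
  then show ?thesis using x by auto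
qed

text \<open>
  More derivatives of \<open>y\<close> than the dimension of the space are dependent, and the relation is divided
  by its highest nonzero coefficient. If that belongs to \<open>y\<close> itself, then \<open>y = 0\<close>.
\<close>

lemma holonomic_imp_lhde:
  assumes D: "derivation D" and F: "diff_subfield D F" and y: "holonomic D F y"
  shows "satisfies_lhde D F y"
proof -
  have sF: "subfield F" using F by (auto simp: diff_subfield_def)
  obtain B where B: "finite B" "y \<in> fspan F B" "\<And>b. b \<in> B \<Longrightarrow> D b \<in> fspan F B"
    using y by (auto simp: holonomic_def)
  have "(D ^^ j) y \<in> fspan F B" for j
    by (induction j) (use B fspan_derivation_closed[OF D F B(1,3)] in auto)
  then obtain e where e: "\<forall>i<Suc (card B). e i \<in> F" "\<exists>i<Suc (card B). e i \<noteq> 0" "(\<Sum>i<Suc (card B). e i * (D ^^ i) y) = 0"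
    using fspan_dependent[OF sF B(1), of "Suc (card B)" "\<lambda>i. (D ^^ i) y"] by blast
  define n where "n = card B"
  \<comment> \<open>The order of the equation is the index of the last nonzero coefficient.\<close>
  define m where "m = (GREATEST i. i \<le> n \<and> e i \<noteq> 0)"
  have ex: "\<exists>i. i \<le> n \<and> e i \<noteq> 0" using e(2) by (auto simp: n_def less_Suc_eq_le)
  have m: "m \<le> n \<and> e m \<noteq> 0" unfolding m_def using GreatestI_ex_nat[OF ex, of n] by auto
  have mtop: "i \<le> m" if "i \<le> n" "e i \<noteq> 0" for i
    unfolding m_def using that Greatest_le_nat[of "\<lambda>i. i \<le> n \<and> e i \<noteq> 0" i n] by auto
  have "(\<Sum>i<Suc n. e i * (D ^^ i) y) = (\<Sum>i<Suc m. e i * (D ^^ i) y)"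
  proof (rule sum.mono_neutral_right)
    show "\<forall>i\<in>{..<Suc n} - {..<Suc m}. e i * (D ^^ i) y = 0"
    proof
      fix i assume "i \<in> {..<Suc n} - {..<Suc m}"
      then have "i \<le> n" "\<not> i \<le> m" by auto
      then have "e i = 0" using mtop by blast
      then show "e i * (D ^^ i) y = 0" by simp
    qed
  qed (use m in auto)
  then have s: "e m * (D ^^ m) y + (\<Sum>i<m. e i * (D ^^ i) y) = 0" using e(3) by (simp add: n_def add.commute)
  show ?thesis
  proof (cases "m = 0")
    case True
    then have "y = 0" using s m by simp
    then show ?thesis unfolding satisfies_lhde_def using subfield_0[OF sF]
      by (intro exI[of _ 1] exI[of _ "\<lambda>_. 0"]) (simp add: derivation_0[OF D])
  next
    case False
    have "(D ^^ m) y + (\<Sum>i<m. e i / e m * (D ^^ i) y) = (e m * (D ^^ m) y + (\<Sum>i<m. e i * (D ^^ i) y)) / e m"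
      using m by (simp add: add_divide_distrib sum_divide_distrib)
    then have "(D ^^ m) y + (\<Sum>i<m. e i / e m * (D ^^ i) y) = 0" using s by simp
    then show ?thesis unfolding satisfies_lhde_def using False m e(1) n_def
      by (intro exI[of _ m] exI[of _ "\<lambda>i. e i / e m"]) (auto intro!: subfield_divide[OF sF])
  qed
qed

lemma lhde_imp_holonomic:
  assumes F: "subfield F" and y: "satisfies_lhde D F y"
  shows "holonomic D F y"
proof -
  obtain m a where m: "m \<ge> 1" "\<forall>j<m. a j \<in> F" "(D ^^ m) y + (\<Sum>j<m. a j * (D ^^ j) y) = 0"
    using y by (auto simp: satisfies_lhde_def)
  define B where "B = (\<lambda>j. (D ^^ j) y) ` {..<m}"
  have B: "finite B" by (simp add: B_def)
  have V: "fsubspace F (fspan F B)" by (rule fsubspace_fspan[OF F])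
  have low: "(D ^^ j) y \<in> fspan F B" if "j < m" for j
    using fspan_superset[OF F B] that by (auto simp: B_def)
  have "(D ^^ m) y = (\<Sum>j<m. (- a j) * (D ^^ j) y)"
    using m(3) by (simp add: sum_negf eq_neg_iff_add_eq_0)
  moreover have "(\<Sum>j<m. (- a j) * (D ^^ j) y) \<in> fspan F B"
  proof (rule fsubspace_sum[OF V])
    fix i assume "i \<in> {..<m}"
    then have "- a i \<in> F" "(D ^^ i) y \<in> fspan F B" using low m(2) subfield_uminus[OF F] by auto
    then show "- a i * (D ^^ i) y \<in> fspan F B" using V unfolding fsubspace_def by blast
  qed
  ultimately have top: "(D ^^ m) y \<in> fspan F B" by simp
  have "D b \<in> fspan F B" if b: "b \<in> B" for b
  proof -
    obtain j where j: "j < m" "b = (D ^^ j) y" using b by (auto simp: B_def)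
    then have "D b = (D ^^ Suc j) y" by simp
    then show ?thesis using low[of "Suc j"] top j(1) by (cases "Suc j = m") auto
  qed
  moreover have "y \<in> fspan F B" using low[of 0] m(1) by simp
  ultimately show ?thesis using B unfolding holonomic_def by blast
qed

lemma holonomic_add:
  assumes F: "subfield F" and "holonomic D F x" "holonomic D F y"
  shows "holonomic D F (x + y)"
proof -
  obtain B C where B: "finite B" "x \<in> fspan F B" "\<And>b. b \<in> B \<Longrightarrow> D b \<in> fspan F B"
    and C: "finite C" "y \<in> fspan F C" "\<And>b. b \<in> C \<Longrightarrow> D b \<in> fspan F C"
    using assms by (auto simp: holonomic_def)
  have "fspan F B \<subseteq> fspan F (B \<union> C)" "fspan F C \<subseteq> fspan F (B \<union> C)"
    using B C by (intro fspan_mono[OF F]; simp)+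
  then have "\<forall>b\<in>B \<union> C. D b \<in> fspan F (B \<union> C)" "x \<in> fspan F (B \<union> C)" "y \<in> fspan F (B \<union> C)"
    using B C by auto
  moreover have "x + y \<in> fspan F (B \<union> C)"
    using calculation fsubspace_fspan[OF F, of "B \<union> C"] by (auto simp: fsubspace_def)
  ultimately show ?thesis using B C unfolding holonomic_def by (meson finite_UnI)
qed

lemma holonomic_mult:
  assumes D: "derivation D" and F: "subfield F" and "holonomic D F x" "holonomic D F y"
  shows "holonomic D F (x * y)"
proof -
  obtain B C where B: "finite B" "x \<in> fspan F B" "\<And>b. b \<in> B \<Longrightarrow> D b \<in> fspan F B"
    and C: "finite C" "y \<in> fspan F C" "\<And>b. b \<in> C \<Longrightarrow> D b \<in> fspan F C"
    using assms by (auto simp: holonomic_def)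
  define E where "E = (\<lambda>(b, c). b * c) ` (B \<times> C)"
  have prod: "u * v \<in> fspan F E" if "u \<in> fspan F B" "v \<in> fspan F C" for u v
    using span_product_mult[OF F B(1) C(1) that] by (simp add: span_product_def E_def)
  have V: "fsubspace F (fspan F E)" by (rule fsubspace_fspan[OF F])
  have "D e \<in> fspan F E" if e: "e \<in> E" for e
  proof -
    obtain b c where bc: "b \<in> B" "c \<in> C" "e = b * c" using e by (auto simp: E_def)
    then have "D e = D b * c + b * D c" by (simp add: derivation_mult[OF D])
    moreover have "D b * c \<in> fspan F E" "b * D c \<in> fspan F E"
      using bc B(3) C(3) fspan_superset[OF F B(1)] fspan_superset[OF F C(1)] by (auto intro!: prod)
    ultimately show ?thesis using V by (auto simp: fsubspace_def)
  qed
  moreover have "finite E" using B C by (simp add: E_def)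
  ultimately show ?thesis using prod B C unfolding holonomic_def by blast
qed

lemma holonomic_base:
  assumes F: "diff_subfield D F" and "c \<in> F"
  shows "holonomic D F c"
proof -
  have sF: "subfield F" and dF: "\<And>x. x \<in> F \<Longrightarrow> D x \<in> F" using F by (auto simp: diff_subfield_def)
  have "fspan F {1} = F" by (auto simp: fspan_def)
  then show ?thesis unfolding holonomic_def using assms dF[OF subfield_1[OF sF]]
    by (intro exI[of _ "{1}"]) auto
qed

text \<open>
  Let \<open>z\<close> be a primitive element for \<open>a\<close> and \<open>b\<close>. The algebra \<open>F[z]\<close> is finite-dimensional and closed
  under \<open>D\<close>, and so is the space \<open>F[z] + F[z] u\<close>.
\<close>

lemma holonomic_first_order:
  fixes D :: "'a::{alg_closed_field, field_char_0} \<Rightarrow> 'a"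
  assumes D: "derivation D" and F: "diff_subfield D F" and ab: "algebraic_over F a" "algebraic_over F b" "D u = a * u + b"
  shows "holonomic D F u"
proof -
  have sF: "subfield F" using F by (auto simp: diff_subfield_def)
  obtain z where z: "algebraic_over F z" "a \<in> eval_ring F z" "b \<in> eval_ring F z"
    using primitive_element[OF sF ab(1,2)] by metis
  have V: "finite_algebra F (eval_ring F z)" by (rule finite_algebra_eval_ring[OF sF z(1)])
  then obtain B where B: "finite B" "eval_ring F z = fspan F B" by (auto simp: finite_algebra_def)
  have mul: "x * y \<in> fspan F B" if "x \<in> fspan F B" "y \<in> fspan F B" for x y
    using V that unfolding finite_algebra_def B(2) by blast
  have ab': "a \<in> fspan F B" "b \<in> fspan F B" using z B by auto
  have DV: "D x \<in> fspan F B" if "x \<in> fspan F B" for x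
    using derivation_eval_ring[OF D F z(1)] that unfolding B(2) .
  have BV: "x \<in> fspan F B" if "x \<in> B" for x using fspan_superset[OF sF B(1)] that by auto
  define C where "C = B \<union> (\<lambda>b. b * u) ` B"
  have C: "finite C" using B by (simp add: C_def)
  have W: "fsubspace F (fspan F C)" by (rule fsubspace_fspan[OF sF])
  have BC: "fspan F B \<subseteq> fspan F C" by (rule fspan_mono[OF sF C]) (simp add: C_def)
  have "fsubspace F {x. x * u \<in> fspan F C}"
    using W by (auto simp: fsubspace_def algebra_simps)
  then have "fspan F B \<subseteq> {x. x * u \<in> fspan F C}"
    by (rule fspan_minimal) (use fspan_superset[OF sF C] in \<open>auto simp: C_def\<close>)
  then have times_u: "x * u \<in> fspan F C" if "x \<in> fspan F B" for x using that by auto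
  have DC: "D c \<in> fspan F C" if c: "c \<in> C" for c
  proof (cases "c \<in> B")
    case True
    then show ?thesis using DV BV BC by blast
  next
    case False
    then obtain d where d: "d \<in> B" "c = d * u" using c by (auto simp: C_def)
    have "D c = D d * u + (d * a) * u + d * b"
      unfolding d(2) derivation_mult[OF D] ab(3) by (simp add: algebra_simps)
    moreover have "D d * u \<in> fspan F C" "(d * a) * u \<in> fspan F C" "d * b \<in> fspan F C"
      using times_u DV BV mul ab' d(1) BC by blast+
    ultimately show ?thesis using W by (auto simp: fsubspace_def)
  qed
  have "1 \<in> fspan F B" using V unfolding finite_algebra_def B(2) by blast
  then have "u \<in> fspan F C" using times_u[of 1] by simp
  then show ?thesis using C DC unfolding holonomic_def by blast
qed

lemma holonomic_algebraic:
  fixes D :: "'a::field_char_0 \<Rightarrow> 'a"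
  assumes D: "derivation D" and F: "diff_subfield D F" and x: "algebraic_over F x"
  shows "holonomic D F x"
proof -
  have sF: "subfield F" using F by (auto simp: diff_subfield_def)
  have V: "finite_algebra F (eval_ring F x)" by (rule finite_algebra_eval_ring[OF sF x])
  then obtain B where B: "finite B" "eval_ring F x = fspan F B" by (auto simp: finite_algebra_def)
  have "D b \<in> fspan F B" if "b \<in> B" for b
    using derivation_eval_ring[OF D F x, of b] fspan_superset[OF sF B(1)] that unfolding B(2) by blast
  moreover have "x \<in> fspan F B" using eval_ring_gen[OF sF, of x] unfolding B(2) .
  ultimately show ?thesis using B(1) unfolding holonomic_def by blast
qed

text \<open>
  The derivatives of \<open>u\<close> are polynomials in \<open>u\<close> over \<open>K\<close>, and the same polynomials in \<open>r\<close> are the derivatives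
  of \<open>r\<close>. So a linear equation for \<open>u\<close> is an algebraic relation over \<open>K\<close>, which passes to \<open>r\<close>.
\<close>

lemma lhde_conjugate:
  fixes D :: "'a::field_char_0 \<Rightarrow> 'a"
  assumes D: "derivation D" and K: "diff_subfield D K" and F: "F \<subseteq> K" and u: "algebraic_over K u"
    and conj: "\<And>q. q \<in> polys_over K \<Longrightarrow> poly q u = 0 \<Longrightarrow> poly q r = 0" and lhde: "satisfies_lhde D F u"
  shows "satisfies_lhde D F r"
proof -
  have sK: "subfield K" and dK: "\<And>x. x \<in> K \<Longrightarrow> D x \<in> K" using K by (auto simp: diff_subfield_def)
  have mapD: "map_poly D q \<in> polys_over K" if "q \<in> polys_over K" for q
    by (rule polys_over_map_derivation[OF D dK that])
  have "\<exists>g1\<in>polys_over K. D u = poly g1 u \<and> D r = poly g1 r"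
  proof -
    obtain p where p: "p \<in> polys_over K" "degree p > 0" "poly p u = 0"
      "\<And>q. q \<in> polys_over K \<Longrightarrow> poly q u = 0 \<Longrightarrow> q \<noteq> 0 \<Longrightarrow> degree p \<le> degree q"
      using minimal_polynomial[OF sK u] by metis
    have n0: "poly (pderiv p) u \<noteq> 0" by (rule minimal_polynomial_separable[OF sK p(1,2,4)])
    have dp: "pderiv p \<in> polys_over K" by (rule polys_over_pderiv[OF sK p(1)])
    then have "poly (pderiv p) u \<in> eval_ring K u" by (auto simp: eval_ring_def)
    then have "inverse (poly (pderiv p) u) \<in> eval_ring K u"
      using subfield_inverse[OF subfield_eval_ring[OF sK u]] by blast
    then obtain s where s: "s \<in> polys_over K" "inverse (poly (pderiv p) u) = poly s u" by (auto simp: eval_ring_def)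
    have su: "poly (s * pderiv p - 1) u = 0" using n0 by (simp flip: s(2))
    then have "poly (s * pderiv p - 1) r = 0"
      using s dp by (intro conj polys_over_diff[OF sK] polys_over_mult[OF sK] polys_over_1[OF sK])
    with su have inv: "poly s u * poly (pderiv p) u = 1" "poly s r * poly (pderiv p) r = 1" by simp_all
    have "poly p r = 0" by (rule conj[OF p(1,3)])
    have eq: "D x = poly (- (s * map_poly D p)) x"
      if "poly p x = 0" "poly s x * poly (pderiv p) x = 1" for x
    proof -
      have "0 = poly (map_poly D p) x + poly (pderiv p) x * D x"
        using derivation_poly[OF D, of p x] that(1) derivation_0[OF D] by simp
      then have "poly (pderiv p) x * D x = - poly (map_poly D p) x" by (simp add: eq_neg_iff_add_eq_0 add.commute)
      then have "poly s x * (poly (pderiv p) x * D x) = - (poly s x * poly (map_poly D p) x)" by simp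
      then have "(poly s x * poly (pderiv p) x) * D x = - (poly s x * poly (map_poly D p) x)" by (simp only: mult.assoc)
      then show ?thesis using that(2) by simp
    qed
    then show ?thesis using \<open>poly p r = 0\<close> p(3) inv
      by (intro bexI[of _ "- (s * map_poly D p)"] conjI polys_over_uminus[OF sK] polys_over_mult[OF sK] s(1) mapD[OF p(1)]) simp_all
  qed
  then obtain g1 where g1: "g1 \<in> polys_over K" "D u = poly g1 u" "D r = poly g1 r" by blast
  have "\<exists>g\<in>polys_over K. (D ^^ j) u = poly g u \<and> (D ^^ j) r = poly g r" for j
  proof (induction j)
    case 0
    have "[:0, 1:] \<in> polys_over K"
      using subfield_0[OF sK] subfield_1[OF sK] by (intro polys_over_pCons[OF sK] polys_over_0[OF sK])
    then show ?case by (intro bexI[of _ "[:0, 1:]"]) auto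
  next
    case (Suc j)
    then obtain g where g: "g \<in> polys_over K" "(D ^^ j) u = poly g u" "(D ^^ j) r = poly g r" by blast
    have "map_poly D g + pderiv g * g1 \<in> polys_over K"
      using g(1) g1(1) mapD by (intro polys_over_add[OF sK] polys_over_mult[OF sK] polys_over_pderiv[OF sK])
    then show ?case using g g1
      by (intro bexI[of _ "map_poly D g + pderiv g * g1"]) (simp_all add: derivation_poly[OF D])
  qed
  then have "\<forall>j. \<exists>g. g \<in> polys_over K \<and> (D ^^ j) u = poly g u \<and> (D ^^ j) r = poly g r" by blast
  then obtain g where g: "\<And>j. g j \<in> polys_over K" "\<And>j. (D ^^ j) u = poly (g j) u" "\<And>j. (D ^^ j) r = poly (g j) r"
    by metis
  obtain m a where m: "m \<ge> 1" "\<forall>j<m. a j \<in> F" "(D ^^ m) u + (\<Sum>j<m. a j * (D ^^ j) u) = 0"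
    using lhde by (auto simp: satisfies_lhde_def)
  define q where "q = g m + (\<Sum>j<m. smult (a j) (g j))"
  have "q \<in> polys_over K" unfolding q_def
    using m(2) F g(1) by (intro polys_over_add[OF sK] polys_over_sum[OF sK] polys_over_smult[OF sK]) auto
  moreover have "poly q u = 0" using m(3) by (simp add: q_def poly_sum g(2))
  ultimately have "poly q r = 0" by (rule conj)
  then have "(D ^^ m) r + (\<Sum>j<m. a j * (D ^^ j) r) = 0" by (simp add: q_def poly_sum g(3))
  then show ?thesis using m unfolding satisfies_lhde_def by blast
qed

lemma coeff_prod_linear_closed:
  fixes R :: "'a::field set"
  assumes R: "0 \<in> R" "1 \<in> R" "\<And>x y. x \<in> R \<Longrightarrow> y \<in> R \<Longrightarrow> x + y \<in> R" "\<And>x y. x \<in> R \<Longrightarrow> y \<in> R \<Longrightarrow> x * y \<in> R"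
      "\<And>x. x \<in> R \<Longrightarrow> - x \<in> R"
    and A: "\<And>x. x \<in># A \<Longrightarrow> x \<in> R"
  shows "coeff (\<Prod>x\<in>#A. [:- x, 1:]) i \<in> R"
  using A
proof (induction A arbitrary: i)
  case empty
  then show ?case using R(1,2) by (simp add: coeff_1)
next
  case (add x A)
  define p where "p = (\<Prod>x\<in>#A. [:- x, 1:])"
  have IH: "coeff p i \<in> R" for i using add by (simp add: p_def)
  have "coeff ([:- x, 1:] * p) i = - x * coeff p i + (case i of 0 \<Rightarrow> 0 | Suc j \<Rightarrow> coeff p j)"
    by (cases i) (simp_all add: coeff_pCons)
  moreover have "- x * coeff p i \<in> R" using IH add.prems[of x] by (intro R(4,5)) auto
  moreover have "(case i of 0 \<Rightarrow> 0 | Suc j \<Rightarrow> coeff p j) \<in> R" using IH R(1) by (simp split: nat.split)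
  ultimately have "coeff ([:- x, 1:] * p) i \<in> R" using R(3) by metis
  then show ?case by (simp add: p_def)
qed

text \<open>
  The conjugates of \<open>u\<close> over \<open>K\<close> are holonomic like \<open>u\<close>, and the coefficients of the minimal polynomial
  are polynomials in the conjugates. Not all of them are algebraic over \<open>F\<close>, since \<open>u\<close> is not.
\<close>

lemma holonomic_descent:
  fixes D :: "'a::{alg_closed_field, field_char_0} \<Rightarrow> 'a"
  assumes D: "derivation D" and F: "diff_subfield D F" and K: "diff_subfield D K" "F \<subseteq> K"
    and u: "algebraic_over K u" "\<not> algebraic_over F u" and hol: "holonomic D F u"
  obtains v where "v \<in> K" "\<not> algebraic_over F v" "satisfies_lhde D F v"
proof -
  have sF: "subfield F" and sK: "subfield K" using F K by (auto simp: diff_subfield_def)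
  obtain p where p: "p \<in> polys_over K" "lead_coeff p = 1" "poly p u = 0"
    "\<And>q. q \<in> polys_over K \<Longrightarrow> poly q u = 0 \<Longrightarrow> \<exists>s\<in>polys_over K. q = s * p"
    using minimal_polynomial[OF sK u(1)] by metis
  have "p \<noteq> 0" using p(2) by auto
  then obtain A where A: "p = (\<Prod>x\<in>#A. [:- x, 1:])"
    using alg_closed_imp_factorization[of p] p(2) by auto
  have lhde: "satisfies_lhde D F u" by (rule holonomic_imp_lhde[OF D F hol])
  have "holonomic D F r" if "r \<in># A" for r
  proof -
    have "[:- r, 1:] dvd p" unfolding A using that by (intro dvd_prod_mset) auto
    then have "poly p r = 0" by (simp add: poly_eq_0_iff_dvd)
    then have "poly q r = 0" if "q \<in> polys_over K" "poly q u = 0" for q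
      using p(4)[OF that] by auto
    from lhde_conjugate[OF D K u(1) this lhde] show ?thesis by (rule lhde_imp_holonomic[OF sF])
  qed
  then have "coeff p i \<in> {y. holonomic D F y}" for i
    unfolding A
  proof (intro coeff_prod_linear_closed)
    show "- x \<in> {y. holonomic D F y}" if "x \<in> {y. holonomic D F y}" for x
      using holonomic_mult[OF D sF holonomic_base[OF F subfield_uminus[OF sF subfield_1[OF sF]]], of x] that by simp
  qed (use holonomic_base[OF F] subfield_0[OF sF] subfield_1[OF sF] holonomic_add[OF sF] holonomic_mult[OF D sF] in auto)
  then have hc: "satisfies_lhde D F (coeff p i)" for i using holonomic_imp_lhde[OF D F] by auto
  have "\<exists>i. \<not> algebraic_over F (coeff p i)"
  proof (rule ccontr)
    assume "\<not> ?thesis"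
    then have "algebraic_over {y. algebraic_over F y} u"
      using p(3) \<open>p \<noteq> 0\<close> unfolding algebraic_over_def[of "{y. algebraic_over F y}"] by blast
    then show False using algebraic_over_trans[OF sF] u(2) by blast
  qed
  then show thesis using that hc polys_overD[OF p(1)] by blast
qed

section \<open>Passage to the algebraic closure\<close>

lemma field_hom_to_ac: "field_hom_on UNIV to_ac"
  by (simp add: field_hom_on_def)

lemma algebraic_over_to_ac_iff:
  assumes F: "subfield F"
  shows "algebraic_over (to_ac ` F) (to_ac x) \<longleftrightarrow> algebraic_over F x"
proof
  assume "algebraic_over F x"
  then show "algebraic_over (to_ac ` F) (to_ac x)"
    by (intro hom_image_algebraic[OF subfield_UNIV field_hom_to_ac]) auto
next
  assume "algebraic_over (to_ac ` F) (to_ac x)"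
  then obtain p where p: "p \<noteq> 0" "\<And>i. coeff p i \<in> to_ac ` F" "poly p (to_ac x) = 0"
    by (auto simp: algebraic_over_def)
  define q where "q = map_poly of_ac p"
  have q: "coeff q i \<in> F" "to_ac (coeff q i) = coeff p i" for i
    using p(2)[of i] by (auto simp: q_def coeff_map_poly)
  have "map_poly to_ac q = p" by (intro poly_eqI) (simp add: coeff_map_poly q)
  then have "to_ac (poly q x) = 0"
    using hom_poly[OF subfield_UNIV field_hom_to_ac polys_over_UNIV, of x q] p(3) by simp
  moreover have "q \<noteq> 0" using \<open>map_poly to_ac q = p\<close> p(1) by auto
  ultimately show "algebraic_over F x" unfolding algebraic_over_def using q by auto
qed

lemma to_ac_adjoin: "to_ac ` adjoin k S = adjoin (to_ac ` k) (to_ac ` S)"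
proof
  have "adjoin k S \<subseteq> {x \<in> UNIV. to_ac x \<in> adjoin (to_ac ` k) (to_ac ` S)}"
    using adjoin_superset[of "to_ac ` k" "to_ac ` S"]
    by (intro adjoin_minimal subfield_hom_vimage[OF subfield_UNIV field_hom_to_ac subfield_adjoin]) auto
  then show "to_ac ` adjoin k S \<subseteq> adjoin (to_ac ` k) (to_ac ` S)" by auto
  show "adjoin (to_ac ` k) (to_ac ` S) \<subseteq> to_ac ` adjoin k S"
    using adjoin_superset[of k S]
    by (intro adjoin_minimal subfield_hom_image[OF subfield_adjoin field_hom_on_subset[OF field_hom_to_ac]])
      (auto simp: subfield_UNIV)
qed

lemma to_ac_acl: "x \<in> acl (k \<union> S) \<Longrightarrow> to_ac x \<in> acl (to_ac ` k \<union> to_ac ` S)"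
proof -
  assume "x \<in> acl (k \<union> S)"
  then have "algebraic_over (adjoin k S) x"
    using acl_subfield[OF subfield_adjoin, of k S] by (simp add: acl_adjoin)
  then have "algebraic_over (adjoin (to_ac ` k) (to_ac ` S)) (to_ac x)"
    unfolding to_ac_adjoin[symmetric] using algebraic_over_to_ac_iff[OF subfield_adjoin] by blast
  then show ?thesis
    using acl_subfield[OF subfield_adjoin, of "to_ac ` k" "to_ac ` S"] by (simp add: acl_adjoin)
qed

lemma derivation_to_ac:
  fixes D :: "'a::field_char_0 \<Rightarrow> 'a"
  assumes D: "derivation D"
  obtains D' where "derivation D'" "\<And>x. D' (to_ac x) = to_ac (D x)"
proof -
  have R: "subfield (range to_ac :: 'a alg_closure set)"
    by (rule subfield_hom_image[OF subfield_UNIV field_hom_to_ac])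
  have alg: "algebraic_over (range to_ac) x" for x :: "'a alg_closure"
  proof -
    obtain p :: "'a poly" where p: "p \<noteq> 0" "poly (map_poly to_ac p) x = 0" by (rule alg_closure_algebraic)
    have "map_poly to_ac p \<noteq> 0" using p(1) map_poly_hom_eq_0[OF subfield_UNIV field_hom_to_ac polys_over_UNIV] by blast
    then show ?thesis using p(2) unfolding algebraic_over_def
      by (intro exI[of _ "map_poly to_ac p"]) (simp add: coeff_map_poly)
  qed
  have of_ac: "of_ac (to_ac x + to_ac y) = x + y" "of_ac (to_ac x * to_ac y) = x * y" for x y :: 'a
    by (metis of_ac_to_ac to_ac_add, metis of_ac_to_ac to_ac_mult)
  obtain D' where "derivation D'" "\<And>x. x \<in> range to_ac \<Longrightarrow> D' x = to_ac (D (of_ac x))"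
    by (rule extend_derivation[OF R alg, of "\<lambda>x. to_ac (D (of_ac x))"])
      (auto simp: of_ac derivation_add[OF D] derivation_mult[OF D])
  then show thesis using that by auto
qed

text \<open>
  The minimal polynomial of \<open>y\<close> over the image of \<open>F\<close> has a root in the image of \<open>F\<close> and is therefore
  linear.
\<close>

lemma alg_closed_algebraic:
  assumes F: "subfield F" "alg_closed F" and x: "algebraic_over (to_ac ` F) y"
  shows "y \<in> to_ac ` F"
proof -
  have sF': "subfield (to_ac ` F)" by (rule subfield_hom_image[OF F(1) field_hom_on_subset[OF field_hom_to_ac]]) simp
  obtain p where p0: "p \<in> polys_over (to_ac ` F)" "lead_coeff p = 1" "degree p > 0" "poly p y = 0"
    "\<And>q. q \<in> polys_over (to_ac ` F) \<Longrightarrow> poly q y = 0 \<Longrightarrow> \<exists>s\<in>polys_over (to_ac ` F). q = s * p"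
    "\<And>q. q \<in> polys_over (to_ac ` F) \<Longrightarrow> poly q y = 0 \<Longrightarrow> q \<noteq> 0 \<Longrightarrow> degree p \<le> degree q"
    by (rule minimal_polynomial[OF sF' x], rule that)
  note p = p0(1,3,4,5,6)
  define q where "q = map_poly of_ac p"
  have q: "coeff q i \<in> F" "to_ac (coeff q i) = coeff p i" for i
    using polys_overD[OF p(1), of i] by (auto simp: q_def coeff_map_poly)
  have pq: "map_poly to_ac q = p" by (intro poly_eqI) (simp add: coeff_map_poly q)
  then have "degree q > 0" using p(2) degree_map_poly_le[of to_ac q] by auto
  then obtain c where c: "c \<in> F" "poly q c = 0" using F(2) q(1) unfolding alg_closed_def by blast
  have "poly p (to_ac c) = 0"
    using hom_poly[OF subfield_UNIV field_hom_to_ac polys_over_UNIV, of c q] c(2) pq by simp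
  then obtain r where r: "p = [:- to_ac c, 1:] * r" by (metis dvdE poly_eq_0_iff_dvd)
  have "p \<noteq> 0" using p(2) by auto
  have "[:- to_ac c, 1:] \<in> polys_over (to_ac ` F)"
    using c(1) subfield_1[OF sF'] subfield_uminus[OF sF'] by (intro polys_over_pCons[OF sF'] polys_over_0[OF sF']) auto
  then obtain s' r' where sr: "s' \<in> polys_over (to_ac ` F)" "r' \<in> polys_over (to_ac ` F)"
    "p = s' * [:- to_ac c, 1:] + r'" "r' = 0 \<or> degree r' < degree [:- to_ac c, 1:]"
    using polys_over_division[OF sF' _ _ p(1), of "[:- to_ac c, 1:]"] by auto
  have "r' = 0"
  proof -
    have "poly r' (to_ac c) = 0" using \<open>poly p (to_ac c) = 0\<close> sr(3) by simp
    moreover obtain d where "r' = [:d:]" using sr(4) by (auto elim: degree_eq_zeroE)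
    ultimately show ?thesis by simp
  qed
  then have ps: "p = s' * [:- to_ac c, 1:]" using sr(3) by simp
  then have "s' \<noteq> 0" using \<open>p \<noteq> 0\<close> by auto
  have "poly s' y \<noteq> 0"
  proof
    assume "poly s' y = 0"
    then have "degree p \<le> degree s'" using p(5) sr(1) \<open>s' \<noteq> 0\<close> by blast
    moreover have "degree p = degree s' + 1" unfolding ps using \<open>s' \<noteq> 0\<close> by (subst degree_mult_eq) auto
    ultimately show False by simp
  qed
  then have "y = to_ac c" using p(3) ps by simp
  then show ?thesis using c(1) by simp
qed

text \<open>
  The main induction is applied to the algebraic closures of the images of \<open>k\<close> and \<open>K\<close> in
  \<open>'a alg_closure\<close>. The two conclusions come from the two ways back to \<open>K\<close>.
\<close>

lemma liouvillian_elements: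
  fixes D :: "'a::field_char_0 \<Rightarrow> 'a" and n :: nat
  assumes D: "derivation D" and k: "diff_subfield D k" and K: "diff_subfield D K" "k \<subseteq> K"
    and K1: "K \<subseteq> acl (k \<union> t ` {..<n})"
    and steps: "\<And>i. i < n \<Longrightarrow> D (t i) \<in> acl (k \<union> t ` {..<i}) \<or> t i \<noteq> 0 \<and> D (t i) / t i \<in> acl (k \<union> t ` {..<i})
      \<or> t i \<in> acl (k \<union> t ` {..<i})"
    and x: "x \<in> K" "\<not> algebraic_over k x"
  shows linear_element: "\<exists>v\<in>K. \<not> algebraic_over k v \<and> satisfies_lhde D k v"
    and first_order_element: "alg_closed k \<Longrightarrow> \<exists>u\<in>K - k. \<exists>a\<in>k. \<exists>b\<in>k. D u = a * u + b"
proof -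
  have sk: "subfield k" and sK: "subfield K" and Dk: "\<And>x. x \<in> k \<Longrightarrow> D x \<in> k" and DK: "\<And>x. x \<in> K \<Longrightarrow> D x \<in> K"
    using k K by (auto simp: diff_subfield_def)
  obtain D' where D': "derivation D'" "\<And>x. D' (to_ac x) = to_ac (D x)" using derivation_to_ac[OF D] by metis
  define k' K' where "k' = to_ac ` k" and "K' = to_ac ` K"
  have sk': "subfield k'" unfolding k'_def by (rule subfield_hom_image[OF sk field_hom_on_subset[OF field_hom_to_ac]]) simp
  have sK': "subfield K'" unfolding K'_def by (rule subfield_hom_image[OF sK field_hom_on_subset[OF field_hom_to_ac]]) simp
  have dk': "diff_subfield D' k'" using sk' Dk by (auto simp: diff_subfield_def k'_def D'(2))
  have dK': "diff_subfield D' K'" using sK' DK by (auto simp: diff_subfield_def K'_def D'(2))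
  have kK': "k' \<subseteq> K'" using K(2) by (auto simp: k'_def K'_def)
  have aclk: "acl k' = {x. algebraic_over k' x}" and aclK: "acl K' = {x. algebraic_over K' x}"
    by (rule acl_subfield[OF sk'], rule acl_subfield[OF sK'])
  define s where "s i = to_ac (t i)" for i
  have img: "to_ac ` t ` {..<i} = s ` {..<i}" for i by (auto simp: s_def)
  have tr: "to_ac y \<in> acl (acl k' \<union> s ` {..<i})" if "y \<in> acl (k \<union> t ` {..<i})" for y i
    using to_ac_acl[OF that] unfolding img acl_acl_Un k'_def .
  have "\<exists>u\<in>acl K' - acl k'. \<exists>a\<in>acl k'. \<exists>b\<in>acl k'. D' u = a * u + b"
  proof (rule first_order_element_closed[OF D'(1), of _ _ s n])
    show "diff_subfield D' (acl k')" "diff_subfield D' (acl K')"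
      by (rule diff_subfield_acl_self[OF D'(1) dk'], rule diff_subfield_acl_self[OF D'(1) dK'])
    show "acl (acl k') = acl k'" "acl (acl K') = acl K'" by (rule acl_idem)+
    show "acl k' \<subseteq> acl K'" by (rule acl_mono[OF kK'])
    show "acl K' \<subseteq> acl (acl k' \<union> s ` {..<n})"
    proof (rule acl_minimal)
      show "K' \<subseteq> acl (acl k' \<union> s ` {..<n})" unfolding K'_def using tr K1 by blast
    qed
    show "D' (s i) \<in> acl (acl k' \<union> s ` {..<i}) \<or> s i \<noteq> 0 \<and> D' (s i) / s i \<in> acl (acl k' \<union> s ` {..<i})
      \<or> s i \<in> acl (acl k' \<union> s ` {..<i})" if "i < n" for i
      using steps[OF that] tr[of "D (t i)" i] tr[of "D (t i) / t i" i] tr[of "t i" i]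
      by (auto simp: s_def D'(2))
    have "to_ac x \<in> acl K'" by (rule subsetD[OF acl_superset]) (use x in \<open>simp add: K'_def\<close>)
    moreover have "to_ac x \<notin> acl k'" unfolding aclk unfolding k'_def using algebraic_over_to_ac_iff[OF sk] x(2) by simp
    ultimately show "acl K' \<noteq> acl k'" by blast
  qed
  then obtain u a b where u: "algebraic_over K' u" "\<not> algebraic_over k' u"
    and ab: "algebraic_over k' a" "algebraic_over k' b" "D' u = a * u + b"
    unfolding aclk aclK by blast
  have pow: "(D' ^^ j) (to_ac y) = to_ac ((D ^^ j) y)" for j y
    by (induction j) (simp_all add: D'(2))
  show "\<exists>v\<in>K. \<not> algebraic_over k v \<and> satisfies_lhde D k v"
  proof -
    obtain v' where v': "v' \<in> K'" "\<not> algebraic_over k' v'" "satisfies_lhde D' k' v'"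
      using holonomic_descent[OF D'(1) dk' dK' kK' u holonomic_first_order[OF D'(1) dk' ab]] by metis
    then obtain v where v: "v \<in> K" "v' = to_ac v" by (auto simp: K'_def)
    obtain m c where m: "m \<ge> 1" "\<forall>j<m. c j \<in> k'" "(D' ^^ m) v' + (\<Sum>j<m. c j * (D' ^^ j) v') = 0"
      using v'(3) by (auto simp: satisfies_lhde_def)
    have c: "of_ac (c j) \<in> k" "c j = to_ac (of_ac (c j))" if "j < m" for j
      using m(2) that by (auto simp: k'_def)
    have "(\<Sum>j<m. c j * (D' ^^ j) v') = (\<Sum>j<m. to_ac (of_ac (c j) * (D ^^ j) v))"
      by (intro sum.cong refl) (use c(2) in \<open>simp add: v(2) pow\<close>)
    then have "to_ac ((D ^^ m) v + (\<Sum>j<m. of_ac (c j) * (D ^^ j) v)) = 0"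
      using m(3) by (simp add: v(2) pow to_ac_sum)
    then have "(D ^^ m) v + (\<Sum>j<m. of_ac (c j) * (D ^^ j) v) = 0" by (simp only: to_ac_eq_0_iff)
    then have "satisfies_lhde D k v" unfolding satisfies_lhde_def
      using m(1) c(1) by (intro exI[of _ m] exI[of _ "\<lambda>j. of_ac (c j)"]) auto
    moreover have "\<not> algebraic_over k v" using v'(2) algebraic_over_to_ac_iff[OF sk] unfolding v(2) k'_def by blast
    ultimately show ?thesis using v(1) by blast
  qed
  show "\<exists>u\<in>K - k. \<exists>a\<in>k. \<exists>b\<in>k. D u = a * u + b" if ac: "alg_closed k"
  proof -
    have "a \<in> k'" "b \<in> k'" using alg_closed_algebraic[OF sk ac] ab unfolding k'_def by blast+
    then obtain v' a' b' where v': "v' \<in> K' - k'" "a' \<in> k'" "b' \<in> k'" "D' v' = a' * v' + b'"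
      using first_order_descent[OF D'(1) dK' sk' kK' u _ _ ab(3)] by metis
    then obtain v a'' b'' where v: "v \<in> K" "v' = to_ac v" "a'' \<in> k" "a' = to_ac a''" "b'' \<in> k" "b' = to_ac b''"
      unfolding K'_def k'_def by blast
    have "to_ac (D v) = to_ac (a'' * v + b'')" using v'(4) by (simp add: v D'(2))
    then have "D v = a'' * v + b''" by (simp only: to_ac_eq_iff)
    moreover have "v \<notin> k" using v'(1) v(2) by (auto simp: k'_def)
    ultimately show ?thesis using v by blast
  qed
qed

section \<open>Finite generation and the number of independent generators\<close>

lemma tower_image_Suc:
  fixes t :: "nat \<Rightarrow> 'a"
  shows "t ` {..<Suc i} = insert (t 0) ((\<lambda>j. t (Suc j)) ` {..<i})"
  by (auto simp: image_iff lessThan_Suc_eq_insert_0)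

lemma adjoin_tower_Suc:
  fixes t :: "nat \<Rightarrow> 'a::field"
  shows "adjoin k (t ` {..<Suc i}) = adjoin (adjoin k {t 0}) ((\<lambda>j. t (Suc j)) ` {..<i})"
  unfolding tower_image_Suc adjoin_adjoin by simp

text \<open>
  Among the finitely generated intermediate fields choose one over which \<open>t\<close> has least degree. An
  element \<open>y\<close> of \<open>K\<close> is \<open>r(t)\<close> with \<open>r\<close> over that field of smaller degree. If \<open>r\<close> were not the
  constant \<open>y\<close>, then \<open>r - y\<close> would be an equation for \<open>t\<close> of smaller degree over the field generated
  in addition by \<open>y\<close>.
\<close>

lemma intermediate_simple_extension_finite:
  assumes F: "subfield F" and K: "subfield K" "F \<subseteq> K" "K \<subseteq> adjoin F {t}" and t: "algebraic_over F t"
  shows "\<exists>Y. finite Y \<and> Y \<subseteq> K \<and> K = adjoin F Y"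
proof -
  \<comment> \<open>The pairs of a finite set of generators and an equation for \<open>t\<close> over the field generated.\<close>
  define P where "P Yp \<longleftrightarrow> finite (fst Yp) \<and> fst Yp \<subseteq> K \<and> snd Yp \<in> polys_over (adjoin F (fst Yp)) \<and>
    snd Yp \<noteq> 0 \<and> poly (snd Yp) t = 0" for Yp
  obtain p0 where "p0 \<noteq> 0" "p0 \<in> polys_over F" "poly p0 t = 0"
    using t by (auto simp: algebraic_over_def polys_over_def)
  then have "P ({}, p0)" by (simp add: P_def adjoin_empty[OF F])
  then obtain Yp where Yp: "P Yp" "\<And>Zq. P Zq \<Longrightarrow> degree (snd Yp) \<le> degree (snd Zq)"
    using ex_has_least_nat[of P "({}, p0)" "\<lambda>Yp. degree (snd Yp)"] by blast
  obtain Y p where eq: "Yp = (Y, p)" by (cases Yp)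
  have Y: "finite Y" "Y \<subseteq> K" "p \<in> polys_over (adjoin F Y)" "p \<noteq> 0" "poly p t = 0"
    using Yp(1) by (auto simp: P_def eq)
  define G where "G = adjoin F Y"
  have sG: "subfield G" unfolding G_def by (rule subfield_adjoin)
  have GK: "G \<subseteq> K" unfolding G_def by (rule adjoin_minimal[OF K(1,2) Y(2)])
  have FG: "F \<subseteq> G" unfolding G_def using adjoin_superset[of F Y] by auto
  have "K \<subseteq> G"
  proof
    fix y assume y: "y \<in> K"
    have tG: "algebraic_over G t" by (rule algebraic_over_mono[OF FG t])
    have "y \<in> adjoin G {t}" using y K(3) adjoin_mono[OF FG, of "{t}" "{t}"] by auto
    then have "y \<in> eval_ring G t" unfolding adjoin_algebraic[OF sG tG] .
    then obtain g where g: "g \<in> polys_over G" "y = poly g t" by (auto simp: eval_ring_def)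
    obtain s r where sr: "s \<in> polys_over G" "r \<in> polys_over G" "g = s * p + r" "r = 0 \<or> degree r < degree p"
      using polys_over_division[OF sG Y(3)[folded G_def] Y(4) g(1)] by blast
    have yr: "y = poly r t" using g(2) sr(3) Y(5) by simp
    show "y \<in> G"
    proof (cases "r - [:y:] = 0")
      case True
      then have "coeff r 0 = y" by simp
      then show ?thesis using polys_overD[OF sr(2)] by blast
    next
      case False
      define H where "H = adjoin F (insert y Y)"
      have sH: "subfield H" unfolding H_def by (rule subfield_adjoin)
      have GH: "G \<subseteq> H" "y \<in> H" unfolding G_def H_def using adjoin_superset[of F "insert y Y"] adjoin_mono[of F F Y "insert y Y"] by auto
      have "r - [:y:] \<in> polys_over H"
        using polys_over_mono[OF GH(1) sr(2)] GH(2)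
        by (intro polys_over_diff[OF sH] polys_over_pCons[OF sH] polys_over_0[OF sH])
      then have "P (insert y Y, r - [:y:])" using False Y y yr by (simp add: P_def H_def)
      then have le: "degree p \<le> degree (r - [:y:])" using Yp(2)[of "(insert y Y, r - [:y:])"] by (simp add: eq)
      have "degree p > 0"
      proof (rule ccontr)
        assume "\<not> degree p > 0"
        then obtain c where "p = [:c:]" by (metis degree_eq_zeroE gr0I)
        with Y(4,5) show False by simp
      qed
      then have "degree r < degree p" using sr(4) by auto
      then have "degree (r - [:y:]) < degree p" using \<open>degree p > 0\<close> by (intro degree_diff_less) auto
      then show ?thesis using le by simp
    qed
  qed
  then show ?thesis using Y GK unfolding G_def by blast
qed

text \<open>
  Induction on the number of generators. Over \<open>F(t 0)\<close> the field \<open>K(t 0)\<close> has finitely many generators,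
  which are written with finitely many elements of \<open>K\<close>. If \<open>K0\<close> is generated by these elements over
  \<open>F\<close>, then \<open>K \<subseteq> K0(t 0)\<close>. For \<open>t 0\<close> transcendental over \<open>K0\<close> this gives \<open>K = K0\<close>, because \<open>K\<close> is
  algebraic; for \<open>t 0\<close> algebraic the preceding lemma applies.
\<close>

lemma algebraic_intermediate_finite:
  fixes t :: "nat \<Rightarrow> 'a::field"
  shows "subfield F \<Longrightarrow> subfield K \<Longrightarrow> F \<subseteq> K \<Longrightarrow> K \<subseteq> adjoin F (t ` {..<n}) \<Longrightarrow>
    (\<And>x. x \<in> K \<Longrightarrow> algebraic_over F x) \<Longrightarrow> \<exists>W. finite W \<and> W \<subseteq> K \<and> K = adjoin F W"
proof (induction n arbitrary: F K t)
  case 0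
  then have "K = adjoin F {}" by (auto simp: adjoin_empty)
  then show ?case by blast
next
  case (Suc n)
  define F1 where "F1 = adjoin F {t 0}"
  define K1 where "K1 = adjoin K {t 0}"
  define s where "s j = t (Suc j)" for j
  have sF1: "subfield F1" and sK1: "subfield K1" unfolding F1_def K1_def by (rule subfield_adjoin)+
  have FK1: "F1 \<subseteq> K1" unfolding F1_def K1_def using Suc.prems(3) by (intro adjoin_mono) auto
  have F1: "F \<subseteq> F1" "t 0 \<in> F1" unfolding F1_def using adjoin_superset[of F "{t 0}"] by auto
  have E: "adjoin F (t ` {..<Suc n}) = adjoin F1 (s ` {..<n})" unfolding adjoin_tower_Suc F1_def s_def ..
  have K1E: "K1 \<subseteq> adjoin F1 (s ` {..<n})" unfolding K1_def
    using Suc.prems(4) F1(2) adjoin_superset[of F1 "s ` {..<n}"] unfolding E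
    by (intro adjoin_minimal subfield_adjoin) auto
  have alg1: "algebraic_over F1 x" if "x \<in> K1" for x
  proof -
    have "K1 \<subseteq> {x. algebraic_over F1 x}" unfolding K1_def
      using Suc.prems(5) F1 algebraic_over_mono[OF F1(1)] algebraic_over_self[OF sF1]
      by (intro adjoin_minimal subfield_algebraic[OF sF1]) auto
    then show ?thesis using that by auto
  qed
  obtain W where W: "finite W" "W \<subseteq> K1" "K1 = adjoin F1 W"
    using Suc.IH[OF sF1 sK1 FK1 K1E alg1] by blast
  have "\<exists>Y. finite Y \<and> Y \<subseteq> K \<and> w \<in> adjoin (adjoin F Y) {t 0}" if w: "w \<in> K1" for w
  proof -
    obtain p q where pq: "p \<in> polys_over K" "q \<in> polys_over K" "poly q (t 0) \<noteq> 0" "w = poly p (t 0) / poly q (t 0)"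
      using w unfolding K1_def adjoin_simple[OF Suc.prems(2)] by auto
    define Y where "Y = range (coeff p) \<union> range (coeff q)"
    have fin: "finite (range (coeff r))" for r :: "'a poly"
    proof -
      have "range (coeff r) \<subseteq> insert 0 (coeff r ` {..degree r})"
        using coeff_eq_0[of r] by (auto simp: not_le image_iff) (metis atMost_iff not_le)
      then show ?thesis by (rule finite_subset) simp
    qed
    let ?G = "adjoin F Y"
    have "Y \<subseteq> ?G" using adjoin_superset[of F Y] by auto
    then have "p \<in> polys_over ?G" "q \<in> polys_over ?G" by (auto simp: polys_over_def Y_def)
    then have "w \<in> adjoin ?G {t 0}" unfolding adjoin_simple[OF subfield_adjoin] using pq(3,4) by blast
    moreover have "finite Y" "Y \<subseteq> K" using pq fin by (auto simp: Y_def polys_over_def)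
    ultimately show ?thesis by blast
  qed
  then have "\<forall>w\<in>W. \<exists>Y. finite Y \<and> Y \<subseteq> K \<and> w \<in> adjoin (adjoin F Y) {t 0}" using W(2) by blast
  from bchoice[OF this] obtain Y where Y: "\<And>w. w \<in> W \<Longrightarrow> finite (Y w) \<and> Y w \<subseteq> K \<and> w \<in> adjoin (adjoin F (Y w)) {t 0}"
    by blast
  define Z where "Z = (\<Union>w\<in>W. Y w)"
  have Z: "finite Z" "Z \<subseteq> K" using W(1) Y by (auto simp: Z_def)
  define K0 where "K0 = adjoin F Z"
  have sK0: "subfield K0" unfolding K0_def by (rule subfield_adjoin)
  have FK0: "F \<subseteq> K0" unfolding K0_def using adjoin_superset[of F Z] by auto
  have K0K: "K0 \<subseteq> K" unfolding K0_def by (rule adjoin_minimal[OF Suc.prems(2,3) Z(2)])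
  have "W \<subseteq> adjoin K0 {t 0}"
  proof
    fix w assume w: "w \<in> W"
    have "adjoin (adjoin F (Y w)) {t 0} \<subseteq> adjoin K0 {t 0}" unfolding K0_def
      using w by (intro adjoin_mono) (auto simp: Z_def)
    then show "w \<in> adjoin K0 {t 0}" using Y[OF w] by auto
  qed
  moreover have "F1 \<subseteq> adjoin K0 {t 0}" unfolding F1_def by (rule adjoin_mono[OF FK0]) simp
  ultimately have "K1 \<subseteq> adjoin K0 {t 0}" unfolding W(3) by (intro adjoin_minimal subfield_adjoin)
  then have KK0: "K \<subseteq> adjoin K0 {t 0}" unfolding K1_def using adjoin_superset[of K "{t 0}"] by auto
  have "\<exists>V. finite V \<and> V \<subseteq> K \<and> K = adjoin K0 V"
  proof (cases "algebraic_over K0 (t 0)")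
    case True
    then show ?thesis by (rule intermediate_simple_extension_finite[OF sK0 Suc.prems(2) K0K KK0])
  next
    case False
    have "K \<subseteq> K0"
    proof
      fix y assume y: "y \<in> K"
      then have "algebraic_over K0 y" using Suc.prems(5) algebraic_over_mono[OF FK0] by blast
      then show "y \<in> K0" using algebraic_in_transcendental_extension[OF sK0 False] y KK0 by blast
    qed
    then have "K = adjoin K0 {}" using K0K adjoin_empty[OF sK0] by auto
    then show ?thesis by blast
  qed
  then obtain V where "finite V" "V \<subseteq> K" "K = adjoin K0 V" by blast
  then show ?case using Z unfolding K0_def adjoin_adjoin by (intro exI[of _ "Z \<union> V"]) auto
qed

text \<open>
  The transcendence degree over \<open>k\<close> of the field generated by the \<open>t i\<close>, counted along the given
  order of the generators.
\<close>

definition independent_generators :: "nat \<Rightarrow> (nat \<Rightarrow> 'a::field) \<Rightarrow> 'a set \<Rightarrow> nat" where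
  "independent_generators n t k = card {i. i < n \<and> t i \<notin> acl (k \<union> t ` {..<i})}"

text \<open>
  No generator becomes independent when the field grows. By exchange, the generator at which \<open>y\<close>
  becomes algebraic turns from independent to dependent once \<open>y\<close> is adjoined.
\<close>

lemma independent_generators_decrease:
  assumes y: "y \<in> acl (k \<union> t ` {..<n})" "y \<notin> acl k" and k': "k \<subseteq> k'" "y \<in> k'"
  shows "independent_generators n t k' < independent_generators n t k"
proof -
  define P where "P i \<longleftrightarrow> y \<in> acl (k \<union> t ` {..<i})" for i
  define m where "m = (LEAST i. P i)"
  have "P n" "\<not> P 0" using y by (auto simp: P_def)
  have Pm: "P m" unfolding m_def by (rule LeastI[of P, OF \<open>P n\<close>])
  have "m \<le> n" unfolding m_def by (rule Least_le[of P, OF \<open>P n\<close>])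
  obtain i where i: "m = Suc i" using Pm \<open>\<not> P 0\<close> by (cases m) auto
  have nP: "\<not> P i" using not_less_Least[of i P] i unfolding m_def by simp
  have ins: "k \<union> t ` {..<Suc i} = (k \<union> t ` {..<i}) \<union> {t i}" by (auto simp: lessThan_Suc)
  have tn: "t i \<notin> acl (k \<union> t ` {..<i})"
  proof
    assume "t i \<in> acl (k \<union> t ` {..<i})"
    then have "acl ((k \<union> t ` {..<i}) \<union> {t i}) \<subseteq> acl (k \<union> t ` {..<i})"
      by (intro acl_minimal Un_least acl_superset) simp
    then show False using Pm nP i ins unfolding P_def by auto
  qed
  have "t i \<in> acl ((k \<union> t ` {..<i}) \<union> {y})"
    using acl_exchange[of y "k \<union> t ` {..<i}" "t i"] Pm nP i ins unfolding P_def by simp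
  also have "\<dots> \<subseteq> acl (k' \<union> t ` {..<i})" using k' by (intro acl_mono) auto
  finally have ti: "t i \<in> acl (k' \<union> t ` {..<i})" .
  have "acl (k \<union> t ` {..<j}) \<subseteq> acl (k' \<union> t ` {..<j})" for j using k'(1) by (intro acl_mono) auto
  then have "{i. i < n \<and> t i \<notin> acl (k' \<union> t ` {..<i})} \<subseteq> {i. i < n \<and> t i \<notin> acl (k \<union> t ` {..<i})}" by blast
  moreover have "i \<in> {i. i < n \<and> t i \<notin> acl (k \<union> t ` {..<i})}" "i \<notin> {i. i < n \<and> t i \<notin> acl (k' \<union> t ` {..<i})}"
    using tn ti \<open>m \<le> n\<close> i by auto
  ultimately have "{i. i < n \<and> t i \<notin> acl (k' \<union> t ` {..<i})} \<subset> {i. i < n \<and> t i \<notin> acl (k \<union> t ` {..<i})}" by blast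
  then show ?thesis unfolding independent_generators_def by (intro psubset_card_mono) auto
qed

lemma case_nat_image: "case_nat y u ` {..<Suc i} = insert y (u ` {..<i})"
  by (auto simp: image_iff lessThan_Suc_eq_insert_0)

lemma diff_subfield_diff_adjoin: "diff_subfield D (diff_adjoin D k S)"
  unfolding diff_adjoin_def by (rule hull_in) (fastforce simp: diff_subfield_def subfield_def)

lemma diff_adjoin_superset: "k \<union> S \<subseteq> diff_adjoin D k S"
  unfolding diff_adjoin_def by (rule hull_subset)

lemma diff_adjoin_minimal: "diff_subfield D F \<Longrightarrow> k \<subseteq> F \<Longrightarrow> S \<subseteq> F \<Longrightarrow> diff_adjoin D k S \<subseteq> F"
  unfolding diff_adjoin_def by (rule hull_minimal) auto

lemma diff_adjoin_insert: "diff_adjoin D k (insert y S) = diff_adjoin D (diff_adjoin D k {y}) S"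
  unfolding diff_adjoin_def by (simp add: hull_Un_left[of _ "insert y k" S, symmetric] insert_commute)

lemma satisfies_lhde_mono: "F \<subseteq> G \<Longrightarrow> satisfies_lhde D F y \<Longrightarrow> satisfies_lhde D G y"
  unfolding satisfies_lhde_def by blast

text \<open>
  As long as \<open>K\<close> is not algebraic over the field \<open>k'\<close> reached, an element of \<open>K\<close> that is transcendental
  over \<open>k'\<close> and satisfies a linear equation is adjoined. This lowers the transcendence degree. When
  \<open>K\<close> has become algebraic, finitely many elements generate the rest.
\<close>

lemma lhde_generators:
  fixes D :: "'a::field_char_0 \<Rightarrow> 'a" and n :: nat
  assumes D: "derivation D" and K: "diff_subfield D K" "K \<subseteq> adjoin k (t ` {..<n})"
    and steps: "\<And>i. i < n \<Longrightarrow> D (t i) \<in> acl (k \<union> t ` {..<i}) \<or> t i \<noteq> 0 \<and> D (t i) / t i \<in> acl (k \<union> t ` {..<i})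
      \<or> t i \<in> acl (k \<union> t ` {..<i})"
  shows "diff_subfield D k' \<Longrightarrow> k \<subseteq> k' \<Longrightarrow> k' \<subseteq> K \<Longrightarrow>
    \<exists>(l::nat) u. (\<forall>i<l. u i \<in> K) \<and> K = diff_adjoin D k' (u ` {..<l}) \<and>
        (\<forall>i<l. satisfies_lhde D (diff_adjoin D k' (u ` {..<i})) (u i))"
proof (induction "independent_generators n t k'" arbitrary: k' rule: less_induct)
  case less
  have sk': "subfield k'" and sK: "subfield K" using less.prems(1) K(1) by (auto simp: diff_subfield_def)
  have mono: "acl (k \<union> t ` {..<i}) \<subseteq> acl (k' \<union> t ` {..<i})" for i
    using less.prems(2) by (intro acl_mono) auto
  have K1: "K \<subseteq> adjoin k' (t ` {..<n})" using K(2) adjoin_mono[OF less.prems(2) order_refl] by blast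
  have K2: "K \<subseteq> acl (k' \<union> t ` {..<n})"
    using K1 hull_subset_acl[of "k' \<union> t ` {..<n}"] unfolding adjoin_def by blast
  show ?case
  proof (cases "\<forall>x\<in>K. algebraic_over k' x")
    case True
    then obtain W where W: "finite W" "W \<subseteq> K" "K = adjoin k' W"
      using algebraic_intermediate_finite[OF sk' sK less.prems(3) K1] by blast
    obtain f where f: "bij_betw f {..<card W} W"
      using ex_bij_betw_nat_finite[OF W(1)] by (auto simp: atLeast0LessThan)
    then have fW: "f ` {..<card W} = W" by (simp add: bij_betw_def)
    show ?thesis
    proof (intro exI conjI allI impI)
      show "f i \<in> K" if "i < card W" for i using that fW W(2) by auto
      show "K = diff_adjoin D k' (f ` {..<card W})"
      proof
        have "subfield (diff_adjoin D k' W)" using diff_subfield_diff_adjoin[of D k' W] by (simp add: diff_subfield_def)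
        then have "adjoin k' W \<subseteq> diff_adjoin D k' W"
          using diff_adjoin_superset[of k' W D] by (intro adjoin_minimal) auto
        then show "K \<subseteq> diff_adjoin D k' (f ` {..<card W})" unfolding fW W(3)[symmetric] .
        show "diff_adjoin D k' (f ` {..<card W}) \<subseteq> K"
          unfolding fW by (rule diff_adjoin_minimal[OF K(1) less.prems(3) W(2)])
      qed
      fix i assume "i < card W"
      then have "algebraic_over k' (f i)" using True fW W(2) by blast
      then have "satisfies_lhde D k' (f i)"
        by (intro holonomic_imp_lhde[OF D less.prems(1)] holonomic_algebraic[OF D less.prems(1)])
      then show "satisfies_lhde D (diff_adjoin D k' (f ` {..<i})) (f i)"
        by (rule satisfies_lhde_mono[rotated]) (use diff_adjoin_superset[of k' _ D] in auto)
    qed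
  next
    case False
    then obtain x where x: "x \<in> K" "\<not> algebraic_over k' x" by blast
    have "\<exists>v\<in>K. \<not> algebraic_over k' v \<and> satisfies_lhde D k' v"
    proof (rule linear_element[OF D less.prems(1) K(1) less.prems(3) K2 _ x])
      fix i assume "i < n"
      from steps[OF this] mono[of i]
      show "D (t i) \<in> acl (k' \<union> t ` {..<i}) \<or> t i \<noteq> 0 \<and> D (t i) / t i \<in> acl (k' \<union> t ` {..<i})
        \<or> t i \<in> acl (k' \<union> t ` {..<i})" by blast
    qed
    then obtain y where y: "y \<in> K" "\<not> algebraic_over k' y" "satisfies_lhde D k' y" by blast
    define k2 where "k2 = diff_adjoin D k' {y}"
    have k2: "k' \<subseteq> k2" "y \<in> k2" unfolding k2_def using diff_adjoin_superset[of k' "{y}" D] by auto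
    have "independent_generators n t k2 < independent_generators n t k'"
    proof (rule independent_generators_decrease[OF _ _ k2])
      show "y \<in> acl (k' \<union> t ` {..<n})" using y(1) K2 by blast
      show "y \<notin> acl k'" using y(2) by (simp add: acl_subfield[OF sk'])
    qed
    moreover have "diff_subfield D k2" unfolding k2_def by (rule diff_subfield_diff_adjoin)
    moreover have "k \<subseteq> k2" using less.prems(2) k2 by blast
    moreover have "k2 \<subseteq> K" unfolding k2_def using y(1) by (intro diff_adjoin_minimal[OF K(1) less.prems(3)]) simp
    ultimately obtain l :: nat and u where u: "\<forall>i<l. u i \<in> K" "K = diff_adjoin D k2 (u ` {..<l})"
      "\<forall>i<l. satisfies_lhde D (diff_adjoin D k2 (u ` {..<i})) (u i)"
      using less.hyps[of k2] by blast
    have eq: "diff_adjoin D k' (case_nat y u ` {..<Suc i}) = diff_adjoin D k2 (u ` {..<i})" for i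
      unfolding case_nat_image k2_def by (rule diff_adjoin_insert)
    show ?thesis
    proof (intro exI conjI allI impI)
      show "case_nat y u i \<in> K" if "i < Suc l" for i using that u(1) y(1) by (cases i) auto
      show "K = diff_adjoin D k' (case_nat y u ` {..<Suc l})" unfolding eq by (rule u(2))
      show "satisfies_lhde D (diff_adjoin D k' (case_nat y u ` {..<i})) (case_nat y u i)" if "i < Suc l" for i
      proof (cases i)
        case 0
        have "satisfies_lhde D (diff_adjoin D k' {}) y"
          by (rule satisfies_lhde_mono[OF _ y(3)]) (use diff_adjoin_superset[of k' _ D] in auto)
        then show ?thesis by (simp add: 0)
      next
        case (Suc j)
        then have "j < l" using that by simp
        then show ?thesis unfolding Suc eq using u(3) by simp
      qed
    qed
  qed
qed

section \<open>Iterated antiderivatives\<close>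

text \<open>
  An algebraic \<open>t\<close> would differ from an element of \<open>k\<close> by a constant of
  \<open>E\<close>, which lies in \<open>k\<close>.
\<close>

lemma antiderivative_transcendental:
  fixes D :: "'a::field_char_0 \<Rightarrow> 'a"
  assumes D: "derivation D" and k: "diff_subfield D k" and E: "subfield E" "k \<subseteq> E" "t \<in> E"
    and const: "\<And>c. c \<in> E \<Longrightarrow> D c = 0 \<Longrightarrow> c \<in> k" and t: "D t \<in> k" "t \<notin> k"
  shows "\<not> algebraic_over k t"
proof
  assume "algebraic_over k t"
  then obtain c where c: "c \<in> k" "D (t - c) = 0" using algebraic_antiderivative[OF D k _ t(1)] by metis
  have "subfield k" using k by (simp add: diff_subfield_def)
  have "t - c \<in> k" using c E by (intro const subfield_diff[OF E(1)]) auto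
  then have "(t - c) + c \<in> k" using subfield_add[OF \<open>subfield k\<close>] c(1) by blast
  then show False using t(2) by simp
qed

text \<open>
  Each generator is transcendental over the field before it or contained in it, and a simple
  transcendental extension contains no new algebraic elements.
\<close>

lemma iterated_antiderivative_relatively_closed:
  fixes D :: "'a::field_char_0 \<Rightarrow> 'a" and n :: nat
  assumes D: "derivation D"
  shows "diff_subfield D k \<Longrightarrow> (\<And>i. i < n \<Longrightarrow> D (t i) \<in> adjoin k (t ` {..<i})) \<Longrightarrow>
    (\<And>c. c \<in> adjoin k (t ` {..<n}) \<Longrightarrow> D c = 0 \<Longrightarrow> c \<in> k) \<Longrightarrow>
    y \<in> adjoin k (t ` {..<n}) \<Longrightarrow> algebraic_over k y \<Longrightarrow> y \<in> k"
proof (induction n arbitrary: k t)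
  case 0
  then show ?case using adjoin_empty[of k] by (simp add: diff_subfield_def)
next
  case (Suc n)
  have sk: "subfield k" using Suc.prems(1) by (simp add: diff_subfield_def)
  define L where "L = adjoin k {t 0}"
  have dt: "D (t 0) \<in> k" using Suc.prems(2)[of 0] adjoin_empty[OF sk] by simp
  have kL: "k \<subseteq> L" "t 0 \<in> L" unfolding L_def using adjoin_superset[of k "{t 0}"] by auto
  have E: "adjoin k (t ` {..<Suc i}) = adjoin L ((\<lambda>j. t (Suc j)) ` {..<i})" for i
    unfolding L_def by (rule adjoin_tower_Suc)
  have LE: "L \<subseteq> adjoin L ((\<lambda>j. t (Suc j)) ` {..<n})" using adjoin_superset[of L] by auto
  have dL: "diff_subfield D L" unfolding L_def
    using dt kL(1) unfolding L_def by (intro diff_subfield_adjoin[OF D Suc.prems(1)]) auto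
  have "y \<in> L"
  proof (rule Suc.IH[OF dL, of "\<lambda>j. t (Suc j)"])
    show "D (t (Suc i)) \<in> adjoin L ((\<lambda>j. t (Suc j)) ` {..<i})" if "i < n" for i
      using Suc.prems(2)[of "Suc i"] that unfolding E by simp
    show "c \<in> L" if "c \<in> adjoin L ((\<lambda>j. t (Suc j)) ` {..<n})" "D c = 0" for c
      using Suc.prems(3)[of c] that kL(1) unfolding E by blast
    show "y \<in> adjoin L ((\<lambda>j. t (Suc j)) ` {..<n})" using Suc.prems(4) unfolding E .
    show "algebraic_over L y" by (rule algebraic_over_mono[OF kL(1) Suc.prems(5)])
  qed
  show ?case
  proof (cases "t 0 \<in> k")
    case True
    then have "L = k" unfolding L_def by (intro adjoin_redundant[OF sk]) simp
    then show ?thesis using \<open>y \<in> L\<close> by simp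
  next
    case False
    have "\<not> algebraic_over k (t 0)"
    proof (rule antiderivative_transcendental[OF D Suc.prems(1) subfield_adjoin _ _ Suc.prems(3) dt False])
      show "k \<subseteq> adjoin k (t ` {..<Suc n})" using adjoin_superset[of k] by auto
      show "t 0 \<in> adjoin k (t ` {..<Suc n})" using adjoin_superset[of k "t ` {..<Suc n}"] by auto
    qed
    then show ?thesis using algebraic_in_transcendental_extension[OF sk _ \<open>y \<in> L\<close>[unfolded L_def] Suc.prems(5)] by blast
  qed
qed

text \<open>
  The induction runs as for \<open>first_order_element_closed\<close>, with \<open>k(t 0)\<close> and \<open>K(t 0)\<close> in place of their
  algebraic closures. As \<open>t 0\<close> is transcendental over \<open>K\<close>, Laurent series in \<open>1 / t 0\<close> are enough. The
  expansion shows that \<open>u\<close> has a coefficient outside \<open>k\<close> because \<open>k(t 0)\<close> is relatively algebraically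
  closed in the tower.
\<close>

lemma antiderivative_element:
  fixes D :: "'a::field_char_0 \<Rightarrow> 'a" and n :: nat
  assumes D: "derivation D"
  shows "diff_subfield D k \<Longrightarrow> diff_subfield D K \<Longrightarrow> k \<subseteq> K \<Longrightarrow> K \<subseteq> adjoin k (t ` {..<n}) \<Longrightarrow>
    (\<And>i. i < n \<Longrightarrow> D (t i) \<in> adjoin k (t ` {..<i})) \<Longrightarrow>
    (\<And>c. c \<in> adjoin k (t ` {..<n}) \<Longrightarrow> D c = 0 \<Longrightarrow> c \<in> k) \<Longrightarrow> K \<noteq> k \<Longrightarrow> \<exists>u\<in>K - k. D u \<in> k"
proof (induction n arbitrary: k K t)
  case 0
  then show ?case using adjoin_empty[of k] by (auto simp: diff_subfield_def)
next
  case (Suc n)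
  have sk: "subfield k" and sK: "subfield K" and Dk: "\<And>x. x \<in> k \<Longrightarrow> D x \<in> k" and DK: "\<And>x. x \<in> K \<Longrightarrow> D x \<in> K"
    using Suc.prems(1,2) by (auto simp: diff_subfield_def)
  define f where "f = D (t 0)"
  have f: "f \<in> k" using Suc.prems(5)[of 0] adjoin_empty[OF sk] by (simp add: f_def)
  define L where "L = adjoin k {t 0}"
  define M where "M = adjoin K {t 0}"
  define E where "E = adjoin k (t ` {..<Suc n})"
  define s where "s j = t (Suc j)" for j
  have E: "adjoin k (t ` {..<Suc i}) = adjoin L (s ` {..<i})" for i
    unfolding L_def s_def by (rule adjoin_tower_Suc)
  have sE: "subfield E" unfolding E_def by (rule subfield_adjoin)
  have kE: "k \<subseteq> E" "t 0 \<in> E" unfolding E_def using adjoin_superset[of k "t ` {..<Suc n}"] by auto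
  have KE: "K \<subseteq> E" using Suc.prems(4) by (simp add: E_def)
  have const: "c \<in> k" if "c \<in> E" "D c = 0" for c using Suc.prems(6) that by (simp add: E_def)
  have steps: "D (s i) \<in> adjoin L (s ` {..<i})" if "i < n" for i
    using Suc.prems(5)[of "Suc i"] that unfolding E by (simp add: s_def)
  show ?case
  proof (cases "t 0 \<in> k")
    case True
    then have "L = k" unfolding L_def by (intro adjoin_redundant[OF sk]) simp
    show ?thesis
    proof (rule Suc.IH[OF Suc.prems(1,2,3) _ _ _ Suc.prems(7), of s])
      show "K \<subseteq> adjoin k (s ` {..<n})" using Suc.prems(4) unfolding E \<open>L = k\<close> .
      show "D (s i) \<in> adjoin k (s ` {..<i})" if "i < n" for i using steps[OF that] unfolding \<open>L = k\<close> .
      show "c \<in> k" if "c \<in> adjoin k (s ` {..<n})" "D c = 0" for c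
        using Suc.prems(6)[of c] that unfolding E \<open>L = k\<close> by blast
    qed
  next
    case tk: False
    show ?thesis
    proof (cases "t 0 \<in> K")
      case True
      then show ?thesis using tk f unfolding f_def by blast
    next
      case tK: False
      have trK: "\<not> algebraic_over K (t 0)"
        by (rule antiderivative_transcendental[OF D Suc.prems(2) sE KE kE(2) _ _ tK])
          (use const f Suc.prems(3) f_def in auto)
      have trk: "\<not> algebraic_over k (t 0)" using trK algebraic_over_mono[OF Suc.prems(3)] by blast
      have kL: "k \<subseteq> L" "t 0 \<in> L" unfolding L_def using adjoin_superset[of k "{t 0}"] by auto
      have KM: "K \<subseteq> M" "t 0 \<in> M" unfolding M_def using adjoin_superset[of K "{t 0}"] by auto
      have LM: "L \<subseteq> M" unfolding L_def M_def by (rule adjoin_mono[OF Suc.prems(3)]) simp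
      have sL: "subfield L" and sM: "subfield M" unfolding L_def M_def by (rule subfield_adjoin)+
      have dL: "diff_subfield D L" unfolding L_def
        using f kL(1) unfolding L_def f_def by (intro diff_subfield_adjoin[OF D Suc.prems(1)]) auto
      have dM: "diff_subfield D M" unfolding M_def
        using f Suc.prems(3) KM(1) unfolding M_def f_def by (intro diff_subfield_adjoin[OF D Suc.prems(2)]) auto
      have ME: "M \<subseteq> adjoin L (s ` {..<n})" unfolding M_def E[symmetric] E_def[symmetric]
        using KE kE by (intro adjoin_minimal[OF sE]) auto
      have constL: "c \<in> L" if "c \<in> adjoin L (s ` {..<n})" "D c = 0" for c
        using const[of c] that kL(1) unfolding E_def E by blast
      have "M \<noteq> L"
      proof
        assume "M = L"
        obtain x where x: "x \<in> K" "x \<notin> k" using Suc.prems(3,7) by blast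
        then have xL: "x \<in> adjoin k {t 0}" using KM(1) \<open>M = L\<close> by (auto simp: L_def)
        have "\<not> algebraic_over k x"
          using algebraic_in_transcendental_extension[OF sk trk xL] x(2) by blast
        then have nx: "x \<notin> acl k" by (simp add: acl_subfield[OF sk])
        have "x \<in> acl (k \<union> {t 0})" using xL unfolding adjoin_def by (rule subsetD[OF hull_subset_acl])
        then have "t 0 \<in> acl (k \<union> {x})" by (rule acl_exchange[OF _ nx])
        moreover have "acl (k \<union> {x}) \<subseteq> acl K" using x(1) Suc.prems(3) by (intro acl_mono) auto
        ultimately show False using trK acl_subfield[OF sK] by blast
      qed
      then obtain u where u: "u \<in> M" "u \<notin> L" "D u \<in> L"
        using Suc.IH[OF dL dM LM ME steps constL] by blast
      have nalg: "\<not> algebraic_over L u"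
        using iterated_antiderivative_relatively_closed[OF D dL steps constL] u(1,2) ME by blast
      obtain \<phi> where \<phi>: "field_hom_on M \<phi>" "\<And>c. c \<in> K \<Longrightarrow> \<phi> c = fls_const c" "\<phi> (t 0) = fls_X_intpow (- 1)"
        using expansion_at_infinity[OF sK trK] unfolding M_def by metis
      \<comment> \<open>Here \<open>X\<close> represents \<open>1 / t 0\<close>, whose derivative is \<open>- f X\<^sup>2\<close>.\<close>
      define \<delta> where "\<delta> = series_derivation D (- f) 1"
      have \<delta>: "derivation \<delta>" unfolding \<delta>_def by (rule derivation_series_derivation[OF D])
      have "\<phi> (D (t 0)) = \<delta> (\<phi> (t 0))"
      proof -
        have "\<delta> (\<phi> (t 0)) = fls_const (- f * of_int (- 1)) * fls_X_intpow (- 1 + int 1)"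
          unfolding \<delta>_def \<phi>(3) by (rule series_derivation_X_intpow[OF D])
        moreover have "\<phi> f = fls_const f" using f Suc.prems(3) by (intro \<phi>(2)) auto
        ultimately show ?thesis by (simp add: f_def)
      qed
      moreover have "\<phi> (D c) = \<delta> (\<phi> c)" if "c \<in> K" for c
        using that DK by (simp add: \<phi>(2) \<delta>_def series_derivation_const[OF D])
      ultimately have "M \<subseteq> {x \<in> M. \<phi> (D x) = \<delta> (\<phi> x)}"
        using KM unfolding M_def
        by (intro adjoin_minimal hom_derivation_subfield[OF dM[unfolded M_def] \<phi>(1)[unfolded M_def] D \<delta>]) auto
      then have compat: "\<phi> (D x) = series_derivation D (- f) 1 (\<phi> x)" if "x \<in> M" for x
        using that unfolding \<delta>_def by auto
      have coeffs: "\<phi> ` adjoin F {t 0} \<subseteq> series_over F" if F: "subfield F" "F \<subseteq> K" for F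
        using F KM \<phi>(2) series_over_const[OF F(1)] series_over_X_intpow[OF F(1), of "- 1", folded \<phi>(3)]
        by (intro hom_adjoin_subset[OF sM \<phi>(1) subfield_series_over[OF F(1)]]) auto
      have zero: "0 \<in> L" by (rule subfield_0[OF sL])
      show "\<exists>v\<in>K - k. D v \<in> k"
      proof (rule first_order_from_expansion[OF D Suc.prems(1,2,3) dM KM(1) \<phi>(1,2) compat _ KM(2) _ trk u(1), of 0 "D u"])
        show "- f \<in> k" using f by (rule subfield_uminus[OF sk])
        show "\<phi> (t 0) \<in> series_over k" unfolding \<phi>(3) by (rule series_over_X_intpow[OF sk])
        show "\<phi> u \<in> series_over K" using coeffs[OF sK order_refl] u(1) unfolding M_def by blast
        show "algebraic_over (adjoin K {t 0}) u" using algebraic_over_self[OF sM u(1)] unfolding M_def .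
        show "\<not> algebraic_over (adjoin k {t 0}) u" using nalg unfolding L_def .
        show "0 \<in> M" "D u \<in> M" using u(3) zero LM by auto
        show "\<phi> 0 \<in> series_over k" "\<phi> (D u) \<in> series_over k"
          using coeffs[OF sk Suc.prems(3)] u(3) zero unfolding L_def by blast+
        show "D u = 0 * u + D u" by simp
        fix v a' b'
        assume v: "v \<in> K - k" "b' \<in> k" "D v = a' * v + b'" and "(0::'a) = 0 \<Longrightarrow> (1::nat) > 0 \<Longrightarrow> a' = 0"
        then have "a' = 0" by simp
        then have "D v \<in> k" using v(2,3) by simp
        then show "\<exists>v\<in>K - k. D v \<in> k" using v(1) by (rule_tac bexI)
      qed
    qed
  qed
qed

text \<open>
  Antiderivatives of elements of the field reached are adjoined as long as that field differs from
  \<open>K\<close>. Each of them is transcendental, so the transcendence degree decreases.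
\<close>

lemma antiderivative_generators:
  fixes D :: "'a::field_char_0 \<Rightarrow> 'a" and n :: nat
  assumes D: "derivation D" and K: "diff_subfield D K" "K \<subseteq> adjoin k (t ` {..<n})"
    and steps: "\<And>i. i < n \<Longrightarrow> D (t i) \<in> adjoin k (t ` {..<i})"
    and const: "\<And>c. c \<in> adjoin k (t ` {..<n}) \<Longrightarrow> D c = 0 \<Longrightarrow> c \<in> k"
  shows "diff_subfield D k' \<Longrightarrow> k \<subseteq> k' \<Longrightarrow> k' \<subseteq> K \<Longrightarrow>
    \<exists>(m::nat) v. K = adjoin k' (v ` {..<m}) \<and> (\<forall>i<m. D (v i) \<in> adjoin k' (v ` {..<i}))"
proof (induction "independent_generators n t k'" arbitrary: k' rule: less_induct)
  case less
  have sk': "subfield k'" using less.prems(1) by (simp add: diff_subfield_def)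
  have E: "adjoin k' (t ` {..<n}) = adjoin k (t ` {..<n})"
  proof
    show "adjoin k' (t ` {..<n}) \<subseteq> adjoin k (t ` {..<n})"
      using less.prems(3) K(2) adjoin_superset[of k "t ` {..<n}"] by (intro adjoin_minimal subfield_adjoin) auto
    show "adjoin k (t ` {..<n}) \<subseteq> adjoin k' (t ` {..<n})" by (rule adjoin_mono[OF less.prems(2) order_refl])
  qed
  have steps': "D (t i) \<in> adjoin k' (t ` {..<i})" if "i < n" for i
    using steps[OF that] adjoin_mono[OF less.prems(2) order_refl] by blast
  have const': "c \<in> k'" if "c \<in> adjoin k' (t ` {..<n})" "D c = 0" for c
    using const that less.prems(2) unfolding E by blast
  have KE: "K \<subseteq> adjoin k' (t ` {..<n})" using K(2) unfolding E .
  show ?case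
  proof (cases "K = k'")
    case True
    then show ?thesis using adjoin_empty[OF sk'] by (intro exI[of _ 0] exI[of _ t]) simp
  next
    case False
    then obtain y where y: "y \<in> K" "y \<notin> k'" "D y \<in> k'"
      using antiderivative_element[OF D less.prems(1) K(1) less.prems(3) KE steps' const'] by blast
    have nalg: "\<not> algebraic_over k' y"
      using iterated_antiderivative_relatively_closed[OF D less.prems(1) steps' const'] y KE by blast
    define k2 where "k2 = adjoin k' {y}"
    have k2: "k' \<subseteq> k2" "y \<in> k2" unfolding k2_def using adjoin_superset[of k' "{y}"] by auto
    have "independent_generators n t k2 < independent_generators n t k'"
    proof (rule independent_generators_decrease[OF _ _ k2])
      show "y \<in> acl (k' \<union> t ` {..<n})"
        using y(1) KE hull_subset_acl[of "k' \<union> t ` {..<n}"] unfolding adjoin_def by blast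
      show "y \<notin> acl k'" using nalg by (simp add: acl_subfield[OF sk'])
    qed
    moreover have "diff_subfield D k2" unfolding k2_def
      using y(3) k2(1) unfolding k2_def by (intro diff_subfield_adjoin[OF D less.prems(1)]) auto
    moreover have "k \<subseteq> k2" using less.prems(2) k2 by blast
    moreover have "k2 \<subseteq> K" unfolding k2_def
      using y(1) K(1) less.prems(3) by (intro adjoin_minimal) (auto simp: diff_subfield_def)
    ultimately obtain m :: nat and v where v: "K = adjoin k2 (v ` {..<m})" "\<forall>i<m. D (v i) \<in> adjoin k2 (v ` {..<i})"
      using less.hyps[of k2] by blast
    have eq: "adjoin k' (case_nat y v ` {..<Suc i}) = adjoin k2 (v ` {..<i})" for i
      unfolding case_nat_image k2_def adjoin_adjoin by simp
    show ?thesis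
    proof (intro exI conjI allI impI)
      show "K = adjoin k' (case_nat y v ` {..<Suc m})" unfolding eq by (rule v(1))
      show "D (case_nat y v i) \<in> adjoin k' (case_nat y v ` {..<i})" if "i < Suc m" for i
      proof (cases i)
        case 0
        then show ?thesis using y(3) adjoin_empty[OF sk'] by simp
      next
        case (Suc j)
        then have "j < m" using that by simp
        then show ?thesis unfolding Suc eq using v(2) by simp
      qed
    qed
  qed
qed

lemma diff_tower_field:
  assumes "diff_tower D k E n t F" "i \<le> n"
  shows "F i = adjoin k (t ` {..<i})"
  using assms(2)
proof (induction i)
  case 0
  have "subfield k" using assms(1) by (auto simp: diff_tower_def diff_subfield_def)
  then show ?case using assms(1) adjoin_empty[of k] by (simp add: diff_tower_def)
next
  case (Suc i)
  then have "F (Suc i) = adjoin (adjoin k (t ` {..<i})) {t i}" using assms(1) by (simp add: diff_tower_def)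
  then show ?case unfolding adjoin_adjoin by (simp add: lessThan_Suc)
qed

lemma iterated_antiderivative_extI:
  fixes m :: nat
  assumes D: "derivation D" and k: "diff_subfield D k" and K: "K = adjoin k (v ` {..<m})"
    and v: "\<And>i. i < m \<Longrightarrow> D (v i) \<in> adjoin k (v ` {..<i})"
  shows "iterated_antiderivative_ext D k K"
proof -
  define F where "F i = adjoin k (v ` {..<i})" for i
  have sk: "subfield k" using k by (simp add: diff_subfield_def)
  have Suc: "F (Suc i) = adjoin (F i) {v i}" for i
    unfolding F_def adjoin_adjoin by (simp add: lessThan_Suc)
  have "diff_subfield D (F i)" if "i \<le> m" for i
    using that
  proof (induction i)
    case 0
    then show ?case using k adjoin_empty[OF sk] by (simp add: F_def)
  next
    case (Suc i)
    then have "diff_subfield D (F i)" "D (v i) \<in> F i" using v by (auto simp: F_def)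
    moreover have "F i \<subseteq> adjoin (F i) {v i}" using adjoin_superset[of "F i" "{v i}"] by auto
    ultimately show ?case unfolding \<open>\<And>i. F (Suc i) = adjoin (F i) {v i}\<close>
      by (intro diff_subfield_adjoin[OF D]) auto
  qed
  then have "diff_tower D k K m v F"
    using K Suc adjoin_empty[OF sk] by (simp add: diff_tower_def F_def)
  moreover have "\<forall>i<m. D (v i) \<in> F i" using v by (simp add: F_def)
  ultimately show ?thesis unfolding iterated_antiderivative_ext_def by blast
qed

section \<open>Intermediate fields of liouvillian extensions\<close>

theorem theorem2p2:
  fixes D :: "'a::field_char_0 \<Rightarrow> 'a" and k K E :: "'a set"
  assumes "derivation D"
    and "diff_subfield D k" and "diff_subfield D K" and "diff_subfield D E"
    and "liouvillian_ext D k E"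
    and "k \<subseteq> K" and "K \<subseteq> E"
  shows
    "(\<exists>(l::nat) (u::nat \<Rightarrow> 'a). (\<forall>i<l. u i \<in> K) \<and> K = diff_adjoin D k (u ` {..<l}) \<and>
        (\<forall>i<l. satisfies_lhde D (diff_adjoin D k (u ` {..<i})) (u i)))
     \<and>
     (iterated_antiderivative_ext D k E \<and> constants D E = constants D k \<longrightarrow>
        iterated_antiderivative_ext D k K \<and>
        (\<exists>(m::nat) (v::nat \<Rightarrow> 'a). K = adjoin k (v ` {..<m}) \<and> (\<forall>i<m. D (v i) \<in> adjoin k (v ` {..<i}))))
     \<and>
     (alg_closed k \<and> K \<noteq> k \<longrightarrow>
        (\<exists>u\<in>K - k. \<exists>a\<in>k. \<exists>b\<in>k. D u = a * u + b))
     \<and>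
     (alg_closed k \<and> (\<forall>c\<in>k. D c = 0) \<and> K \<noteq> k \<longrightarrow>
        (\<exists>z\<in>K - k. D z = 1 \<or> (\<exists>a\<in>k. D z = a * z)))"
proof -
  note D = assms(1) and k = assms(2) and K = assms(3)
  have sk: "subfield k" and sK: "subfield K" using k K by (auto simp: diff_subfield_def)
  obtain n t F where tower: "diff_tower D k E n t F"
    and lst: "\<And>i. i < n \<Longrightarrow> D (t i) \<in> F i \<or> (t i \<noteq> 0 \<and> D (t i) / t i \<in> F i) \<or> algebraic_over (F i) (t i)"
    using assms(5) unfolding liouvillian_ext_def by blast
  have EF: "E = adjoin k (t ` {..<n})" using tower by (simp add: diff_tower_def)
  have F: "F i = adjoin k (t ` {..<i})" if "i < n" for i using diff_tower_field[OF tower] that by simp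
  have steps: "D (t i) \<in> acl (k \<union> t ` {..<i}) \<or> t i \<noteq> 0 \<and> D (t i) / t i \<in> acl (k \<union> t ` {..<i})
      \<or> t i \<in> acl (k \<union> t ` {..<i})" if "i < n" for i
  proof -
    have "F i \<subseteq> acl (k \<union> t ` {..<i})" unfolding F[OF that] adjoin_def by (rule hull_subset_acl)
    moreover have "t i \<in> acl (k \<union> t ` {..<i})" if "algebraic_over (F i) (t i)"
      using that unfolding F[OF \<open>i < n\<close>] by (simp add: acl_def adjoin_def)
    ultimately show ?thesis using lst[OF that] by blast
  qed
  have KE: "K \<subseteq> adjoin k (t ` {..<n})" using assms(7) EF by simp
  have Kacl: "K \<subseteq> acl (k \<union> t ` {..<n})"
    using KE hull_subset_acl[of "k \<union> t ` {..<n}"] unfolding adjoin_def by blast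
  have I: "\<exists>(l::nat) (u::nat \<Rightarrow> 'a). (\<forall>i<l. u i \<in> K) \<and> K = diff_adjoin D k (u ` {..<l}) \<and>
        (\<forall>i<l. satisfies_lhde D (diff_adjoin D k (u ` {..<i})) (u i))"
    by (rule lhde_generators[OF D K KE steps k order_refl assms(6)])
  have II: "iterated_antiderivative_ext D k K \<and>
        (\<exists>(m::nat) (v::nat \<Rightarrow> 'a). K = adjoin k (v ` {..<m}) \<and> (\<forall>i<m. D (v i) \<in> adjoin k (v ` {..<i})))"
    if it: "iterated_antiderivative_ext D k E" and const: "constants D E = constants D k"
  proof -
    obtain n s G where G: "diff_tower D k E n s G" "\<And>i. i < n \<Longrightarrow> D (s i) \<in> G i"
      using it unfolding iterated_antiderivative_ext_def by blast
    have E: "E = adjoin k (s ` {..<n})" using G(1) by (simp add: diff_tower_def)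
    have "D (s i) \<in> adjoin k (s ` {..<i})" if "i < n" for i
      using G(2)[OF that] diff_tower_field[OF G(1), of i] that by simp
    moreover have "c \<in> k" if "c \<in> adjoin k (s ` {..<n})" "D c = 0" for c
    proof -
      have "c \<in> constants D E" using that E by (simp add: constants_def)
      then show ?thesis unfolding const by (simp add: constants_def)
    qed
    moreover have "K \<subseteq> adjoin k (s ` {..<n})" using assms(7) E by simp
    ultimately obtain m :: nat and v where "K = adjoin k (v ` {..<m})" "\<forall>i<m. D (v i) \<in> adjoin k (v ` {..<i})"
      using antiderivative_generators[OF D K _ _ _ k order_refl assms(6), of s n] by blast
    then show ?thesis using iterated_antiderivative_extI[OF D k] by blast
  qed
  have III: "\<exists>u\<in>K - k. \<exists>a\<in>k. \<exists>b\<in>k. D u = a * u + b" if ac: "alg_closed k" and ne: "K \<noteq> k"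
  proof -
    obtain x where x: "x \<in> K" "x \<notin> k" using ne assms(6) by blast
    have "\<not> algebraic_over k x"
    proof
      assume "algebraic_over k x"
      then have "to_ac x \<in> to_ac ` k"
        by (intro alg_closed_algebraic[OF sk ac]) (simp add: algebraic_over_to_ac_iff[OF sk])
      then show False using x(2) by auto
    qed
    then show ?thesis using first_order_element[OF D k K assms(6) Kacl steps x(1) _ ac] by blast
  qed
  have IV: "\<exists>z\<in>K - k. D z = 1 \<or> (\<exists>a\<in>k. D z = a * z)"
    if ac: "alg_closed k" and const: "\<forall>c\<in>k. D c = 0" and ne: "K \<noteq> k"
  proof -
    obtain u a b where u: "u \<in> K" "u \<notin> k" "a \<in> k" "b \<in> k" "D u = a * u + b" using III[OF ac ne] by blast
    \<comment> \<open>As \<open>a\<close> and \<open>b\<close> are constants, \<open>u\<close> becomes exponential after adding \<open>b / a\<close>, and for \<open>a = 0\<close> it is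
      a constant or \<open>b\<close> times an element with derivative 1.\<close>
    consider "a \<noteq> 0" | "a = 0" "b = 0" | "a = 0" "b \<noteq> 0" by blast
    then show ?thesis
    proof cases
      case 1
      have ba: "b / a \<in> k" using u by (intro subfield_divide[OF sk])
      have "D (u + b / a) = a * (u + b / a)"
        using 1 u(5) const ba by (simp add: derivation_add[OF D] distrib_left)
      moreover have "u + b / a \<in> K" using u(1) ba assms(6) by (intro subfield_add[OF sK]) auto
      moreover have "u + b / a \<notin> k"
        using subfield_diff[OF sk _ ba, of "u + b / a"] u(2) by auto
      ultimately show ?thesis using u(3) by blast
    next
      case 2
      then have "D u = 0 * u" using u(5) by simp
      then show ?thesis using u subfield_0[OF sk] by blast
    next
      case 3
      have ib: "inverse b \<in> k" using u by (intro subfield_inverse[OF sk])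
      have "D (u * inverse b) = 1"
        using 3 u(5) const ib by (simp add: derivation_mult[OF D])
      moreover have "u * inverse b \<in> K" using u(1) ib assms(6) by (intro subfield_mult[OF sK]) auto
      moreover have "u * inverse b \<notin> k"
        using subfield_mult[OF sk _ u(4), of "u * inverse b"] u(2) 3 by (auto simp: mult.assoc)
      ultimately show ?thesis by blast
    qed
  qed
  show ?thesis using I II III IV by blast
qed

end
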